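(* Let $H$ be a complex Hilbert space, let $a, b \in E(H)$ and let $\mathcal{M}_1$ be the von Neumann algebra generated by $a$ and $b$. Let $x_0 \in B(H)^+$ lie in the centre of $\mathcal{M}_1$ with $\Vert x_0 \Vert < 1$. Then the following are equivalent: (i) $a \triangle_{x_0} b$, and $(I - x_0)^{-1}(a - \frac12 x_0)$ and $(I - x_0)^{-1}(b - \frac12 x_0)$ are strict in $\mathcal{M}_1$; (ii) there exist $\mathbb{M}_2$-strict projections $p$ and $q$ in $\mathcal{M}_1$ and strict positive elements $w_1$ and $w_2$ in the centre of $\mathcal{M}_1$ with $w_1 + w_2 = I - x_0$ such that $$a = x_0 c + w_1 p + w_2 q \quad\text{and}\quad b = x_0 c + w_1 p + w_2 q',$$ where $c := \frac12 I$ and $q' := I - q$.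
   Context: $B(H)$ is the algebra of bounded linear operators on $H$, $B(H)^+$ its positive operators, $I$ the identity operator, and $E(H) = \{a \in B(H) : a = a^*,\ 0 \le a \le I\}$ the set of effects. The von Neumann algebra generated by $a$ and $b$ contains $I$. For $u \in B(H)$, $|u| := (u^*u)^{1/2}$. The relation $a \triangle_{x_0} b$ ($a$ is $x_0$-compatible with $b$) means $|a - b| + |I - a - b| = I - x_0$. Strict elements: an element $x$ of a von Neumann algebra $\mathcal{M}$ with $0 \le x \le 1$ is strict in $\mathcal{M}$ if, whenever $p, q$ are projections in $\mathcal{M}$ with $p \le x \le q$, one has $p = 0$ and $q = 1$. In (ii), $w_1$ and $w_2$ are strict in $\mathcal{M}_1$. $\mathbb{M}_2$-strict projections: for an abelian von Neumann algebra $\mathcal{M}_0$ with identity $I_0$, a projection in $\mathbb{M}_2(\mathcal{M}_0)$ is called $\mathbb{M}_2$-strict if it has the form $\begin{bmatrix} p_1^2 & p_1 p_2 \\ p_1 p_2 & p_2^2 \end{bmatrix}$ with $p_1, p_2$ strict elements of $\mathcal{M}_0$ satisfying $p_1^2 + p_2^2 = I_0$. Saying that $p$ and $q$ are $\mathbb{M}_2$-strict projections in $\mathcal{M}_1$ means that there are an abelian von Neumann algebra $\mathcal{M}_0$ and a $*$-isomorphism of $\mathcal{M}_1$ onto $\mathbb{M}_2(\mathcal{M}_0)$ under which both $p$ and $q$ correspond to $\mathbb{M}_2$-strict projections of $\mathbb{M}_2(\mathcal{M}_0)$. *)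

theory Defs
  imports "HOL-Analysis.Analysis"
begin

section \<open>Complex Hilbert spaces\<close>

text \<open>The complex inner product is linear in its first argument. The class extends the library's
  real inner product spaces; the underlying real inner product is the real part of the complex
  one, so that \<^term>\<open>norm x\<close> is the usual Hilbert space norm (lemma \<open>cinner_self\<close>).\<close>

class complex_hilbert_space = real_inner + complete_space +
  fixes scaleC :: "complex \<Rightarrow> 'a \<Rightarrow> 'a" (infixr "*\<^sub>C" 75)
    and cinner :: "'a \<Rightarrow> 'a \<Rightarrow> complex"
  assumes scaleC_add_right: "c *\<^sub>C (x + y) = c *\<^sub>C x + c *\<^sub>C y"
    and scaleC_add_left: "(c + d) *\<^sub>C x = c *\<^sub>C x + d *\<^sub>C x"
    and scaleC_scaleC: "c *\<^sub>C (d *\<^sub>C x) = (c * d) *\<^sub>C x"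
    and scaleC_of_real: "complex_of_real r *\<^sub>C x = r *\<^sub>R x"
    and cinner_commute: "cinner x y = cnj (cinner y x)"
    and cinner_add_left: "cinner (x + y) z = cinner x z + cinner y z"
    and cinner_scaleC_left: "cinner (c *\<^sub>C x) y = c * cinner x y"
    and inner_eq_Re_cinner: "inner x y = Re (cinner x y)"
begin

subclass banach ..

end

lemma cinner_self: "cinner x x = complex_of_real ((norm x)\<^sup>2)"
proof (rule complex_eqI)
  show "Re (cinner x x) = Re (complex_of_real ((norm x)\<^sup>2))"
    by (simp add: power2_norm_eq_inner inner_eq_Re_cinner)
  have "Im (cinner x x) = Im (cnj (cinner x x))"
    using cinner_commute[of x x] by simp
  then show "Im (cinner x x) = Im (complex_of_real ((norm x)\<^sup>2))" by simp
qed

lemma norm_scaleC: "norm (c *\<^sub>C x) = cmod c * norm (x :: 'a::complex_hilbert_space)"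
proof -
  have "cinner (c *\<^sub>C x) (c *\<^sub>C x) = c * (cnj c * cinner x x)"
    by (metis cinner_commute cinner_scaleC_left complex_cnj_cnj complex_cnj_mult)
  also have "\<dots> = complex_of_real ((cmod c * norm x)\<^sup>2)"
    by (simp add: cinner_self power_mult_distrib complex_mult_cnj cmod_power2 flip: of_real_power)
  finally have "(norm (c *\<^sub>C x))\<^sup>2 = (cmod c * norm x)\<^sup>2"
    by (metis cinner_self of_real_eq_iff)
  then show ?thesis by (simp add: power2_eq_iff_nonneg)
qed

instantiation complex :: complex_hilbert_space
begin

definition scaleC_complex :: "complex \<Rightarrow> complex \<Rightarrow> complex"
  where "scaleC_complex c x = c * x"

definition cinner_complex :: "complex \<Rightarrow> complex \<Rightarrow> complex"
  where "cinner_complex x y = x * cnj y"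

instance
  by standard
    (auto simp: scaleC_complex_def cinner_complex_def algebra_simps scaleR_conv_of_real inner_complex_def)

end


section \<open>Bounded operators\<close>

text \<open>The library type \<open>'a \<Rightarrow>\<^sub>L 'a\<close> consists of the bounded real-linear maps. The
  algebra \<open>B(H)\<close> is its subset \<open>bounded_ops\<close> of complex-linear maps, with the library's composition
  \<open>o\<^sub>L\<close>, identity \<^term>\<open>id_blinfun\<close> and operator norm.\<close>

type_synonym 'a endo = "'a \<Rightarrow>\<^sub>L 'a"

definition bounded_ops :: "'a::complex_hilbert_space endo set"
  where "bounded_ops = {T :: 'a endo. \<forall>c x. T (c *\<^sub>C x) = c *\<^sub>C T x}"

lift_definition scaleC_op :: "complex \<Rightarrow> 'a::complex_hilbert_space endo \<Rightarrow> 'a endo"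
  is "\<lambda>c T x. c *\<^sub>C T x"
proof -
  fix c :: complex and T :: "'a \<Rightarrow> 'a"
  assume "bounded_linear T"
  moreover have "bounded_linear (\<lambda>x::'a. c *\<^sub>C x)"
  proof (rule bounded_linear_intro)
    show "c *\<^sub>C (r *\<^sub>R x) = r *\<^sub>R (c *\<^sub>C x)" for r and x :: 'a
      by (metis mult.commute scaleC_of_real scaleC_scaleC)
    show "norm (c *\<^sub>C x) \<le> norm x * cmod c" for x :: 'a
      by (simp add: norm_scaleC mult.commute)
  qed (rule scaleC_add_right)
  ultimately show "bounded_linear (\<lambda>x. c *\<^sub>C T x)"
    using bounded_linear_compose by blast
qed

definition adj :: "'a::complex_hilbert_space endo \<Rightarrow> 'a endo"
  where "adj T = (THE S :: 'a endo. \<forall>x y. cinner (T x) y = cinner x (S y))"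

definition positive_op :: "'a::complex_hilbert_space endo \<Rightarrow> bool"
  where "positive_op T \<longleftrightarrow> T \<in> bounded_ops \<and> (\<forall>x. cinner (T x) x \<in> \<real>\<^sub>\<ge>\<^sub>0)"

definition op_le :: "'a::complex_hilbert_space endo \<Rightarrow> 'a endo \<Rightarrow> bool" (infix "\<preceq>" 50)
  where "S \<preceq> T \<longleftrightarrow> positive_op (T - S)"

definition inv_op :: "'a::complex_hilbert_space endo \<Rightarrow> 'a endo"
  where "inv_op T = (THE S :: 'a endo. S o\<^sub>L T = id_blinfun \<and> T o\<^sub>L S = id_blinfun)"

definition sqrt_op :: "'a::complex_hilbert_space endo \<Rightarrow> 'a endo"
  where "sqrt_op T = (THE S :: 'a endo. positive_op S \<and> S o\<^sub>L S = T)"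

definition abs_op :: "'a::complex_hilbert_space endo \<Rightarrow> 'a endo"
  where "abs_op u = sqrt_op (adj u o\<^sub>L u)"

definition projection :: "'a::complex_hilbert_space endo \<Rightarrow> bool"
  where "projection p \<longleftrightarrow> p \<in> bounded_ops \<and> adj p = p \<and> p o\<^sub>L p = p"

definition effects :: "'a::complex_hilbert_space endo set"
  where "effects = {a \<in> bounded_ops. adj a = a \<and> 0 \<preceq> a \<and> a \<preceq> id_blinfun}"

definition compatible :: "'a::complex_hilbert_space endo \<Rightarrow> 'a endo \<Rightarrow> 'a endo \<Rightarrow> bool"
  where "compatible x\<^sub>0 a b \<longleftrightarrow>
    abs_op (a - b) + abs_op (id_blinfun - a - b) = id_blinfun - x\<^sub>0"


section \<open>Von Neumann algebras\<close>

text \<open>\<open>von_neumann_algebra M e\<close>: \<open>M\<close> is a strongly closed \<open>*\<close>-subalgebra of \<open>B(H)\<close> with identity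
  \<open>e\<close>. Then \<open>e\<close> is a projection, and \<open>M\<close> is a von Neumann algebra in the usual sense on the range
  of \<open>e\<close>, with elements extended by zero to the orthogonal complement. Algebras acting
  nondegenerately on \<open>H\<close> are those with \<open>e = id_blinfun\<close>.\<close>

definition von_neumann_algebra :: "'a::complex_hilbert_space endo set \<Rightarrow> 'a endo \<Rightarrow> bool"
  where "von_neumann_algebra M e \<longleftrightarrow>
    M \<subseteq> bounded_ops \<and>
    (\<forall>x\<in>M. \<forall>y\<in>M. x + y \<in> M \<and> x o\<^sub>L y \<in> M) \<and>
    (\<forall>c. \<forall>x\<in>M. scaleC_op c x \<in> M) \<and>
    (\<forall>x\<in>M. adj x \<in> M) \<and>
    e \<in> M \<and> (\<forall>x\<in>M. e o\<^sub>L x = x \<and> x o\<^sub>L e = x) \<and>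
    closedin strong_operator_topology M"

definition generated_vna :: "'a::complex_hilbert_space endo set \<Rightarrow> 'a endo set"
  where "generated_vna S = (\<lambda>M. von_neumann_algebra M id_blinfun) hull S"

definition centre :: "'a::complex_hilbert_space endo set \<Rightarrow> 'a endo set"
  where "centre M = {z \<in> M. \<forall>x\<in>M. z o\<^sub>L x = x o\<^sub>L z}"

definition abelian :: "'a::complex_hilbert_space endo set \<Rightarrow> bool"
  where "abelian M \<longleftrightarrow> (\<forall>x\<in>M. \<forall>y\<in>M. x o\<^sub>L y = y o\<^sub>L x)"

text \<open>\<open>strict_in M e x\<close>: \<open>x\<close> is strict in the von Neumann algebra \<open>M\<close> with identity \<open>e\<close>.\<close>

definition strict_in ::
    "'a::complex_hilbert_space endo set \<Rightarrow> 'a endo \<Rightarrow> 'a endo \<Rightarrow> bool"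
  where "strict_in M e x \<longleftrightarrow>
    x \<in> M \<and> 0 \<preceq> x \<and> x \<preceq> e \<and>
    (\<forall>p\<in>M. \<forall>q\<in>M. projection p \<and> projection q \<and> p \<preceq> x \<and> x \<preceq> q \<longrightarrow> p = 0 \<and> q = e)"


section \<open>Two-by-two matrices over a von Neumann algebra\<close>

text \<open>The library product \<open>**\<close> needs a semiring of entries, which \<open>'a \<Rightarrow>\<^sub>L 'a\<close> is not
  declared to be. Addition of matrices is the library's entrywise one.\<close>

definition M2 :: "'a::complex_hilbert_space endo set \<Rightarrow> ('a endo ^ 2 ^ 2) set"
  where "M2 M = {A. \<forall>i j. A $ i $ j \<in> M}"

definition mat_mult ::
    "'a::complex_hilbert_space endo ^ 2 ^ 2 \<Rightarrow> 'a endo ^ 2 ^ 2 \<Rightarrow> 'a endo ^ 2 ^ 2"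
  where "mat_mult A B = (\<chi> i j. \<Sum>k\<in>UNIV. A $ i $ k o\<^sub>L B $ k $ j)"

definition mat_scaleC ::
    "complex \<Rightarrow> 'a::complex_hilbert_space endo ^ 2 ^ 2 \<Rightarrow> 'a endo ^ 2 ^ 2"
  where "mat_scaleC c A = (\<chi> i j. scaleC_op c (A $ i $ j))"

definition mat_adj :: "'a::complex_hilbert_space endo ^ 2 ^ 2 \<Rightarrow> 'a endo ^ 2 ^ 2"
  where "mat_adj A = (\<chi> i j. adj (A $ j $ i))"

definition star_isomorphism_M2 ::
    "('a::complex_hilbert_space endo \<Rightarrow> 'b::complex_hilbert_space endo ^ 2 ^ 2) \<Rightarrow>
     'a endo set \<Rightarrow> 'b endo set \<Rightarrow> bool"
  where "star_isomorphism_M2 \<Phi> M M\<^sub>0 \<longleftrightarrow>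
    bij_betw \<Phi> M (M2 M\<^sub>0) \<and>
    (\<forall>x\<in>M. \<forall>y\<in>M. \<Phi> (x + y) = \<Phi> x + \<Phi> y) \<and>
    (\<forall>c. \<forall>x\<in>M. \<Phi> (scaleC_op c x) = mat_scaleC c (\<Phi> x)) \<and>
    (\<forall>x\<in>M. \<forall>y\<in>M. \<Phi> (x o\<^sub>L y) = mat_mult (\<Phi> x) (\<Phi> y)) \<and>
    (\<forall>x\<in>M. \<Phi> (adj x) = mat_adj (\<Phi> x))"

definition M2_strict ::
    "'a::complex_hilbert_space endo set \<Rightarrow> 'a endo \<Rightarrow> 'a endo ^ 2 ^ 2 \<Rightarrow> bool"
  where "M2_strict M\<^sub>0 e P \<longleftrightarrow>
    P \<in> M2 M\<^sub>0 \<and> mat_adj P = P \<and> mat_mult P P = P \<and>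
    (\<exists>p\<^sub>1 p\<^sub>2. strict_in M\<^sub>0 e p\<^sub>1 \<and> strict_in M\<^sub>0 e p\<^sub>2 \<and>
      (p\<^sub>1 o\<^sub>L p\<^sub>1) + (p\<^sub>2 o\<^sub>L p\<^sub>2) = e \<and>
      P = vector [vector [p\<^sub>1 o\<^sub>L p\<^sub>1, p\<^sub>1 o\<^sub>L p\<^sub>2],
                  vector [p\<^sub>1 o\<^sub>L p\<^sub>2, p\<^sub>2 o\<^sub>L p\<^sub>2]])"

text \<open>The Hilbert space on which the abelian algebra \<open>M\<^sub>0\<close> acts cannot be quantified existentially
  in HOL, so its ambient type \<open>'k\<close> is a parameter; \<open>M\<^sub>0\<close> itself may act on any closed subspace of
  \<open>'k\<close>.\<close>

definition M2_strict_projections ::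
    "'k::complex_hilbert_space itself \<Rightarrow> 'h::complex_hilbert_space endo set \<Rightarrow>
     'h endo \<Rightarrow> 'h endo \<Rightarrow> bool"
  where "M2_strict_projections K M p q \<longleftrightarrow> p \<in> M \<and> q \<in> M \<and>
    (\<exists>(M\<^sub>0 :: 'k endo set) e \<Phi>.
      von_neumann_algebra M\<^sub>0 e \<and> abelian M\<^sub>0 \<and> star_isomorphism_M2 \<Phi> M M\<^sub>0 \<and>
      M2_strict M\<^sub>0 e (\<Phi> p) \<and> M2_strict M\<^sub>0 e (\<Phi> q))"

end

(* Put d = a - b, s = a + b - I, y = I - x0, so that (i) reads |d| + |s| = y. Since |d| commutes
   with d, |s| with s, and y is central, both absolute values commute with d and s; they generate
   M1, so w2 = |d| and w1 = |s| are central. The signs u of d and v of s yield q = (I + u)/2 and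
   p = (I + v)/2. Strictness enters as follows: if a strict A acts idempotently on the kernel of a
   selfadjoint x whose square is central, then x is injective. With A = (I - x0)^-1 (a - x0/2), or
   the same with b, this applies to d, s, f = (v - u)/2 and g = (v + u)/2. As f and g anticommute and f^2 + g^2 = I, their signs F and G anticommute while
   C = |f| and S = |g| are central; hence (I + F)/2 and G are matrix units identifying M1 with the
   2x2 matrices over its centre, and p, q become the M2-strict projections with diagonals
   (I + C)/2, (I - C)/2 and (I - C)/2, (I + C)/2.

   Conversely w2 = |a - b| and w1 = |I - a - b| by uniqueness of square roots. A projection t
   violating strictness satisfies p t, q t in {0, t}, so it is central and corresponds to a scalar
   matrix diag(z, z) with p1 p2 z = 0, which forces z = 0. *)

theory Submission
  imports Defs
begin

section \<open>Adjoints and positive operators\<close>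

text \<open>In terms of the projections, \<open>f = p - q\<close> and \<open>g = p + q - I\<close>.
  This is the classical pair attached to two projections, for which \<open>f^2 + g^2 = I\<close> and
  \<open>f g = - g f\<close> hold identically; \<open>d\<close> and \<open>s\<close> are the same
  combinations of \<open>a\<close> and \<open>b\<close>. With \<open>C\<close> and \<open>S\<close>
  as cosine and sine of an angle \<theta>, \<open>p\<close> and \<open>q\<close> project onto the
  lines at angles \<theta>/2 and (\<pi> - \<theta>)/2, which is where the half-angle diagonals come
  from. The obstacle is the kernels of \<open>f\<close> and \<open>g\<close>, on which
  \<open>p\<close> and \<open>q\<close> agree or are complementary: strictness of the element built
  from \<open>a\<close> removes the kernels of \<open>d\<close>, \<open>s\<close> and
  \<open>f\<close>, that of the element built from \<open>b\<close> the kernel of \<open>g\<close>.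

  Spectral theory is replaced by three explicit limits. Square roots and the inverse of
  \<open>I - x0\<close> are norm limits of iterations, kernel projections are strong limits of
  powers. Each limit therefore stays in the algebra and commutes with whatever commutes with its
  ingredients, which is how membership in \<open>M1\<close> and centrality are obtained.\<close>

lemma norm_midpoint_diff:
  fixes x y :: "'a::real_inner"
  shows "(norm (x - y))\<^sup>2 = 2 * (norm x)\<^sup>2 + 2 * (norm y)\<^sup>2 - 4 * (norm ((1/2) *\<^sub>R (x + y)))\<^sup>2"
  by (simp add: power2_norm_eq_inner inner_add inner_diff inner_commute algebra_simps)

text \<open>For small \<open>t\<close> of the sign opposite to \<open>k\<close> the linear term
  wins; \<open>t = - k / m\<close> with \<open>m > l\<close> is small enough. This is the
  first-variation argument at a minimum.\<close>

lemma nonneg_quadratic_imp_zero: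
  fixes k l :: real
  assumes "\<And>t. 0 \<le> t * k + t\<^sup>2 * l"
  shows "k = 0"
proof (rule ccontr)
  assume "k \<noteq> 0"
  define m where "m = \<bar>l\<bar> + 1"
  have "m > 0" "l < m" by (auto simp: m_def)
  have "0 \<le> (- k / m) * k + (- k / m)\<^sup>2 * l" by (rule assms)
  also have "\<dots> = (k\<^sup>2 / m) * (l / m - 1)"
    using \<open>m > 0\<close> by (simp add: power2_eq_square field_simps)
  also have "\<dots> < 0"
    using \<open>m > 0\<close> \<open>l < m\<close> \<open>k \<noteq> 0\<close> by (intro mult_pos_neg) auto
  finally show False by simp
qed

text \<open>The representing vector minimises \<open>\<parallel>x\<parallel>\<^sup>2 / 2 - f x\<close>.\<close>
theorem riesz_representation:
  fixes f :: "'a::{real_inner,complete_space} \<Rightarrow> real"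
  assumes "bounded_linear f"
  obtains z where "\<And>x. f x = inner x z"
proof -
  interpret f: bounded_linear f by fact
  obtain K where K: "\<And>x. norm (f x) \<le> norm x * K" "K \<ge> 0"
    using f.nonneg_bounded by blast
  define J where "J x = (norm x)\<^sup>2 / 2 - f x" for x
  have "J x \<ge> - (K\<^sup>2 / 2)" for x
  proof -
    have "f x \<le> norm x * K" using K(1)[of x] by simp
    moreover have "0 \<le> (norm x - K)\<^sup>2" by simp
    ultimately show ?thesis by (simp add: J_def power2_eq_square algebra_simps)
  qed
  then have bdd: "bdd_below (range J)" by (intro bdd_belowI2)
  define m where "m = Inf (range J)"
  have mle: "m \<le> J x" for x unfolding m_def using bdd by (intro cINF_lower) auto
  have "\<exists>x. J x < m + inverse (real (Suc n))" for n
    using cInf_lessD[of "range J" "m + inverse (real (Suc n))"] by (auto simp: m_def)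
  then obtain X where X: "\<And>n. J (X n) < m + inverse (real (Suc n))" by metis
  \<comment> \<open>The linear parts of \<open>J\<close> cancel in the parallelogram law, and
    \<open>J \<ge> m\<close> at the midpoint leaves only the two excesses over \<open>m\<close>;
    hence a minimising sequence is Cauchy.\<close>
  have mid: "(norm (x - y))\<^sup>2 \<le> 4 * (J x - m) + 4 * (J y - m)" for x y
    using norm_midpoint_diff[of x y] mle[of "(1/2) *\<^sub>R (x + y)"]
    by (simp add: J_def f.scaleR f.add field_simps)
  have "Cauchy X"
  proof (rule metric_CauchyI)
    fix e :: real assume "e > 0"
    then obtain N where N: "inverse (real (Suc N)) < e\<^sup>2 / 8"
      using reals_Archimedean[of "e\<^sup>2 / 8"] by auto
    have "dist (X i) (X j) < e" if "i \<ge> N" "j \<ge> N" for i j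
    proof -
      have *: "inverse (real (Suc k)) \<le> inverse (real (Suc N))" if "k \<ge> N" for k
        using that by (simp add: field_simps)
      have "(norm (X i - X j))\<^sup>2 < e\<^sup>2"
        using mid[of "X i" "X j"] X[of i] X[of j] *[OF that(1)] *[OF that(2)] N by argo
      then show ?thesis using \<open>e > 0\<close> by (simp add: dist_norm power2_less_imp_less)
    qed
    then show "\<exists>M. \<forall>i\<ge>M. \<forall>j\<ge>M. dist (X i) (X j) < e" by blast
  qed
  then obtain z where z: "X \<longlonglongrightarrow> z" by (meson Cauchy_convergent convergent_def)
  have "(\<lambda>n. J (X n)) \<longlonglongrightarrow> J z"
    unfolding J_def by (intro tendsto_intros f.tendsto z) auto
  moreover have "(\<lambda>n. m + inverse (real (Suc n))) \<longlonglongrightarrow> m + 0"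
    by (intro tendsto_intros LIMSEQ_inverse_real_of_nat)
  ultimately have "J z \<le> m + 0"
    by (rule LIMSEQ_le) (use X less_imp_le in blast)
  then have min: "J z \<le> J x" for x using mle[of x] by simp
  \<comment> \<open>This is the derivative of \<open>J\<close> at the minimiser \<open>z\<close> in
    the direction \<open>x\<close>.\<close>
  have "inner z x - f x = 0" for x
  proof (rule nonneg_quadratic_imp_zero)
    show "0 \<le> t * (inner z x - f x) + t\<^sup>2 * ((norm x)\<^sup>2 / 2)" for t
    proof -
      have "(norm (z + t *\<^sub>R x))\<^sup>2 = (norm z)\<^sup>2 + 2 * (t * inner z x) + t\<^sup>2 * (norm x)\<^sup>2"
        by (simp only: power2_norm_eq_inner)
          (simp add: inner_add inner_commute power2_eq_square algebra_simps)
      then show ?thesis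
        using min[of "z + t *\<^sub>R x"] by (simp add: J_def f.add f.scaleR algebra_simps)
    qed
  qed
  then have "f x = inner x z" for x by (metis eq_iff_diff_eq_0 inner_commute)
  then show ?thesis by (rule that)
qed

section \<open>Composition of operators and complex scalars\<close>

lemmas compose_simps =
  bounded_bilinear.add_left[OF bounded_bilinear_blinfun_compose]
  bounded_bilinear.add_right[OF bounded_bilinear_blinfun_compose]
  bounded_bilinear.diff_left[OF bounded_bilinear_blinfun_compose]
  bounded_bilinear.diff_right[OF bounded_bilinear_blinfun_compose]
  bounded_bilinear.minus_left[OF bounded_bilinear_blinfun_compose]
  bounded_bilinear.minus_right[OF bounded_bilinear_blinfun_compose]
  bounded_bilinear.scaleR_left[OF bounded_bilinear_blinfun_compose]
  bounded_bilinear.scaleR_right[OF bounded_bilinear_blinfun_compose]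

lemma compose_assoc: "(a o\<^sub>L b) o\<^sub>L c = a o\<^sub>L (b o\<^sub>L c)"
  by (rule blinfun_eqI) simp

lemma compose_id [simp]: "id_blinfun o\<^sub>L a = a" "a o\<^sub>L id_blinfun = a"
  by (auto intro: blinfun_eqI)

lemma scaleC_op_apply [simp]: "scaleC_op c T x = c *\<^sub>C T x"
  by transfer simp

lemma scaleC_zero_right [simp]: "c *\<^sub>C (0::'a::complex_hilbert_space) = 0"
  using scaleC_add_right[of c 0 0] by simp

lemma scaleC_minus_right: "c *\<^sub>C (- x) = - (c *\<^sub>C (x::'a::complex_hilbert_space))"
  using scaleC_add_right[of c x "- x"] by (simp add: eq_neg_iff_add_eq_0 add.commute)

lemma scaleC_diff_right: "c *\<^sub>C (x - y) = c *\<^sub>C x - c *\<^sub>C (y::'a::complex_hilbert_space)"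
  using scaleC_add_right[of c x "- y"] by (simp add: scaleC_minus_right)

lemma scaleC_scaleR: "c *\<^sub>C (r *\<^sub>R x) = r *\<^sub>R (c *\<^sub>C (x::'a::complex_hilbert_space))"
  by (metis mult.commute scaleC_of_real scaleC_scaleC)

text \<open>Multiplication by the imaginary unit exchanges real and imaginary parts, so identities
  of \<open>cinner\<close> reduce to identities of the real \<open>inner\<close>.\<close>

lemma Im_cinner: "Im (cinner x y) = - inner (\<i> *\<^sub>C x) y"
  by (simp add: inner_eq_Re_cinner cinner_scaleC_left)

lemma inner_ii_left: "inner (\<i> *\<^sub>C x) y = - inner x (\<i> *\<^sub>C (y::'a::complex_hilbert_space))"
proof -
  have "Im (cinner x y) = - Im (cinner y x)" by (subst cinner_commute) simp
  then show ?thesis by (simp add: Im_cinner inner_commute)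
qed

lemma bounded_opsD: "T \<in> bounded_ops \<Longrightarrow> T (c *\<^sub>C x) = c *\<^sub>C T x"
  by (simp add: bounded_ops_def)

lemma scaleC_decompose: "c *\<^sub>C x = Re c *\<^sub>R x + Im c *\<^sub>R (\<i> *\<^sub>C (x::'a::complex_hilbert_space))"
proof -
  have "c = complex_of_real (Re c) + complex_of_real (Im c) * \<i>" by (simp add: complex_eq_iff)
  then have "c *\<^sub>C x = complex_of_real (Re c) *\<^sub>C x + (complex_of_real (Im c) * \<i>) *\<^sub>C x"
    by (metis scaleC_add_left)
  then show ?thesis by (simp add: scaleC_of_real flip: scaleC_scaleC)
qed

text \<open>The maps are real-linear already, so complex linearity only has to be tested at the
  imaginary unit.\<close>

lemma bounded_opsI:
  fixes T :: "'a::complex_hilbert_space endo"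
  assumes "\<And>x. T (\<i> *\<^sub>C x) = \<i> *\<^sub>C T x"
  shows "T \<in> bounded_ops"
  unfolding bounded_ops_def
proof (intro CollectI allI)
  show "T (c *\<^sub>C x) = c *\<^sub>C T x" for c x
    by (simp add: scaleC_decompose[of c x] scaleC_decompose[of c "T x"] blinfun.add_right
        blinfun.scaleR_right assms)
qed

lemma bounded_ops_closed [simp, intro]:
  "id_blinfun \<in> bounded_ops" "0 \<in> bounded_ops"
  "S \<in> bounded_ops \<Longrightarrow> T \<in> bounded_ops \<Longrightarrow> S + T \<in> bounded_ops"
  "S \<in> bounded_ops \<Longrightarrow> T \<in> bounded_ops \<Longrightarrow> S - T \<in> bounded_ops"
  "S \<in> bounded_ops \<Longrightarrow> - S \<in> bounded_ops"
  "S \<in> bounded_ops \<Longrightarrow> T \<in> bounded_ops \<Longrightarrow> S o\<^sub>L T \<in> bounded_ops"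
  "S \<in> bounded_ops \<Longrightarrow> r *\<^sub>R S \<in> bounded_ops"
  "S \<in> bounded_ops \<Longrightarrow> scaleC_op c S \<in> bounded_ops"
  by (auto simp: bounded_ops_def blinfun.bilinear_simps scaleC_add_right scaleC_diff_right
      scaleC_minus_right scaleC_scaleR scaleC_scaleC mult.commute)

section \<open>Adjoints through the real inner product\<close>

lemma inner_eq_imp_eq: "(\<And>x::'a::real_inner. inner x y = inner x z) \<Longrightarrow> y = z"
  by (metis inner_diff_right inner_eq_zero_iff eq_iff_diff_eq_0)

text \<open>The representation theorem is applied to \<open>x \<mapsto> inner (T x) y\<close> for
  each \<open>y\<close>. Boundedness of the resulting map comes from testing at the vector
  \<open>S y\<close> itself.\<close>

lemma ex_adjoint:
  fixes T :: "'a::complex_hilbert_space endo"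
  obtains S :: "'a endo" where "\<And>x y. inner (T x) y = inner x (S y)"
proof -
  have "\<exists>z. \<forall>x. inner (T x) y = inner x z" for y
  proof -
    have "bounded_linear (\<lambda>x. inner (T x) y)"
      by (intro bounded_linear_intros)
    then show ?thesis by (metis riesz_representation)
  qed
  then obtain S where S: "\<And>x y. inner (T x) y = inner x (S y)" by metis
  have "bounded_linear S"
  proof (rule bounded_linear_intro)
    show "S (x + y) = S x + S y" for x y
      by (rule inner_eq_imp_eq) (simp add: inner_add_right flip: S)
    show "S (r *\<^sub>R x) = r *\<^sub>R S x" for r x
      by (rule inner_eq_imp_eq) (simp flip: S)
    show "norm (S y) \<le> norm y * norm T" for y
    proof (cases "S y = 0")
      case False
      have "norm (S y) * norm (S y) = inner (T (S y)) y"
        by (simp add: S power2_norm_eq_inner flip: power2_eq_square)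
      also have "\<dots> \<le> norm (T (S y)) * norm y" by (rule norm_cauchy_schwarz)
      also have "\<dots> \<le> (norm T * norm (S y)) * norm y"
        by (intro mult_right_mono norm_blinfun) auto
      finally show ?thesis using False by (simp add: mult.commute mult.left_commute)
    qed simp
  qed
  then have "inner (T x) y = inner x (Blinfun S y)" for x y
    by (simp add: bounded_linear_Blinfun_apply S)
  then show ?thesis by (rule that)
qed

text \<open>The real identity is enough: applied to the multiple of \<open>x\<close> by the
  imaginary unit, it yields the imaginary part as well, because \<open>T\<close> is
  complex-linear.\<close>

lemma adj_eqI:
  fixes T S :: "'a::complex_hilbert_space endo"
  assumes T: "T \<in> bounded_ops" and S: "\<And>x y. inner (T x) y = inner x (S y)"
  shows "adj T = S"
  unfolding adj_def
proof (rule the_equality)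
  show "\<forall>x y. cinner (T x) y = cinner x (S y)"
    by (intro allI complex_eqI)
      (simp_all add: Im_cinner S flip: inner_eq_Re_cinner bounded_opsD[OF T])
next
  fix S' :: "'a endo" assume S': "\<forall>x y. cinner (T x) y = cinner x (S' y)"
  show "S' = S"
  proof (rule blinfun_eqI, rule inner_eq_imp_eq)
    show "inner x (S' y) = inner x (S y)" for x y
      using S'[rule_format, of x y] S[of x y] by (simp only: inner_eq_Re_cinner)
  qed
qed

lemma inner_adj:
  assumes "T \<in> bounded_ops"
  shows "inner (T x) y = inner x (adj T y)"
proof -
  obtain S where S: "\<And>x y. inner (T x) y = inner x (blinfun_apply S y)"
    using ex_adjoint[of T] by blast
  show ?thesis using adj_eqI[OF assms S] S by simp
qed

lemma inner_adj':
  assumes "T \<in> bounded_ops"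
  shows "inner (adj T x) y = inner x (T y)"
  using inner_adj[OF assms, of y x] by (simp add: inner_commute)

lemma adj_bounded_ops [simp, intro]:
  assumes T: "T \<in> bounded_ops"
  shows "adj T \<in> bounded_ops"
proof (rule bounded_opsI)
  show "adj T (\<i> *\<^sub>C x) = \<i> *\<^sub>C adj T x" for x
  proof (rule inner_eq_imp_eq)
    fix y
    have "inner y (adj T (\<i> *\<^sub>C x)) = inner (T y) (\<i> *\<^sub>C x)" by (simp add: inner_adj T)
    also have "\<dots> = - inner (\<i> *\<^sub>C T y) x" by (simp add: inner_ii_left)
    also have "\<dots> = - inner (\<i> *\<^sub>C y) (adj T x)" by (simp add: inner_adj T flip: bounded_opsD)
    finally show "inner y (adj T (\<i> *\<^sub>C x)) = inner y (\<i> *\<^sub>C adj T x)"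
      by (simp add: inner_ii_left)
  qed
qed

lemma adj_simps [simp]:
  "adj (0 :: 'a::complex_hilbert_space endo) = 0"
  "adj (id_blinfun :: 'a endo) = id_blinfun"
  "S \<in> bounded_ops \<Longrightarrow> T \<in> bounded_ops \<Longrightarrow> adj (S + T) = adj S + adj T"
  "S \<in> bounded_ops \<Longrightarrow> T \<in> bounded_ops \<Longrightarrow> adj (S - T) = adj S - adj T"
  "S \<in> bounded_ops \<Longrightarrow> adj (- S) = - adj S"
  "S \<in> bounded_ops \<Longrightarrow> T \<in> bounded_ops \<Longrightarrow> adj (S o\<^sub>L T) = adj T o\<^sub>L adj S"
  "S \<in> bounded_ops \<Longrightarrow> adj (r *\<^sub>R S) = r *\<^sub>R adj S"
  by (rule adj_eqI; auto simp: blinfun.bilinear_simps inner_add inner_diff inner_adj)+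

lemma adj_adj [simp]: "S \<in> bounded_ops \<Longrightarrow> adj (adj S) = S"
  by (rule adj_eqI) (auto simp: inner_adj')

section \<open>Selfadjoint and positive operators\<close>

definition selfadj :: "'a::complex_hilbert_space endo \<Rightarrow> bool"
  where "selfadj T \<longleftrightarrow> T \<in> bounded_ops \<and> adj T = T"

lemma selfadj_inner: "selfadj T \<Longrightarrow> inner (T x) y = inner x (T y)"
  using inner_adj[of T x y] by (simp add: selfadj_def)

lemma selfadjI:
  assumes "T \<in> bounded_ops" "\<And>x y. inner (T x) y = inner x (T y)"
  shows "selfadj T"
  using assms adj_eqI[of T T] by (simp add: selfadj_def)

lemma selfadj_closed [simp, intro]:
  "selfadj 0" "selfadj id_blinfun"
  "selfadj S \<Longrightarrow> selfadj T \<Longrightarrow> selfadj (S + T)"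
  "selfadj S \<Longrightarrow> selfadj T \<Longrightarrow> selfadj (S - T)"
  "selfadj S \<Longrightarrow> selfadj (- S)"
  "selfadj S \<Longrightarrow> selfadj (r *\<^sub>R S)"
  "selfadj S \<Longrightarrow> selfadj (S o\<^sub>L S)"
  by (auto simp: selfadj_def)

lemma selfadj_compose: "selfadj S \<Longrightarrow> selfadj T \<Longrightarrow> S o\<^sub>L T = T o\<^sub>L S \<Longrightarrow> selfadj (S o\<^sub>L T)"
  by (auto simp: selfadj_def)

lemma selfadj_sandwich: "selfadj S \<Longrightarrow> selfadj T \<Longrightarrow> selfadj (S o\<^sub>L (T o\<^sub>L S))"
  by (auto simp: selfadj_def compose_assoc)

text \<open>Complex polarisation: a quadratic form with real values belongs to a selfadjoint
  operator. Afterwards positivity is handled with the real inner product alone.\<close>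

lemma positive_op_iff: "positive_op T \<longleftrightarrow> selfadj T \<and> (\<forall>x. 0 \<le> inner (T x) x)"
proof
  assume T: "positive_op T"
  then have B: "T \<in> bounded_ops" and P: "\<And>x. cinner (T x) x \<in> \<real>\<^sub>\<ge>\<^sub>0"
    by (auto simp: positive_op_def)
  have im: "inner (T (\<i> *\<^sub>C x)) x = 0" for x
  proof -
    have "Im (cinner (T x) x) = 0" using P[of x] by (simp add: complex_nonneg_Reals_iff)
    then show ?thesis by (simp add: Im_cinner bounded_opsD B)
  qed
  have "inner (T x) y = inner x (T y)" for x y
  proof -
    define z where "z = - (\<i> *\<^sub>C x)"
    have iz: "\<i> *\<^sub>C z = x"
      using scaleC_of_real[of "-1" x] by (simp add: z_def scaleC_minus_right scaleC_scaleC)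
    have "inner (T (\<i> *\<^sub>C z)) y + inner (T (\<i> *\<^sub>C y)) z = 0"
      using im[of "z + y"] im[of z] im[of y]
      by (simp add: scaleC_add_right blinfun.add_right inner_add)
    moreover have "inner (T (\<i> *\<^sub>C y)) z = - inner (T y) (\<i> *\<^sub>C z)"
      by (simp add: bounded_opsD B inner_ii_left)
    ultimately show ?thesis by (simp add: iz inner_commute)
  qed
  moreover have "0 \<le> inner (T x) x" for x
    using P[of x] by (simp add: inner_eq_Re_cinner complex_nonneg_Reals_iff)
  ultimately show "selfadj T \<and> (\<forall>x. 0 \<le> inner (T x) x)" using B selfadjI[of T] by simp
next
  assume T: "selfadj T \<and> (\<forall>x. 0 \<le> inner (T x) x)"
  then have B: "T \<in> bounded_ops" by (simp add: selfadj_def)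
  have "Im (cinner (T x) x) = 0" for x
  proof -
    have "inner (\<i> *\<^sub>C T x) x = inner (\<i> *\<^sub>C x) (T x)"
      using T selfadj_inner[of T "\<i> *\<^sub>C x" x] by (simp add: bounded_opsD[OF B])
    then have "inner (\<i> *\<^sub>C T x) x = 0"
      using inner_ii_left[of x "T x"] inner_commute[of x "\<i> *\<^sub>C T x"] by linarith
    then show ?thesis by (simp add: Im_cinner)
  qed
  then show "positive_op T"
    using T B by (auto simp: positive_op_def complex_nonneg_Reals_iff simp flip: inner_eq_Re_cinner)
qed

lemma positive_opD: "positive_op T \<Longrightarrow> selfadj T" "positive_op T \<Longrightarrow> 0 \<le> inner (T x) x"
  by (auto simp: positive_op_iff)

lemma positive_op_closed [simp, intro]:
  "positive_op 0" "positive_op id_blinfun"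
  "positive_op S \<Longrightarrow> positive_op T \<Longrightarrow> positive_op (S + T)"
  "0 \<le> r \<Longrightarrow> positive_op S \<Longrightarrow> positive_op (r *\<^sub>R S)"
  by (auto simp: positive_op_iff blinfun.bilinear_simps inner_add)

lemma positive_square: "selfadj S \<Longrightarrow> positive_op (S o\<^sub>L S)"
  using selfadj_inner[of S "S x" x for x] by (auto simp: positive_op_iff)

lemma positive_sandwich: "selfadj S \<Longrightarrow> positive_op T \<Longrightarrow> positive_op (S o\<^sub>L (T o\<^sub>L S))"
  using selfadj_inner[of S "T (S x)" x for x] by (auto simp: positive_op_iff selfadj_sandwich)

lemma positive_cauchy_schwarz:
  assumes "positive_op A"
  shows "(inner (A x) y)\<^sup>2 \<le> inner (A x) x * inner (A y) y"
proof -
  have sa: "inner (A u) v = inner u (A v)" for u v using assms positive_opD selfadj_inner by blast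
  have nn: "0 \<le> inner (A u) u" for u using assms positive_opD by blast
  define p q r where "p = inner (A x) x" and "q = inner (A x) y" and "r = inner (A y) y"
  have *: "0 \<le> s\<^sup>2 * p + 2 * s * t * q + t\<^sup>2 * r" for s t
  proof -
    have "0 \<le> inner (A (s *\<^sub>R x + t *\<^sub>R y)) (s *\<^sub>R x + t *\<^sub>R y)" by (rule nn)
    also have "\<dots> = s\<^sup>2 * p + 2 * s * t * q + t\<^sup>2 * r"
      unfolding p_def q_def r_def using sa[of y x]
      by (simp add: blinfun.bilinear_simps inner_add power2_eq_square algebra_simps inner_commute)
    finally show ?thesis .
  qed
  have "q\<^sup>2 \<le> p * r"
  proof (cases "r = 0")
    case True
    have "2 * q = 0"
    proof (rule nonneg_quadratic_imp_zero)
      show "0 \<le> t * (2 * q) + t\<^sup>2 * 0" for t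
      proof -
        have p: "0 \<le> p" by (simp add: p_def nn)
        have "p + t * (2 * q) \<ge> 0" for t using *[of 1 t] True by (simp add: algebra_simps)
        \<comment> \<open>If \<open>t * (2 * q)\<close> were negative, this scaling would make the
          linear term equal to \<open>- (p + 1)\<close>, and the sum would be
          \<open>- 1\<close>.\<close>
        then have "p + (t * (p + 1) / \<bar>t * (2 * q)\<bar>) * (2 * q) \<ge> 0" .
        then show ?thesis
          using p by (cases "t * (2 * q) < 0") (auto simp: field_simps abs_if split: if_splits)
      qed
    qed
    then show ?thesis using True by simp
  next
    case False
    then have "r > 0" using nn[of y] by (simp add: r_def)
    \<comment> \<open>The minimum of the quadratic form over the second coefficient is attained, up
      to scaling, at \<open>s = r\<close>, \<open>t = - q\<close>.\<close>
    have "0 \<le> r\<^sup>2 * p + 2 * r * (- q) * q + (- q)\<^sup>2 * r" by (rule *)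
    also have "\<dots> = r * (p * r - q\<^sup>2)" by (simp add: power2_eq_square algebra_simps)
    finally show ?thesis using \<open>r > 0\<close> by (simp add: zero_le_mult_iff)
  qed
  then show ?thesis by (simp add: p_def q_def r_def)
qed

text \<open>Cauchy-Schwarz for the form of \<open>A\<close>, with second argument
  \<open>A x\<close>.\<close>

lemma positive_inner_zero:
  assumes "positive_op A" "inner (A x) x = 0"
  shows "A x = 0"
  using positive_cauchy_schwarz[OF assms(1), of x "A x"] assms(2) by simp

text \<open>Cauchy-Schwarz for the form of \<open>A\<close> at \<open>x\<close> and
  \<open>A x\<close> bounds the fourth power of \<open>norm (A x)\<close> by the product of the
  squares of \<open>norm x\<close> and \<open>norm (A x)\<close>.\<close>

lemma positive_contraction_norm:
  assumes "positive_op A" "positive_op (id_blinfun - A)"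
  shows "norm A \<le> 1"
proof (rule norm_blinfun_bound)
  fix x
  have le: "inner (A u) u \<le> (norm u)\<^sup>2" for u
    using positive_opD(2)[OF assms(2), of u]
    by (simp add: blinfun.bilinear_simps inner_diff power2_norm_eq_inner)
  show "norm (A x) \<le> 1 * norm x"
  proof (cases "A x = 0")
    case False
    have "(inner (A x) (A x))\<^sup>2 \<le> inner (A x) x * inner (A (A x)) (A x)"
      by (rule positive_cauchy_schwarz[OF assms(1)])
    also have "\<dots> \<le> (norm x)\<^sup>2 * (norm (A x))\<^sup>2"
      by (intro mult_mono le) (auto simp: positive_opD assms)
    finally have "(norm (A x))\<^sup>2 * (norm (A x))\<^sup>2 \<le> (norm x)\<^sup>2 * (norm (A x))\<^sup>2"
      by (simp only: power2_norm_eq_inner power2_eq_square[of "inner _ _"])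
    then have "(norm (A x))\<^sup>2 \<le> (norm x)\<^sup>2" by (rule mult_right_le_imp_le) (simp add: False)
    then show ?thesis by (simp add: power2_le_iff_abs_le)
  qed simp
qed simp

lemma contraction_positive:
  assumes "selfadj A" "norm A \<le> 1"
  shows "positive_op (id_blinfun - A)" "positive_op (id_blinfun + A)"
proof -
  have "\<bar>inner (A x) x\<bar> \<le> inner x x" for x
  proof -
    have "\<bar>inner (A x) x\<bar> \<le> norm (A x) * norm x" by (rule Cauchy_Schwarz_ineq2)
    also have "\<dots> \<le> (norm A * norm x) * norm x" by (intro mult_right_mono norm_blinfun) auto
    also have "\<dots> \<le> 1 * (norm x * norm x)"
      unfolding mult.assoc by (intro mult_right_mono assms) auto
    finally show ?thesis by (simp add: power2_norm_eq_inner flip: power2_eq_square)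
  qed
  then have "0 \<le> inner x x + inner (A x) x" "0 \<le> inner x x - inner (A x) x" for x
    by (simp_all add: abs_le_iff) (smt (verit))
  then show "positive_op (id_blinfun - A)" "positive_op (id_blinfun + A)"
    using assms(1)
    by (simp_all add: positive_op_iff blinfun.bilinear_simps inner_add inner_diff)
qed

section \<open>Square roots and inverses\<close>

text \<open>One notion serves two purposes: a von Neumann algebra with unit
  \<open>id_blinfun\<close> is such a set, which gives membership of limits, and so is the set of
  operators commuting with a fixed \<open>R\<close>, which gives commutation.\<close>

definition closed_subalgebra :: "'a::complex_hilbert_space endo set \<Rightarrow> bool"
  where "closed_subalgebra A \<longleftrightarrow> closed A \<and> id_blinfun \<in> A \<and>
    (\<forall>x\<in>A. \<forall>y\<in>A. x + y \<in> A \<and> x o\<^sub>L y \<in> A) \<and> (\<forall>r. \<forall>x\<in>A. r *\<^sub>R x \<in> A)"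

lemma closed_subalgebraD:
  assumes "closed_subalgebra A"
  shows "closed A" "id_blinfun \<in> A" "0 \<in> A"
    "x \<in> A \<Longrightarrow> y \<in> A \<Longrightarrow> x + y \<in> A"
    "x \<in> A \<Longrightarrow> y \<in> A \<Longrightarrow> x - y \<in> A"
    "x \<in> A \<Longrightarrow> y \<in> A \<Longrightarrow> x o\<^sub>L y \<in> A"
    "x \<in> A \<Longrightarrow> r *\<^sub>R x \<in> A"
proof -
  have A: "closed A" "id_blinfun \<in> A" "\<And>x y. x \<in> A \<Longrightarrow> y \<in> A \<Longrightarrow> x + y \<in> A"
    "\<And>x y. x \<in> A \<Longrightarrow> y \<in> A \<Longrightarrow> x o\<^sub>L y \<in> A" "\<And>x r. x \<in> A \<Longrightarrow> r *\<^sub>R x \<in> A"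
    using assms unfolding closed_subalgebra_def by blast+
  show "closed A" "id_blinfun \<in> A" "x \<in> A \<Longrightarrow> y \<in> A \<Longrightarrow> x + y \<in> A"
    "x \<in> A \<Longrightarrow> y \<in> A \<Longrightarrow> x o\<^sub>L y \<in> A" "x \<in> A \<Longrightarrow> r *\<^sub>R x \<in> A"
    by (fact A)+
  show "0 \<in> A" using A(5)[OF A(2), of 0] by simp
  show "x - y \<in> A" if "x \<in> A" "y \<in> A"
    using A(3)[OF that(1) A(5)[OF that(2), of "-1"]] by simp
qed

lemma closed_subalgebra_commuting: "closed_subalgebra {x. R o\<^sub>L x = x o\<^sub>L R}"
proof -
  have "closed {x. R o\<^sub>L x = x o\<^sub>L R}"
    by (intro closed_Collect_eq continuous_intros)
  moreover have "R o\<^sub>L (x o\<^sub>L y) = (x o\<^sub>L y) o\<^sub>L R" if "R o\<^sub>L x = x o\<^sub>L R" "R o\<^sub>L y = y o\<^sub>L R" for x y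
    by (metis that compose_assoc)
  ultimately show ?thesis
    by (simp add: closed_subalgebra_def compose_simps)
qed

section \<open>Convergence of the square root iteration\<close>

lemma summable_increments_imp_convergent:
  fixes X :: "nat \<Rightarrow> 'a::banach"
  assumes "summable c" "\<And>n. norm (X (Suc n) - X n) \<le> c n"
  shows "convergent X"
proof -
  have "summable (\<lambda>n. X (Suc n) - X n)"
    by (rule summable_comparison_test'[OF assms(1), of 0]) (rule assms(2))
  then have "(\<lambda>n. \<Sum>k<n. X (Suc k) - X k) \<longlonglongrightarrow> (\<Sum>n. X (Suc n) - X n)"
    by (rule summable_LIMSEQ)
  then have "(\<lambda>n. X n - X 0) \<longlonglongrightarrow> (\<Sum>n. X (Suc n) - X n)"
    by (simp add: sum_lessThan_telescope)
  from tendsto_add[OF this tendsto_const[of "X 0"]] show ?thesis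
    by (auto simp: convergent_def)
qed

text \<open>The limit \<open>Y\<close> of this iteration satisfies \<open>2 Y = X + Y\<^sup>2\<close>, so \<open>(1 - Y)\<^sup>2 = 1 - X\<close>.\<close>

primrec sqrt_iter :: "'a::complex_hilbert_space endo \<Rightarrow> nat \<Rightarrow> 'a endo" where
  "sqrt_iter X 0 = 0"
| "sqrt_iter X (Suc n) = (1/2) *\<^sub>R (X + (sqrt_iter X n o\<^sub>L sqrt_iter X n))"

text \<open>The same iteration for the scalar 1. It increases and is bounded by 1, so its increments
  are summable; they dominate the operator increments also when \<open>norm X = 1\<close>, where no
  geometric bound is available.\<close>

primrec scalar_iter :: "nat \<Rightarrow> real" where
  "scalar_iter 0 = 0"
| "scalar_iter (Suc n) = (1 + (scalar_iter n)\<^sup>2) / 2"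

lemma scalar_iter_bounds: "0 \<le> scalar_iter n" "scalar_iter n \<le> 1"
proof -
  have "0 \<le> scalar_iter n \<and> scalar_iter n \<le> 1"
  proof (induction n)
    case (Suc n)
    then have "(scalar_iter n)\<^sup>2 \<le> 1\<^sup>2" by (intro power_mono) auto
    then show ?case by simp
  qed simp
  then show "0 \<le> scalar_iter n" "scalar_iter n \<le> 1" by auto
qed

lemma scalar_iter_incr: "scalar_iter n \<le> scalar_iter (Suc n)"
  using zero_le_power2[of "scalar_iter n - 1"] by (simp add: power2_diff)

lemma summable_scalar_iter: "summable (\<lambda>n. scalar_iter (Suc n) - scalar_iter n)"
proof (rule bounded_imp_summable)
  show "0 \<le> scalar_iter (Suc n) - scalar_iter n" for n using scalar_iter_incr[of n] by linarith
  show "(\<Sum>k\<le>n. scalar_iter (Suc k) - scalar_iter k) \<le> 1" for n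
    unfolding lessThan_Suc_atMost[symmetric] sum_lessThan_telescope
    using scalar_iter_bounds[of "Suc n"] by simp
qed

lemma norm_sqrt_iter:
  assumes "norm X \<le> 1"
  shows "norm (sqrt_iter X n) \<le> scalar_iter n"
proof (induction n)
  case (Suc n)
  have "norm (sqrt_iter X (Suc n)) = norm (X + (sqrt_iter X n o\<^sub>L sqrt_iter X n)) / 2" by simp
  also have "\<dots> \<le> (norm X + norm (sqrt_iter X n o\<^sub>L sqrt_iter X n)) / 2"
    using norm_triangle_ineq by (intro divide_right_mono) auto
  also have "\<dots> \<le> (1 + scalar_iter n * scalar_iter n) / 2"
  proof -
    have "norm (sqrt_iter X n o\<^sub>L sqrt_iter X n) \<le> norm (sqrt_iter X n) * norm (sqrt_iter X n)"
      by (rule norm_blinfun_compose)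
    also have "\<dots> \<le> scalar_iter n * scalar_iter n"
      by (intro mult_mono Suc scalar_iter_bounds) auto
    finally show ?thesis using assms by simp
  qed
  finally show ?case by (simp add: power2_eq_square)
qed simp

lemma sqrt_iter_in_closed_subalgebra:
  "closed_subalgebra A \<Longrightarrow> X \<in> A \<Longrightarrow> sqrt_iter X n \<in> A"
  by (induction n) (simp_all only: sqrt_iter.simps closed_subalgebraD)

text \<open>Membership is used twice: the iterates commute with \<open>X\<close>, so
  \<open>X\<close> lies in the commutant of each iterate, and then so do all iterates.\<close>

lemma sqrt_iter_commute: "sqrt_iter X m o\<^sub>L sqrt_iter X n = sqrt_iter X n o\<^sub>L sqrt_iter X m"
proof -
  have "sqrt_iter X n \<in> {x. X o\<^sub>L x = x o\<^sub>L X}"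
    by (rule sqrt_iter_in_closed_subalgebra[OF closed_subalgebra_commuting]) simp
  then have "sqrt_iter X m \<in> {x. sqrt_iter X n o\<^sub>L x = x o\<^sub>L sqrt_iter X n}"
    by (intro sqrt_iter_in_closed_subalgebra[OF closed_subalgebra_commuting]) simp
  then show ?thesis by simp
qed

lemma compose_square_diff:
  assumes "x o\<^sub>L y = y o\<^sub>L x"
  shows "(x o\<^sub>L x) - (y o\<^sub>L y) = (x - y) o\<^sub>L (x + y)"
  by (simp add: compose_simps assms)

text \<open>The iterates commute, so a difference of squares factors. Each factor is bounded by its
  scalar counterpart, and the product of the scalar factors is exactly twice the next scalar
  increment.\<close>

lemma norm_sqrt_iter_diff:
  assumes "norm X \<le> 1"
  shows "norm (sqrt_iter X (Suc n) - sqrt_iter X n) \<le> scalar_iter (Suc n) - scalar_iter n"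
proof (induction n)
  case 0
  then show ?case using assms by simp
next
  case (Suc n)
  let ?Y = "sqrt_iter X (Suc n)" and ?Z = "sqrt_iter X n"
  have "sqrt_iter X (Suc (Suc n)) - ?Y
      = (1/2) *\<^sub>R (X + (?Y o\<^sub>L ?Y)) - (1/2) *\<^sub>R (X + (?Z o\<^sub>L ?Z))"
    by (simp only: sqrt_iter.simps(2)[of X "Suc n"] sqrt_iter.simps(2)[of X n, symmetric])
  also have "\<dots> = (1/2) *\<^sub>R ((?Y o\<^sub>L ?Y) - (?Z o\<^sub>L ?Z))"
    by (simp only: scaleR_diff_right[symmetric] add_diff_cancel_left)
  also have "(?Y o\<^sub>L ?Y) - (?Z o\<^sub>L ?Z) = (?Y - ?Z) o\<^sub>L (?Y + ?Z)"
    using compose_square_diff[OF sqrt_iter_commute] .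
  finally have "norm (sqrt_iter X (Suc (Suc n)) - ?Y) = norm ((?Y - ?Z) o\<^sub>L (?Y + ?Z)) / 2"
    by (simp add: norm_scaleR del: sqrt_iter.simps)
  also have "\<dots> \<le> (norm (?Y - ?Z) * norm (?Y + ?Z)) / 2"
    by (intro divide_right_mono norm_blinfun_compose) auto
  also have "\<dots> \<le> ((scalar_iter (Suc n) - scalar_iter n) * (scalar_iter (Suc n) + scalar_iter n)) / 2"
  proof (intro divide_right_mono mult_mono Suc)
    show "norm (?Y + ?Z) \<le> scalar_iter (Suc n) + scalar_iter n"
      using norm_triangle_ineq[of ?Y ?Z] norm_sqrt_iter[OF assms, of "Suc n"]
        norm_sqrt_iter[OF assms, of n] by linarith
    show "0 \<le> scalar_iter (Suc n) - scalar_iter n" using scalar_iter_incr[of n] by linarith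
  qed auto
  also have "\<dots> = scalar_iter (Suc (Suc n)) - scalar_iter (Suc n)"
  proof -
    have "(t - s) * (t + s) / 2 = (1 + t\<^sup>2) / 2 - t" if "t = (1 + s\<^sup>2) / 2" for s t :: real
    proof -
      have "(t - s) * (t + s) / 2 = (1 + t\<^sup>2) / 2 - (1 + s\<^sup>2) / 2"
        by (simp add: power2_eq_square field_simps)
      then show ?thesis by (simp only: that[symmetric])
    qed
    from this[OF scalar_iter.simps(2)] show ?thesis by (simp only: scalar_iter.simps(2)[of "Suc n"])
  qed
  finally show ?case .
qed

lemma selfadj_limit:
  assumes "X \<longlonglongrightarrow> Y" "\<And>n. selfadj (X n)"
  shows "selfadj Y"
proof (rule selfadjI)
  have lim: "(\<lambda>n. X n h) \<longlonglongrightarrow> Y h" for h by (intro tendsto_intros assms)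
  show "Y \<in> bounded_ops"
  proof (rule bounded_opsI)
    fix h
    have "(\<lambda>n. scaleC_op \<i> id_blinfun (X n h)) \<longlonglongrightarrow> scaleC_op \<i> id_blinfun (Y h)"
      by (intro tendsto_intros lim)
    then have "(\<lambda>n. X n (\<i> *\<^sub>C h)) \<longlonglongrightarrow> \<i> *\<^sub>C Y h"
      using assms(2) by (simp add: selfadj_def bounded_opsD)
    with lim show "Y (\<i> *\<^sub>C h) = \<i> *\<^sub>C Y h" using LIMSEQ_unique by blast
  qed
  show "inner (Y h) k = inner h (Y k)" for h k
  proof (rule LIMSEQ_unique)
    show "(\<lambda>n. inner (X n h) k) \<longlonglongrightarrow> inner (Y h) k" by (intro tendsto_intros lim)
    show "(\<lambda>n. inner (X n h) k) \<longlonglongrightarrow> inner h (Y k)"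
      unfolding selfadj_inner[OF assms(2)] by (intro tendsto_intros lim)
  qed
qed

text \<open>The root is \<open>I - Y\<close> for the limit \<open>Y\<close> of the iteration. The
  membership clause stands inside the existential so that one root serves every closed
  subalgebra.\<close>

lemma ex_sqrt_contraction:
  assumes X: "selfadj X" "norm X \<le> 1"
  shows "\<exists>S. positive_op S \<and> S o\<^sub>L S = id_blinfun - X \<and>
    (\<forall>A. closed_subalgebra A \<longrightarrow> X \<in> A \<longrightarrow> S \<in> A)"
proof -
  have "convergent (sqrt_iter X)"
    using summable_scalar_iter norm_sqrt_iter_diff[OF X(2)]
    by (rule summable_increments_imp_convergent)
  then obtain Y where Y: "sqrt_iter X \<longlonglongrightarrow> Y" by (auto simp: convergent_def)
  have "selfadj (sqrt_iter X n)" for n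
    using X(1) by (induction n) auto
  then have "selfadj Y" using Y selfadj_limit by blast
  moreover have "norm Y \<le> 1"
  proof (rule LIMSEQ_le_const2)
    show "(\<lambda>n. norm (sqrt_iter X n)) \<longlonglongrightarrow> norm Y" by (intro tendsto_intros Y)
    show "\<exists>N. \<forall>n\<ge>N. norm (sqrt_iter X n) \<le> 1"
      using norm_sqrt_iter[OF X(2)] scalar_iter_bounds order_trans by blast
  qed
  ultimately have "positive_op (id_blinfun - Y)" by (rule contraction_positive)
  moreover have "Y = (1/2) *\<^sub>R (X + (Y o\<^sub>L Y))"
  proof (rule LIMSEQ_unique)
    show "(\<lambda>n. sqrt_iter X (Suc n)) \<longlonglongrightarrow> Y" using Y by (rule LIMSEQ_Suc)
    show "(\<lambda>n. sqrt_iter X (Suc n)) \<longlonglongrightarrow> (1/2) *\<^sub>R (X + (Y o\<^sub>L Y))"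
      unfolding sqrt_iter.simps by (intro tendsto_intros Y)
  qed
  then have "2 *\<^sub>R Y = X + (Y o\<^sub>L Y)"
    by (metis (no_types) scaleR_scaleR scaleR_one mult.commute nonzero_divide_eq_eq zero_neq_numeral)
  then have "(id_blinfun - Y) o\<^sub>L (id_blinfun - Y) = id_blinfun - X"
    by (simp add: compose_simps scaleR_2 algebra_simps)
  moreover have "id_blinfun - Y \<in> A" if A: "closed_subalgebra A" "X \<in> A" for A
  proof -
    have "Y \<in> A"
      using closed_subalgebraD(1)[OF A(1)] sqrt_iter_in_closed_subalgebra[OF A] Y
      by (metis closed_sequentially)
    then show ?thesis using A(1) closed_subalgebraD by blast
  qed
  ultimately show ?thesis by blast
qed

lemma ex_sqrt:
  assumes T: "positive_op T"
  shows "\<exists>S. positive_op S \<and> S o\<^sub>L S = T \<and> (\<forall>A. closed_subalgebra A \<longrightarrow> T \<in> A \<longrightarrow> S \<in> A)"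
proof -
  \<comment> \<open>With \<open>r > norm T\<close>, both \<open>T / r\<close> and
    \<open>X = I - T / r\<close> are positive; hence \<open>norm X \<le> 1\<close> and the iteration
    applies to \<open>X\<close>.\<close>
  define r where "r = norm T + 1"
  have r: "r > 0" by (simp add: r_def add_nonneg_pos)
  define X where "X = id_blinfun - (1 / r) *\<^sub>R T"
  have Tr: "positive_op ((1 / r) *\<^sub>R T)" using T r by auto
  have "norm ((1 / r) *\<^sub>R T) \<le> 1" using r by (simp add: r_def)
  then have "positive_op X"
    unfolding X_def using Tr contraction_positive positive_opD by blast
  moreover have "id_blinfun - X = (1 / r) *\<^sub>R T" by (simp add: X_def)
  ultimately have X: "selfadj X" "norm X \<le> 1"
    using positive_contraction_norm[of X] Tr by (auto simp: positive_opD)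
  obtain S where S: "positive_op S" "S o\<^sub>L S = (1 / r) *\<^sub>R T"
    "\<And>A. closed_subalgebra A \<Longrightarrow> X \<in> A \<Longrightarrow> S \<in> A"
    using ex_sqrt_contraction[OF X] \<open>id_blinfun - X = _\<close> by metis
  show ?thesis
  proof (intro exI[of _ "sqrt r *\<^sub>R S"] conjI allI impI)
    show "positive_op (sqrt r *\<^sub>R S)" using S r by auto
    show "(sqrt r *\<^sub>R S) o\<^sub>L (sqrt r *\<^sub>R S) = T" using r by (simp add: compose_simps S)
    show "sqrt r *\<^sub>R S \<in> A" if A: "closed_subalgebra A" "T \<in> A" for A
      using A S(3)[of A] closed_subalgebraD[OF A(1)] by (simp add: X_def)
  qed
qed

text \<open>\<open>(S + S') (S - S') = 0\<close>, and positivity makes each summand vanish on the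
  range of \<open>D = S - S'\<close>; so \<open>D^2 = 0\<close>, and \<open>D = 0\<close> as
  \<open>D\<close> is selfadjoint.\<close>

lemma sqrt_unique:
  assumes S: "positive_op S" and S': "positive_op S'" and eq: "S o\<^sub>L S = S' o\<^sub>L S'"
    and comm: "S o\<^sub>L S' = S' o\<^sub>L S"
  shows "S = S'"
proof -
  have sa: "selfadj S" "selfadj S'" using S S' positive_opD by auto
  define D where "D = S - S'"
  have D: "selfadj D" using sa by (simp add: D_def)
  have "(S + S') o\<^sub>L D = 0" by (simp add: D_def compose_simps eq comm)
  then have z: "S (D x) + S' (D x) = 0" for x
    by (metis blinfun.add_left blinfun_apply_blinfun_compose zero_blinfun.rep_eq)
  have "D x = 0" for x
  proof -
    have "inner (S (D x)) (D x) + inner (S' (D x)) (D x) = 0"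
      by (simp add: z flip: inner_add_left)
    moreover have "0 \<le> inner (S (D x)) (D x)" "0 \<le> inner (S' (D x)) (D x)"
      using S S' positive_opD by auto
    ultimately have "inner (S (D x)) (D x) = 0" "inner (S' (D x)) (D x) = 0" by auto
    then have "S (D x) = 0" "S' (D x) = 0" using S S' positive_inner_zero by auto
    then have "D (D x) = 0" by (simp add: D_def blinfun.diff_left)
    then have "inner (D x) (D x) = 0" using selfadj_inner[OF D, of "D x" x] by simp
    then show ?thesis by simp
  qed
  then show ?thesis by (intro blinfun_eqI) (simp add: D_def blinfun.diff_left)
qed

text \<open>Two given roots need not be known to commute with each other. Each commutes with
  \<open>T\<close>, hence with the constructed root, and is compared with that one.\<close>

lemma sqrt_op_eqI:
  assumes "positive_op S" "S o\<^sub>L S = T"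
  shows "sqrt_op T = S"
proof -
  have T: "positive_op T" using assms positive_square positive_opD by blast
  have *: "S' = S''" if S': "positive_op S'" "S' o\<^sub>L S' = T"
    and S'': "positive_op S''" "S'' o\<^sub>L S'' = T" for S' S''
  proof -
    obtain R where R: "positive_op R" "R o\<^sub>L R = T" "\<forall>A. closed_subalgebra A \<longrightarrow> T \<in> A \<longrightarrow> R \<in> A"
      using ex_sqrt[OF T] by blast
    have **: "V = R" if V: "positive_op V" "V o\<^sub>L V = T" for V
    proof (rule sqrt_unique)
      have "T \<in> {x. V o\<^sub>L x = x o\<^sub>L V}" by (simp add: compose_assoc flip: V(2))
      then show "V o\<^sub>L R = R o\<^sub>L V"
        using R(3) closed_subalgebra_commuting[of V] by blast
    qed (use V R in auto)
    show ?thesis using **[OF S'] **[OF S''] by simp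
  qed
  show ?thesis
    unfolding sqrt_op_def
  proof (rule the_equality)
    show "positive_op S \<and> S o\<^sub>L S = T" using assms by simp
    show "S' = S" if "positive_op S' \<and> S' o\<^sub>L S' = T" for S'
      using *[of S' S] that assms by simp
  qed
qed

lemma
  assumes "positive_op T"
  shows positive_sqrt_op: "positive_op (sqrt_op T)"
    and sqrt_op_square: "sqrt_op T o\<^sub>L sqrt_op T = T"
    and sqrt_op_in_closed_subalgebra: "closed_subalgebra A \<Longrightarrow> T \<in> A \<Longrightarrow> sqrt_op T \<in> A"
proof -
  obtain S where S: "positive_op S" "S o\<^sub>L S = T" "\<And>A. closed_subalgebra A \<Longrightarrow> T \<in> A \<Longrightarrow> S \<in> A"
    using ex_sqrt[OF assms] by blast
  then have "sqrt_op T = S" by (intro sqrt_op_eqI)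
  then show "positive_op (sqrt_op T)" "sqrt_op T o\<^sub>L sqrt_op T = T"
    "closed_subalgebra A \<Longrightarrow> T \<in> A \<Longrightarrow> sqrt_op T \<in> A"
    using S by simp_all
qed

lemma sqrt_op_commute:
  assumes "positive_op T" "R o\<^sub>L T = T o\<^sub>L R"
  shows "R o\<^sub>L sqrt_op T = sqrt_op T o\<^sub>L R"
  using sqrt_op_in_closed_subalgebra[OF assms(1) closed_subalgebra_commuting[of R]] assms(2) by simp

text \<open>With \<open>R\<close> the root of \<open>S\<close>, the product equals
  \<open>R T R\<close>.\<close>

lemma positive_compose:
  assumes "positive_op S" "positive_op T" "S o\<^sub>L T = T o\<^sub>L S"
  shows "positive_op (S o\<^sub>L T)"
proof -
  let ?R = "sqrt_op S"
  have "T o\<^sub>L ?R = ?R o\<^sub>L T" using assms by (intro sqrt_op_commute) simp_all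
  then have "S o\<^sub>L T = ?R o\<^sub>L (T o\<^sub>L ?R)"
    by (metis compose_assoc sqrt_op_square assms(1))
  then show ?thesis
    using positive_sandwich positive_opD(1) positive_sqrt_op assms by metis
qed

section \<open>Inverses by the Neumann series\<close>

primrec neumann_iter :: "'a::complex_hilbert_space endo \<Rightarrow> nat \<Rightarrow> 'a endo" where
  "neumann_iter x 0 = id_blinfun"
| "neumann_iter x (Suc n) = id_blinfun + (x o\<^sub>L neumann_iter x n)"

lemma ex_inverse:
  assumes x: "norm x < 1"
  shows "\<exists>N. N o\<^sub>L (id_blinfun - x) = id_blinfun \<and> (id_blinfun - x) o\<^sub>L N = id_blinfun \<and>
    (\<forall>A. closed_subalgebra A \<longrightarrow> x \<in> A \<longrightarrow> N \<in> A)"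
proof -
  have "norm (neumann_iter x (Suc n) - neumann_iter x n) \<le> norm x * norm x ^ n" for n
  proof (induction n)
    case (Suc n)
    have "neumann_iter x (Suc (Suc n)) - neumann_iter x (Suc n)
        = x o\<^sub>L (neumann_iter x (Suc n) - neumann_iter x n)"
      by (simp add: compose_simps)
    then have "norm (neumann_iter x (Suc (Suc n)) - neumann_iter x (Suc n))
        \<le> norm x * norm (neumann_iter x (Suc n) - neumann_iter x n)"
      by (simp only: norm_blinfun_compose)
    also have "\<dots> \<le> norm x * (norm x * norm x ^ n)" by (intro mult_left_mono Suc) auto
    finally show ?case by simp
  qed simp
  moreover have "summable (\<lambda>n. norm x * norm x ^ n)"
    using x by (intro summable_mult summable_geometric) simp
  ultimately have "convergent (neumann_iter x)"
    by (intro summable_increments_imp_convergent)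
  then obtain N where N: "neumann_iter x \<longlonglongrightarrow> N" by (auto simp: convergent_def)
  have NA: "N \<in> A" if A: "closed_subalgebra A" "x \<in> A" for A
  proof -
    have "neumann_iter x n \<in> A" for n
      by (induction n) (simp_all only: neumann_iter.simps closed_subalgebraD[OF A(1)] A(2))
    then show ?thesis using closed_subalgebraD(1)[OF A(1)] N by (metis closed_sequentially)
  qed
  have "N = id_blinfun + (x o\<^sub>L N)"
  proof (rule LIMSEQ_unique)
    show "(\<lambda>n. neumann_iter x (Suc n)) \<longlonglongrightarrow> N" using N by (rule LIMSEQ_Suc)
    show "(\<lambda>n. neumann_iter x (Suc n)) \<longlonglongrightarrow> id_blinfun + (x o\<^sub>L N)"
      unfolding neumann_iter.simps by (intro tendsto_intros N)
  qed
  then have 1: "(id_blinfun - x) o\<^sub>L N = id_blinfun"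
    by (simp add: compose_simps algebra_simps)
  \<comment> \<open>The limit lies in the commutant of \<open>x\<close>, which turns the right
    inverse into a left inverse.\<close>
  have "x o\<^sub>L N = N o\<^sub>L x" using NA[OF closed_subalgebra_commuting[of x]] by simp
  with 1 have "N o\<^sub>L (id_blinfun - x) = id_blinfun" by (simp add: compose_simps)
  with 1 NA show ?thesis by blast
qed

lemma inv_op_eqI:
  assumes "N o\<^sub>L T = id_blinfun" "T o\<^sub>L N = id_blinfun"
  shows "inv_op T = N"
  unfolding inv_op_def
proof (rule the_equality)
  show "S = N" if "S o\<^sub>L T = id_blinfun \<and> T o\<^sub>L S = id_blinfun" for S
    by (metis assms that compose_assoc compose_id)
qed (use assms in simp)

lemma
  assumes "norm x < 1"
  shows inv_op_left: "inv_op (id_blinfun - x) o\<^sub>L (id_blinfun - x) = id_blinfun"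
    and inv_op_right: "(id_blinfun - x) o\<^sub>L inv_op (id_blinfun - x) = id_blinfun"
    and inv_op_in_closed_subalgebra:
      "closed_subalgebra A \<Longrightarrow> x \<in> A \<Longrightarrow> inv_op (id_blinfun - x) \<in> A"
proof -
  obtain N where N: "N o\<^sub>L (id_blinfun - x) = id_blinfun" "(id_blinfun - x) o\<^sub>L N = id_blinfun"
    "\<And>A. closed_subalgebra A \<Longrightarrow> x \<in> A \<Longrightarrow> N \<in> A"
    using ex_inverse[OF assms] by blast
  moreover have "inv_op (id_blinfun - x) = N" using N by (intro inv_op_eqI)
  ultimately show "inv_op (id_blinfun - x) o\<^sub>L (id_blinfun - x) = id_blinfun"
    "(id_blinfun - x) o\<^sub>L inv_op (id_blinfun - x) = id_blinfun"
    "closed_subalgebra A \<Longrightarrow> x \<in> A \<Longrightarrow> inv_op (id_blinfun - x) \<in> A"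
    by simp_all
qed

section \<open>Von Neumann algebras and kernel projections\<close>

lemma blinfun_eq_iff: "x = y \<longleftrightarrow> (\<forall>h. blinfun_apply x h = blinfun_apply y h)"
  by (auto intro: blinfun_eqI)

text \<open>Operators commuting with \<open>t\<close> are the common zeros of these maps over all
  \<open>h\<close>; this makes commutants strongly closed.\<close>

lemma continuous_map_strong_apply:
  fixes t :: "'a::real_normed_vector \<Rightarrow>\<^sub>L 'a"
  shows "continuous_map strong_operator_topology euclidean (\<lambda>x::'a \<Rightarrow>\<^sub>L 'a. t (x h) - x (t h))"
proof -
  have "continuous_map strong_operator_topology euclidean (\<lambda>x::'a \<Rightarrow>\<^sub>L 'a. t (x h))"
    using continuous_map_compose[OF strong_operator_topology_continuous_evaluation[of h],
        of euclidean "blinfun_apply t"]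
    by (simp add: o_def blinfun.continuous_on continuous_on_id)
  then show ?thesis
    by (intro continuous_map_diff strong_operator_topology_continuous_evaluation)
qed

lemma closedin_strong_commuting:
  "closedin strong_operator_topology {x::'a::real_normed_vector \<Rightarrow>\<^sub>L 'a. \<forall>t\<in>S. t o\<^sub>L x = x o\<^sub>L t}"
proof (cases "S = {}")
  case True
  then show ?thesis
    using closedin_topspace[of strong_operator_topology] by (simp add: strong_operator_topology_topspace)
next
  case False
  define F :: "('a \<Rightarrow>\<^sub>L 'a) \<times> 'a \<Rightarrow> ('a \<Rightarrow>\<^sub>L 'a) set"
    where "F th = {x::'a \<Rightarrow>\<^sub>L 'a. fst th (x (snd th)) - x (fst th (snd th)) \<in> {0}}" for th
  have "closedin strong_operator_topology (F th)" for th
    unfolding F_def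
    using closedin_continuous_map_preimage[OF continuous_map_strong_apply[of "fst th" "snd th"], of "{0}"]
    by (simp add: strong_operator_topology_topspace)
  then have "closedin strong_operator_topology (\<Inter> (F ` (S \<times> UNIV)))"
    using False by (intro closedin_Inter) auto
  also have "\<Inter> (F ` (S \<times> UNIV)) = {x. \<forall>t\<in>S. t o\<^sub>L x = x o\<^sub>L t}"
    by (auto simp: F_def blinfun_eq_iff)
  finally show ?thesis .
qed

text \<open>Complex linearity is itself a commutation condition, so strong closedness of
  \<open>bounded_ops\<close> is an instance of that of commutants.\<close>

lemma bounded_ops_eq_commuting:
  "bounded_ops = {x. \<forall>t\<in>range (\<lambda>c. scaleC_op c id_blinfun). t o\<^sub>L x = x o\<^sub>L t}"
  by (auto simp: bounded_ops_def blinfun_eq_iff)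

lemma closedin_strong_bounded_ops: "closedin strong_operator_topology bounded_ops"
  by (subst bounded_ops_eq_commuting) (rule closedin_strong_commuting)

lemma scaleC_op_of_real: "scaleC_op (complex_of_real r) x = r *\<^sub>R x"
  by (rule blinfun_eqI) (simp add: scaleC_of_real blinfun.scaleR_left)

section \<open>Commutants and generated algebras\<close>

definition commutant :: "'a::complex_hilbert_space endo set \<Rightarrow> 'a endo set"
  where "commutant S = {x \<in> bounded_ops. \<forall>t\<in>S. t o\<^sub>L x = x o\<^sub>L t}"

lemma scaleC_op_compose: "scaleC_op c x o\<^sub>L y = scaleC_op c (x o\<^sub>L y)"
  by (rule blinfun_eqI) simp

lemma compose_scaleC_op: "x \<in> bounded_ops \<Longrightarrow> x o\<^sub>L scaleC_op c y = scaleC_op c (x o\<^sub>L y)"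
  by (rule blinfun_eqI) (simp add: bounded_opsD)

lemma von_neumann_algebra_commutant:
  assumes "S \<subseteq> bounded_ops" "\<And>t. t \<in> S \<Longrightarrow> adj t \<in> S"
  shows "von_neumann_algebra (commutant S) id_blinfun"
  unfolding von_neumann_algebra_def
proof (intro conjI ballI allI)
  show "commutant S \<subseteq> bounded_ops" "id_blinfun \<in> commutant S" by (auto simp: commutant_def)
  show "closedin strong_operator_topology (commutant S)"
    using closedin_Int[OF closedin_strong_bounded_ops closedin_strong_commuting[of S]]
    by (simp add: commutant_def Int_def)
  fix x assume x: "x \<in> commutant S"
  then have xb: "x \<in> bounded_ops" and xc: "\<And>t. t \<in> S \<Longrightarrow> t o\<^sub>L x = x o\<^sub>L t"
    by (auto simp: commutant_def)
  have "t o\<^sub>L adj x = adj x o\<^sub>L t" if "t \<in> S" for t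
  proof -
    have "t \<in> bounded_ops" using that assms by auto
    then have "adj (adj t o\<^sub>L x) = adj x o\<^sub>L t" "adj (x o\<^sub>L adj t) = t o\<^sub>L adj x" using xb by auto
    then show ?thesis using xc[OF assms(2)[OF that]] by simp
  qed
  then show "adj x \<in> commutant S" using xb by (auto simp: commutant_def)
  show "scaleC_op c x \<in> commutant S" for c
    using xb xc assms(1) by (auto simp: commutant_def scaleC_op_compose compose_scaleC_op subsetD)
  fix y assume y: "y \<in> commutant S"
  then have yb: "y \<in> bounded_ops" and yc: "\<And>t. t \<in> S \<Longrightarrow> t o\<^sub>L y = y o\<^sub>L t"
    by (auto simp: commutant_def)
  show "x + y \<in> commutant S" using xb yb xc yc by (auto simp: commutant_def compose_simps)
  have "t o\<^sub>L (x o\<^sub>L y) = (x o\<^sub>L y) o\<^sub>L t" if "t \<in> S" for t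
    by (metis compose_assoc xc[OF that] yc[OF that])
  then show "x o\<^sub>L y \<in> commutant S" using xb yb by (auto simp: commutant_def)
qed auto

lemma von_neumann_algebra_Inter:
  assumes "\<And>M. M \<in> T \<Longrightarrow> von_neumann_algebra M id_blinfun" "T \<noteq> {}"
  shows "von_neumann_algebra (\<Inter> T) id_blinfun"
  unfolding von_neumann_algebra_def
proof (intro conjI ballI allI)
  show "closedin strong_operator_topology (\<Inter> T)"
    using assms by (intro closedin_Inter) (auto simp: von_neumann_algebra_def)
  obtain M where "M \<in> T" using assms(2) by blast
  then show "\<Inter> T \<subseteq> bounded_ops"
    using assms(1)[of M] unfolding von_neumann_algebra_def by auto
qed (use assms(1) in \<open>auto simp: von_neumann_algebra_def\<close>)

lemma von_neumann_algebra_generated: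
  assumes "S \<subseteq> bounded_ops"
  shows "von_neumann_algebra (generated_vna S) id_blinfun"
proof -
  have "von_neumann_algebra (commutant {}) id_blinfun" by (rule von_neumann_algebra_commutant) auto
  then have "{M. von_neumann_algebra M id_blinfun \<and> S \<subseteq> M} \<noteq> {}"
    using assms by (auto simp: commutant_def)
  then show ?thesis
    unfolding generated_vna_def hull_def by (intro von_neumann_algebra_Inter) auto
qed

lemma subset_generated_vna: "S \<subseteq> generated_vna S"
  unfolding generated_vna_def by (rule hull_subset)

lemma generated_vna_minimal: "S \<subseteq> M \<Longrightarrow> von_neumann_algebra M id_blinfun \<Longrightarrow> generated_vna S \<subseteq> M"
  unfolding generated_vna_def by (rule hull_minimal)

text \<open>Selfadjoint elements commuting with \<open>t\<close> also commute with
  \<open>adj t\<close>. They lie in the commutant of both, a von Neumann algebra, which therefore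
  contains everything they generate.\<close>

lemma commute_generated_vna:
  assumes t: "t \<in> bounded_ops" and S: "\<And>s. s \<in> S \<Longrightarrow> selfadj s" "\<And>s. s \<in> S \<Longrightarrow> t o\<^sub>L s = s o\<^sub>L t"
    and x: "x \<in> generated_vna S"
  shows "t o\<^sub>L x = x o\<^sub>L t"
proof -
  have vna: "von_neumann_algebra (commutant {t, adj t}) id_blinfun"
    using t by (intro von_neumann_algebra_commutant) auto
  have "S \<subseteq> commutant {t, adj t}"
  proof
    fix s assume s: "s \<in> S"
    then have "adj (t o\<^sub>L s) = adj (s o\<^sub>L t)" using S by simp
    then have "s o\<^sub>L adj t = adj t o\<^sub>L s" using S(1)[OF s] t by (simp add: selfadj_def)
    then show "s \<in> commutant {t, adj t}" using S[OF s] by (simp add: commutant_def selfadj_def)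
  qed
  from generated_vna_minimal[OF this vna] x show ?thesis by (auto simp: commutant_def)
qed

text \<open>The unit \<open>e\<close> is kept general because the abelian algebra in (ii) may act on
  a proper subspace.\<close>

locale vna =
  fixes M :: "'a::complex_hilbert_space endo set" and e :: "'a endo"
  assumes vna: "von_neumann_algebra M e"
begin

lemma in_bounded_ops: "x \<in> M \<Longrightarrow> x \<in> bounded_ops"
  and add_in: "x \<in> M \<Longrightarrow> y \<in> M \<Longrightarrow> x + y \<in> M"
  and compose_in: "x \<in> M \<Longrightarrow> y \<in> M \<Longrightarrow> x o\<^sub>L y \<in> M"
  and scaleC_in: "x \<in> M \<Longrightarrow> scaleC_op c x \<in> M"
  and adj_in: "x \<in> M \<Longrightarrow> adj x \<in> M"
  and unit_in: "e \<in> M"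
  and unit_left: "x \<in> M \<Longrightarrow> e o\<^sub>L x = x"
  and unit_right: "x \<in> M \<Longrightarrow> x o\<^sub>L e = x"
  and closedin_strong: "closedin strong_operator_topology M"
  using vna unfolding von_neumann_algebra_def by auto

lemma scaleR_in: "x \<in> M \<Longrightarrow> r *\<^sub>R x \<in> M"
  using scaleC_in[of x "complex_of_real r"] by (simp add: scaleC_op_of_real)

lemma uminus_in: "x \<in> M \<Longrightarrow> - x \<in> M"
  using scaleR_in[of x "-1"] by simp

lemma diff_in: "x \<in> M \<Longrightarrow> y \<in> M \<Longrightarrow> x - y \<in> M"
  using add_in[of x "- y"] uminus_in by simp

lemma zero_in: "0 \<in> M"
  using scaleR_in[OF unit_in, of 0] by simp

lemmas closure_rules = add_in compose_in scaleC_in adj_in unit_in scaleR_in uminus_in diff_in zero_in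

lemma selfadj_unit: "selfadj e"
proof -
  have "adj (adj e) = adj (e o\<^sub>L adj e)" by (simp add: unit_left adj_in unit_in)
  then have "e = adj (adj e) o\<^sub>L adj e" by (simp add: in_bounded_ops unit_in)
  then have "e = adj e" by (simp add: in_bounded_ops unit_in unit_left adj_in)
  then show ?thesis using in_bounded_ops unit_in by (simp add: selfadj_def)
qed

lemma strong_limit_in:
  fixes P :: "'a endo"
  assumes "\<And>n. T n \<in> M" "\<And>h. (\<lambda>n. blinfun_apply (T n) h) \<longlonglongrightarrow> P h"
  shows "P \<in> M"
proof (rule limitin_closedin[of strong_operator_topology T P sequentially M])
  show "limitin strong_operator_topology T P sequentially"
        unfolding limitin_def
  proof (intro conjI allI impI)
    show "P \<in> topspace strong_operator_topology" by (simp add: strong_operator_topology_topspace)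
    fix U assume U: "openin strong_operator_topology U \<and> P \<in> U"
    then obtain V where V: "open V" "U = blinfun_apply -` V"
      unfolding strong_operator_topology_def by (auto simp: openin_pullback_topology)
    have "limitin (product_topology (\<lambda>_. euclidean) UNIV) (\<lambda>n. blinfun_apply (T n)) (blinfun_apply P) sequentially"
      using assms(2) by (simp add: limitin_componentwise)
    then have "(\<lambda>n. blinfun_apply (T n)) \<longlonglongrightarrow> blinfun_apply P"
      by (simp add: euclidean_product_topology)
    then have "\<forall>\<^sub>F n in sequentially. blinfun_apply (T n) \<in> V"
      using V U by (intro topological_tendstoD) auto
    then show "\<forall>\<^sub>F n in sequentially. T n \<in> U" using V by simp
  qed
qed (use assms closedin_strong in auto)

lemma closed: "closed M"
proof (unfold closed_sequential_limits, intro allI impI, elim conjE)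
  fix T P assume T: "\<forall>n. T n \<in> M" "T \<longlonglongrightarrow> P"
  show "P \<in> M"
  proof (rule strong_limit_in[of T])
    show "(\<lambda>n. T n h) \<longlonglongrightarrow> P h" for h by (intro tendsto_intros T)
  qed (use T in simp)
qed

lemma unit_projection: "e (e h) = e h"
  using unit_left[OF unit_in] by (metis blinfun_apply_blinfun_compose)

lemma unit_apply: "x \<in> M \<Longrightarrow> e (x h) = x h" "x \<in> M \<Longrightarrow> x (e h) = x h"
  using unit_left unit_right by (metis blinfun_apply_blinfun_compose)+

lemma norm_unit_le: "norm (e h) \<le> norm h"
proof -
  have "(norm (e h))\<^sup>2 = inner (e h) h"
    using selfadj_inner[OF selfadj_unit, of "e h" h] by (simp only: power2_norm_eq_inner unit_projection)
  also have "\<dots> \<le> norm (e h) * norm h" by (rule norm_cauchy_schwarz)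
  finally show ?thesis by (cases "norm (e h) = 0") (auto simp: power2_eq_square)
qed

end

lemma (in vna) closed_subalgebra:
  assumes "e = id_blinfun"
  shows "closed_subalgebra M"
  using closed unit_in assms by (simp add: closed_subalgebra_def closure_rules)

section \<open>Kernel projections as strong limits of powers\<close>

locale vna_contraction = vna +
  fixes x
  assumes x_in: "x \<in> M" and selfadj_x: "selfadj x" and norm_x: "norm x \<le> 1"
begin

text \<open>\<open>e - x\<^sup>2\<close> is a contraction whose fixed space in the range of \<open>e\<close> is the kernel of \<open>x\<close>; its
  even powers converge strongly.\<close>

primrec power_iter :: "nat \<Rightarrow> 'a endo" where
  "power_iter 0 = e"
| "power_iter (Suc n) = (e - (x o\<^sub>L x)) o\<^sub>L power_iter n"

lemma power_iter_in: "power_iter n \<in> M"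
  by (induction n) (simp_all add: closure_rules x_in)

lemma power_iter_add: "power_iter m o\<^sub>L power_iter n = power_iter (m + n)"
  by (induction m) (simp_all add: unit_left power_iter_in compose_assoc)

lemma selfadj_power_iter: "selfadj (power_iter n)"
proof (induction n)
  case (Suc n)
  have "power_iter 1 o\<^sub>L power_iter n = power_iter n o\<^sub>L power_iter 1"
    by (simp only: power_iter_add add.commute)
  moreover have "power_iter 1 = e - (x o\<^sub>L x)"
    by (simp add: unit_right closure_rules x_in)
  moreover have "selfadj (e - (x o\<^sub>L x))"
    using selfadj_unit selfadj_x by simp
  ultimately show ?case using Suc by (simp add: selfadj_compose)
qed (simp add: selfadj_unit)

text \<open>Together the two facts say that one step lowers the squared norm by at least that of
  \<open>x g\<close>; a vector whose norm is preserved lies in the kernel of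
  \<open>x\<close>.\<close>

lemma norm_step:
  assumes "e g = g"
  shows "(norm ((e - (x o\<^sub>L x)) g))\<^sup>2 = (norm g)\<^sup>2 - 2 * (norm (x g))\<^sup>2 + (norm (x (x g)))\<^sup>2"
    and "(norm (x (x g)))\<^sup>2 \<le> (norm (x g))\<^sup>2"
proof -
  have "inner g (x (x g)) = inner (x g) (x g)" by (simp only: selfadj_inner[OF selfadj_x])
  then show "(norm ((e - (x o\<^sub>L x)) g))\<^sup>2 = (norm g)\<^sup>2 - 2 * (norm (x g))\<^sup>2 + (norm (x (x g)))\<^sup>2"
    by (simp only: power2_norm_eq_inner)
      (simp add: blinfun.diff_left assms inner_diff inner_commute[of "x (x g)" g])
  have "norm (x (x g)) \<le> norm x * norm (x g)" by (rule norm_blinfun)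
  also have "\<dots> \<le> 1 * norm (x g)" by (intro mult_right_mono norm_x) auto
  finally show "(norm (x (x g)))\<^sup>2 \<le> (norm (x g))\<^sup>2" by (simp add: power_mono)
qed

lemma norm_step_le:
  assumes "e g = g"
  shows "norm ((e - (x o\<^sub>L x)) g) \<le> norm g"
proof -
  have "(norm ((e - (x o\<^sub>L x)) g))\<^sup>2 \<le> (norm g)\<^sup>2"
    using norm_step[OF assms] zero_le_power2[of "norm (x g)"] by linarith
  then show ?thesis by (simp add: power2_le_iff_abs_le)
qed

lemma norm_power_iter_decseq: "norm (power_iter (Suc n) h) \<le> norm (power_iter n h)"
  using norm_step_le[of "power_iter n h"] by (simp add: unit_apply power_iter_in)

lemma inner_power_iter: "inner (power_iter m h) (power_iter n h) = inner (power_iter (m + n) h) h"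
proof -
  have "inner (power_iter n (power_iter m h)) h = inner (power_iter m h) (power_iter n h)"
    by (rule selfadj_inner[OF selfadj_power_iter])
  moreover have "power_iter n (power_iter m h) = power_iter (m + n) h"
    by (subst add.commute) (simp flip: power_iter_add)
  ultimately show ?thesis by simp
qed

text \<open>Inner products of iterates depend only on the sum of the indices, and even indices make
  that product a value \<open>a (i + j)\<close> of the decreasing sequence of squared norms. Squared
  distances are thus differences of values of a convergent sequence.\<close>

lemma convergent_power_iter: "convergent (\<lambda>n. power_iter (2 * n) h)"
proof -
  define a where "a n = (norm (power_iter n h))\<^sup>2" for n
  have a: "a n = inner (power_iter (2 * n) h) h" for n
    using inner_power_iter[of n h n] by (simp add: a_def power2_norm_eq_inner mult_2)
  have "decseq a"
    unfolding a_def by (intro decseq_SucI power_mono norm_power_iter_decseq) auto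
  then obtain L where "a \<longlonglongrightarrow> L"
    using decseq_convergent[of a 0] by (auto simp: a_def)
  then have "Cauchy a" by (rule LIMSEQ_imp_Cauchy)
  have diff: "(norm (power_iter (2 * i) h - power_iter (2 * j) h))\<^sup>2
      = (a (2 * i) - a (i + j)) + (a (2 * j) - a (i + j))" for i j
  proof -
    have "inner (power_iter (2 * i) h) (power_iter (2 * j) h) = a (i + j)"
      using inner_power_iter[of "2 * i" h "2 * j"] by (simp add: a distrib_left)
    then show ?thesis
      by (simp only: power2_norm_eq_inner a_def)
        (simp add: inner_diff inner_commute[of "power_iter (2 * j) h" "power_iter (2 * i) h"])
  qed
  have "Cauchy (\<lambda>n. power_iter (2 * n) h)"
  proof (rule metric_CauchyI)
    fix \<epsilon> :: real assume "\<epsilon> > 0"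
    then obtain N where N: "\<And>i j. i \<ge> N \<Longrightarrow> j \<ge> N \<Longrightarrow> dist (a i) (a j) < \<epsilon>\<^sup>2 / 2"
      using metric_CauchyD[OF \<open>Cauchy a\<close>, of "\<epsilon>\<^sup>2 / 2"] by auto
    have "dist (power_iter (2 * i) h) (power_iter (2 * j) h) < \<epsilon>" if "i \<ge> N" "j \<ge> N" for i j
    proof -
      have "(norm (power_iter (2 * i) h - power_iter (2 * j) h))\<^sup>2 < \<epsilon>\<^sup>2"
        using N[of "2 * i" "i + j"] N[of "2 * j" "i + j"] that
        unfolding diff dist_real_def by linarith
      then show ?thesis using \<open>\<epsilon> > 0\<close> by (simp add: dist_norm power2_less_imp_less)
    qed
    then show "\<exists>M. \<forall>i\<ge>M. \<forall>j\<ge>M. dist (power_iter (2 * i) h) (power_iter (2 * j) h) < \<epsilon>" by blast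
  qed
  then show ?thesis by (rule Cauchy_convergent)
qed

lemma ex_kernel_projection_contraction:
  "\<exists>k\<in>M. selfadj k \<and> k o\<^sub>L k = k \<and> x o\<^sub>L k = 0 \<and> (\<forall>h. e h = h \<longrightarrow> x h = 0 \<longrightarrow> k h = h) \<and>
    (\<forall>R. R o\<^sub>L x = x o\<^sub>L R \<longrightarrow> R o\<^sub>L e = e o\<^sub>L R \<longrightarrow> R o\<^sub>L k = k o\<^sub>L R)"
proof -
  define P where "P h = lim (\<lambda>n. power_iter (2 * n) h)" for h
  have lim: "(\<lambda>n. power_iter (2 * n) h) \<longlonglongrightarrow> P h" for h
    unfolding P_def using convergent_power_iter by (simp add: convergent_LIMSEQ_iff)
  have bound: "norm (power_iter n h) \<le> norm h" for n h
  proof (induction n)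
    case (Suc n)
    then show ?case using norm_power_iter_decseq[of n h] by linarith
  qed (simp add: norm_unit_le)
  have "bounded_linear P"
  proof (rule bounded_linear_intro)
    show "P (h + h') = P h + P h'" for h h'
      by (rule LIMSEQ_unique[OF lim])
        (simp add: blinfun.add_right tendsto_add lim)
    show "P (r *\<^sub>R h) = r *\<^sub>R P h" for r h
      by (rule LIMSEQ_unique[OF lim])
        (simp add: blinfun.scaleR_right tendsto_scaleR lim)
    show "norm (P h) \<le> norm h * 1" for h
      by (rule LIMSEQ_le_const2[OF tendsto_norm[OF lim]]) (simp add: bound)
  qed
  define k where "k = Blinfun P"
  have k: "blinfun_apply k = P"
    unfolding k_def by (rule bounded_linear_Blinfun_apply) fact
  have kM: "k \<in> M"
    by (rule strong_limit_in[of "\<lambda>n. power_iter (2 * n)"]) (simp_all add: power_iter_in k lim)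
  have sa: "selfadj k"
  proof (rule selfadjI)
    show "k \<in> bounded_ops" using kM in_bounded_ops by blast
    fix h h'
    show "inner (k h) h' = inner h (k h')"
    proof (rule LIMSEQ_unique)
      show "(\<lambda>n. inner (power_iter (2 * n) h) h') \<longlonglongrightarrow> inner (k h) h'"
        unfolding k by (intro tendsto_intros lim)
      show "(\<lambda>n. inner (power_iter (2 * n) h) h') \<longlonglongrightarrow> inner h (k h')"
        unfolding k selfadj_inner[OF selfadj_power_iter] by (intro tendsto_intros lim)
    qed
  qed
  have fix1: "k h = h" if "e h = h" "x h = 0" for h
  proof -
    have "power_iter n h = h" for n
      using that by (induction n) (simp_all add: blinfun.diff_left blinfun.zero_right)
    then show ?thesis using lim[of h] by (simp add: k LIMSEQ_const_iff)
  qed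
  have xk: "x (k h) = 0" for h
  proof -
    define g where "g = k h"
    define y where "y = e - (x o\<^sub>L x)"
    have eg: "e g = g" by (simp add: g_def unit_apply kM)
    have yM: "y \<in> M" by (simp add: y_def closure_rules x_in)
    \<comment> \<open>Passing to the next even power applies \<open>y\<close> twice and does not
      change the limit.\<close>
    have "y (y g) = g"
    proof (rule LIMSEQ_unique)
      show "(\<lambda>n. y (y (power_iter (2 * n) h))) \<longlonglongrightarrow> y (y g)"
        unfolding g_def k by (intro tendsto_intros lim)
      show "(\<lambda>n. y (y (power_iter (2 * n) h))) \<longlonglongrightarrow> g"
        unfolding g_def k using LIMSEQ_Suc[OF lim[of h]] by (simp add: y_def)
    qed
    moreover have "norm (y (y g)) \<le> norm (y g)" "norm (y g) \<le> norm g"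
      unfolding y_def using norm_step_le[of g] norm_step_le[of "y g"] eg yM
      by (simp_all add: y_def unit_apply)
    ultimately have "norm (y g) = norm g" by simp
    \<comment> \<open>Both applications of the contraction \<open>y\<close> must preserve the norm,
      so the loss computed in \<open>norm_step\<close> is zero.\<close>
    then have "2 * (norm (x g))\<^sup>2 = (norm (x (x g)))\<^sup>2"
      using norm_step(1)[OF eg] by (simp add: y_def)
    then have "(norm (x g))\<^sup>2 \<le> 0" using norm_step(2)[OF eg] by linarith
    then show ?thesis by (simp add: g_def)
  qed
  have "k o\<^sub>L k = k"
    by (rule blinfun_eqI) (simp add: fix1 xk unit_apply kM)
  moreover have "x o\<^sub>L k = 0" by (rule blinfun_eqI) (simp add: xk)
  moreover have "R o\<^sub>L k = k o\<^sub>L R" if R: "R o\<^sub>L x = x o\<^sub>L R" "R o\<^sub>L e = e o\<^sub>L R" for R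
  proof (rule blinfun_eqI)
    fix h
    have Rx: "R (x g) = x (R g)" and Re: "R (e g) = e (R g)" for g
      using R by (metis blinfun_apply_blinfun_compose)+
    have comm: "R (power_iter n h) = power_iter n (R h)" for n
      by (induction n) (simp_all add: Rx Re blinfun.diff_left blinfun.diff_right)
    have "R (P h) = P (R h)"
    proof (rule LIMSEQ_unique)
      show "(\<lambda>n. R (power_iter (2 * n) h)) \<longlonglongrightarrow> R (P h)" by (intro tendsto_intros lim)
      show "(\<lambda>n. R (power_iter (2 * n) h)) \<longlonglongrightarrow> P (R h)" unfolding comm by (rule lim)
    qed
    then show "(R o\<^sub>L k) h = (k o\<^sub>L R) h" by (simp add: k)
  qed
  ultimately show ?thesis using sa fix1 kM by (intro bexI[of _ k] conjI allI impI) simp_all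
qed

end

context vna
begin

lemma ex_kernel_projection:
  assumes "x \<in> M" "selfadj x"
  obtains k where "k \<in> M" "selfadj k" "k o\<^sub>L k = k" "x o\<^sub>L k = 0"
    "\<And>h. e h = h \<Longrightarrow> x h = 0 \<Longrightarrow> k h = h"
    "\<And>R. R o\<^sub>L x = x o\<^sub>L R \<Longrightarrow> R o\<^sub>L e = e o\<^sub>L R \<Longrightarrow> R o\<^sub>L k = k o\<^sub>L R"
proof -
  define r where "r = 1 / (norm x + 1)"
  have r: "r > 0" by (simp add: r_def add_nonneg_pos)
  have "norm (r *\<^sub>R x) \<le> 1" using r by (simp add: r_def divide_le_eq)
  then interpret c: vna_contraction M e "r *\<^sub>R x"
    using assms by unfold_locales (simp_all add: scaleR_in)
  obtain k where k: "k \<in> M" "selfadj k" "k o\<^sub>L k = k" "(r *\<^sub>R x) o\<^sub>L k = 0"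
    "\<forall>h. e h = h \<longrightarrow> (r *\<^sub>R x) h = 0 \<longrightarrow> k h = h"
    "\<forall>R. R o\<^sub>L (r *\<^sub>R x) = (r *\<^sub>R x) o\<^sub>L R \<longrightarrow> R o\<^sub>L e = e o\<^sub>L R \<longrightarrow> R o\<^sub>L k = k o\<^sub>L R"
    using c.ex_kernel_projection_contraction by (elim bexE conjE) (rule that)
  show ?thesis
  proof (rule that[of k])
    show "x o\<^sub>L k = 0" using k(4) r by (simp add: compose_simps)
    show "k h = h" if "e h = h" "x h = 0" for h using k(5)[rule_format, of h] that by (simp add: blinfun.scaleR_left)
    show "R o\<^sub>L k = k o\<^sub>L R" if "R o\<^sub>L x = x o\<^sub>L R" "R o\<^sub>L e = e o\<^sub>L R" for R
      using k(6)[rule_format, of R] that by (simp add: compose_simps)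
  qed (use k in auto)
qed

end

section \<open>Strict elements and signs\<close>

lemma zero_op_le [simp]: "0 \<preceq> x \<longleftrightarrow> positive_op x"
  by (simp add: op_le_def)

lemma projection_iff: "projection p \<longleftrightarrow> selfadj p \<and> p o\<^sub>L p = p"
  by (auto simp: projection_def selfadj_def)

lemma positive_projection: "selfadj p \<Longrightarrow> p o\<^sub>L p = p \<Longrightarrow> positive_op p"
  using positive_square[of p] by simp

lemma positive_sum_inner_zero:
  assumes "positive_op S" "positive_op T" "inner ((S + T) h) h \<le> 0"
  shows "S h = 0" "T h = 0"
proof -
  have "inner (S h) h \<ge> 0" "inner (T h) h \<ge> 0" using assms positive_opD by auto
  moreover have "inner (S h) h + inner (T h) h \<le> 0"
    using assms(3) by (simp add: blinfun.add_left inner_add_left)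
  ultimately have "inner (S h) h = 0" "inner (T h) h = 0" by auto
  then show "S h = 0" "T h = 0" using assms positive_inner_zero by auto
qed

lemma complement_apply_eq_0: "(id_blinfun - p) g = 0 \<longleftrightarrow> p g = g"
  by (auto simp: blinfun.diff_left)

lemma abs_op_eqI: "positive_op T \<Longrightarrow> T o\<^sub>L T = adj u o\<^sub>L u \<Longrightarrow> abs_op u = T"
  unfolding abs_op_def by (rule sqrt_op_eqI)

context vna
begin

text \<open>If \<open>k\<close> is the kernel projection, \<open>r = e - k\<close> is a projection
  above \<open>x\<close>, because \<open>r - x = r (e - x) r\<close>. Strictness makes it equal to
  \<open>e\<close>.\<close>

lemma strict_in_injective:
  assumes x: "strict_in M e x" and h: "e h = h" "x h = 0"
  shows "h = 0"
proof -
  have xM: "x \<in> M" and pos: "positive_op x" "positive_op (e - x)"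
    and strict: "\<And>p q. p \<in> M \<Longrightarrow> q \<in> M \<Longrightarrow> projection p \<Longrightarrow> projection q \<Longrightarrow> p \<preceq> x \<Longrightarrow> x \<preceq> q
      \<Longrightarrow> p = 0 \<and> q = e"
    using x by (auto simp: strict_in_def op_le_def)
  have sa: "selfadj x" using pos positive_opD by blast
  obtain k where k: "k \<in> M" "selfadj k" "k o\<^sub>L k = k" "x o\<^sub>L k = 0"
    "\<And>h. e h = h \<Longrightarrow> x h = 0 \<Longrightarrow> k h = h"
    by (rule ex_kernel_projection[OF xM sa]) (rule that)
  have kx: "k o\<^sub>L x = 0"
    using arg_cong[OF k(4), of adj] k(2) sa by (simp add: selfadj_def)
  define r where "r = e - k"
  have r: "r \<in> M" "selfadj r" "r o\<^sub>L r = r"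
    using k selfadj_unit
    by (simp_all add: r_def closure_rules compose_simps unit_left unit_right unit_in)
  have "r o\<^sub>L ((e - x) o\<^sub>L r) = r - x"
    using k kx xM unit_in
    by (simp add: r_def compose_simps unit_left unit_right compose_assoc)
  then have "x \<preceq> r"
    using positive_sandwich[OF r(2) pos(2)] by (simp add: op_le_def)
  then have "r = e"
    using strict[of 0 r] r pos by (simp add: zero_in projection_iff)
  then have "k = 0" by (simp add: r_def)
  then show ?thesis using k(5)[OF h] by simp
qed

text \<open>The range of a projection below \<open>x\<close> consists of vectors fixed by
  \<open>x\<close>; the complement in \<open>e\<close> of a projection above \<open>x\<close> has
  its range in the kernel of \<open>x\<close>.\<close>

lemma strict_inI:
  assumes xM: "x \<in> M" and pos: "positive_op x" "positive_op (e - x)"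
    and inj0: "\<And>h. e h = h \<Longrightarrow> x h = 0 \<Longrightarrow> h = 0"
    and inj1: "\<And>h. e h = h \<Longrightarrow> x h = h \<Longrightarrow> h = 0"
  shows "strict_in M e x"
  unfolding strict_in_def
proof (intro conjI ballI impI)
  fix p q assume pq: "p \<in> M" "q \<in> M" "projection p \<and> projection q \<and> p \<preceq> x \<and> x \<preceq> q"
  then have p: "selfadj p" "p o\<^sub>L p = p" "positive_op (x - p)"
    and q: "selfadj q" "q o\<^sub>L q = q" "positive_op (q - x)"
    by (auto simp: projection_iff op_le_def)
  show "p = 0"
  proof (rule blinfun_eqI)
    fix h
    define g where "g = p h"
    have pg: "p g = g" using p(2) unfolding g_def by (metis blinfun_apply_blinfun_compose)
    have eg: "e g = g" by (simp add: g_def unit_apply pq)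
    have "0 \<le> inner ((x - p) g) g" using p positive_opD by blast
    then have "inner ((e - x) g) g \<le> 0"
      by (simp add: blinfun.diff_left inner_diff_left pg eg)
    then have "(e - x) g = 0" using positive_sum_inner_zero(1)[of "e - x" 0] pos by simp
    then have "x g = g" using eg by (simp add: blinfun.diff_left)
    then show "p h = blinfun_apply 0 h" using inj1[OF eg] by (simp add: g_def)
  qed
  have "(e - q) h = 0" for h
  proof -
    define g where "g = (e - q) h"
    have eg: "e g = g" by (simp add: g_def unit_apply closure_rules pq)
    have "q o\<^sub>L (e - q) = 0" using q pq by (simp add: compose_simps unit_right)
    then have qg: "q g = 0" unfolding g_def by (metis blinfun_apply_blinfun_compose zero_blinfun.rep_eq)
    have "0 \<le> inner ((q - x) g) g" using q positive_opD by blast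
    then have "inner (x g) g \<le> 0" by (simp add: blinfun.diff_left inner_diff_left qg)
    then have "x g = 0" using positive_sum_inner_zero(1)[of x 0] pos by simp
    then show ?thesis using inj0[OF eg] by (simp add: g_def)
  qed
  then show "q = e" by (intro blinfun_eqI) (simp add: blinfun.diff_left)
qed (use xM pos in \<open>simp_all add: op_le_def\<close>)

end

section \<open>Centre, polar decomposition and weighted sums of two projections\<close>

locale unital_vna = vna M id_blinfun for M :: "'a::complex_hilbert_space endo set"
begin

lemma closed_subalgebra_M: "closed_subalgebra M"
  by (rule closed_subalgebra) simp

lemma sqrt_op_in: "T \<in> M \<Longrightarrow> positive_op T \<Longrightarrow> sqrt_op T \<in> M"
  using sqrt_op_in_closed_subalgebra closed_subalgebra_M by blast

lemma von_neumann_algebra_centre: "von_neumann_algebra (centre M) id_blinfun"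
proof -
  have "von_neumann_algebra (commutant M) id_blinfun"
    by (rule von_neumann_algebra_commutant) (auto simp: in_bounded_ops adj_in)
  then have "von_neumann_algebra (\<Inter> {M, commutant M}) id_blinfun"
    using vna by (intro von_neumann_algebra_Inter) auto
  also have "\<Inter> {M, commutant M} = centre M"
    unfolding centre_def commutant_def
  proof (intro set_eqI iffI)
    fix z assume "z \<in> \<Inter> {M, {x \<in> bounded_ops. \<forall>t\<in>M. t o\<^sub>L x = x o\<^sub>L t}}"
    then have "z \<in> M" "\<forall>t\<in>M. t o\<^sub>L z = z o\<^sub>L t" by blast+
    then show "z \<in> {z \<in> M. \<forall>x\<in>M. z o\<^sub>L x = x o\<^sub>L z}" by force
  next
    fix z assume "z \<in> {z \<in> M. \<forall>x\<in>M. z o\<^sub>L x = x o\<^sub>L z}"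
    then have "z \<in> M" "z \<in> bounded_ops" "\<forall>t\<in>M. t o\<^sub>L z = z o\<^sub>L t" using in_bounded_ops by force+
    then show "z \<in> \<Inter> {M, {x \<in> bounded_ops. \<forall>t\<in>M. t o\<^sub>L x = x o\<^sub>L t}}" by blast
  qed
  finally show ?thesis .
qed

lemma abelian_centre: "abelian (centre M)"
  unfolding abelian_def centre_def by blast

text \<open>With \<open>k\<close> the kernel projection of \<open>\<bar>d\<bar> - d\<close>, \<open>d\<close> is \<open>\<bar>d\<bar>\<close> on the range of \<open>k\<close> and \<open>- \<bar>d\<bar>\<close> on its
  complement, so \<open>u = 2 k - 1\<close> is a sign of \<open>d\<close>, equal to 1 on \<open>ker d\<close>.\<close>

lemma polar_decomposition:
  assumes d: "d \<in> M" "selfadj d"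
  obtains u where "u \<in> M" "selfadj u" "u o\<^sub>L u = id_blinfun"
    "abs_op d \<in> M" "positive_op (abs_op d)" "abs_op d o\<^sub>L abs_op d = d o\<^sub>L d"
    "d = abs_op d o\<^sub>L u" "u o\<^sub>L abs_op d = abs_op d o\<^sub>L u"
    "\<And>R. R o\<^sub>L d = d o\<^sub>L R \<Longrightarrow> R o\<^sub>L abs_op d = abs_op d o\<^sub>L R"
    "\<And>R. R o\<^sub>L d = d o\<^sub>L R \<Longrightarrow> R o\<^sub>L u = u o\<^sub>L R"
proof -
  define T where "T = abs_op d"
  have T_eq: "T = sqrt_op (d o\<^sub>L d)" using d by (simp add: T_def abs_op_def selfadj_def)
  have dd: "positive_op (d o\<^sub>L d)" using d by (simp add: positive_square)
  have T: "positive_op T" "T o\<^sub>L T = d o\<^sub>L d" "T \<in> M"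
    using dd d by (simp_all add: T_eq positive_sqrt_op sqrt_op_square sqrt_op_in compose_in)
  have TR: "R o\<^sub>L T = T o\<^sub>L R" if "R o\<^sub>L d = d o\<^sub>L R" for R
    unfolding T_eq using dd
  proof (rule sqrt_op_commute)
    show "R o\<^sub>L (d o\<^sub>L d) = (d o\<^sub>L d) o\<^sub>L R" by (metis compose_assoc that)
  qed
  have Td: "d o\<^sub>L T = T o\<^sub>L d" by (rule TR) simp
  have saTd: "selfadj (T - d)" using T d positive_opD by blast
  have TdM: "T - d \<in> M" using T d by (simp add: diff_in)
  obtain k where k: "k \<in> M" "selfadj k" "k o\<^sub>L k = k" "(T - d) o\<^sub>L k = 0"
    "\<And>h. id_blinfun h = h \<Longrightarrow> (T - d) h = 0 \<Longrightarrow> k h = h"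
    "\<And>R. R o\<^sub>L (T - d) = (T - d) o\<^sub>L R \<Longrightarrow> R o\<^sub>L id_blinfun = id_blinfun o\<^sub>L R \<Longrightarrow> R o\<^sub>L k = k o\<^sub>L R"
    by (rule ex_kernel_projection[OF TdM saTd]) (rule that)
  have kR: "R o\<^sub>L k = k o\<^sub>L R" if "R o\<^sub>L d = d o\<^sub>L R" for R
    using that TR[OF that] by (intro k(6)) (simp_all add: compose_simps)
  define u where "u = 2 *\<^sub>R k - id_blinfun"
  \<comment> \<open>\<open>T^2 = d^2\<close> with \<open>T\<close> and \<open>d\<close> commuting:
    the range of \<open>T + d\<close> lies in the kernel of \<open>T - d\<close>, where
    \<open>k\<close> acts as the identity.\<close>
  have "(T - d) o\<^sub>L (T + d) = 0" using T Td by (simp add: compose_simps)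
  then have "(T - d) ((T + d) h) = 0" for h
    by (metis blinfun_apply_blinfun_compose zero_blinfun.rep_eq)
  then have "k ((T + d) h) = (T + d) h" for h by (intro k(5)) simp_all
  then have k1: "k o\<^sub>L (T + d) = T + d" by (intro blinfun_eqI) simp
  have kT: "k o\<^sub>L T = T o\<^sub>L k" and kd: "k o\<^sub>L d = d o\<^sub>L k"
    by (rule kR[OF Td[symmetric], symmetric], rule kR[OF refl, symmetric])
  have k0: "T o\<^sub>L k = d o\<^sub>L k" using k(4) by (simp only: compose_simps right_minus_eq)
  \<comment> \<open>As \<open>T k = d k\<close>, this reads \<open>T + d = 2 T k\<close>, that is,
    \<open>d = T (2 k - I)\<close>.\<close>
  have "T + d = k o\<^sub>L (T + d)" by (simp only: k1)
  also have "\<dots> = (T o\<^sub>L k) + (d o\<^sub>L k)" by (simp only: compose_simps kT kd)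
  finally have sum_eq: "T + d = (T o\<^sub>L k) + (d o\<^sub>L k)" .
  have "d = (T + d) - T" by simp
  also have "\<dots> = ((T o\<^sub>L k) + (d o\<^sub>L k)) - T" by (simp only: sum_eq)
  also have "\<dots> = T o\<^sub>L u" by (simp add: u_def compose_simps k0 scaleR_2)
  finally have dT: "d = T o\<^sub>L u" .
  have uM: "u \<in> M" using k(1) by (simp add: u_def closure_rules)
  have usa: "selfadj u" using k(2) by (simp add: u_def)
  have uu: "u o\<^sub>L u = id_blinfun" by (simp add: u_def compose_simps scaleR_2 k(3))
  have uT: "u o\<^sub>L T = T o\<^sub>L u" by (simp add: u_def compose_simps kT)
  have uR: "R o\<^sub>L u = u o\<^sub>L R" if "R o\<^sub>L d = d o\<^sub>L R" for R
    by (simp add: u_def compose_simps kR[OF that])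
  show ?thesis
    using that[OF uM usa uu T(3,1,2)[unfolded T_def] dT[unfolded T_def] uT[unfolded T_def]
        TR[unfolded T_def] uR] .
qed

text \<open>On the range of a projection below \<open>A = G p + K q\<close> the complement
  \<open>I - A = G p' + K q'\<close> vanishes; its summands are positive and \<open>G\<close>,
  \<open>K\<close> injective, so that range lies under both \<open>p\<close> and \<open>q\<close>.
  Dually, the complement of a projection above \<open>A\<close> is killed by both. The hypotheses
  \<open>one\<close> and \<open>zero\<close> exclude these two cases.\<close>

lemma strict_combination:
  assumes G: "G \<in> M" "positive_op G" "\<And>h. G h = 0 \<Longrightarrow> h = 0"
    and K: "K \<in> M" "positive_op K" "\<And>h. K h = 0 \<Longrightarrow> h = 0"
    and GK: "G + K = id_blinfun"
    and p: "p \<in> M" "selfadj p" "p o\<^sub>L p = p" "p o\<^sub>L G = G o\<^sub>L p"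
    and q: "q \<in> M" "selfadj q" "q o\<^sub>L q = q" "q o\<^sub>L K = K o\<^sub>L q"
    and one: "\<And>t. t \<in> M \<Longrightarrow> selfadj t \<Longrightarrow> p o\<^sub>L t = t \<Longrightarrow> q o\<^sub>L t = t \<Longrightarrow> t = 0"
    and zero: "\<And>t. t \<in> M \<Longrightarrow> selfadj t \<Longrightarrow> p o\<^sub>L t = 0 \<Longrightarrow> q o\<^sub>L t = 0 \<Longrightarrow> t = 0"
  shows "strict_in M id_blinfun ((G o\<^sub>L p) + (K o\<^sub>L q))"
  unfolding strict_in_def
proof (intro conjI ballI impI)
  define A where "A = (G o\<^sub>L p) + (K o\<^sub>L q)"
  define p' where "p' = id_blinfun - p"
  define q' where "q' = id_blinfun - q"
  have p': "selfadj p'" "p' o\<^sub>L p' = p'" "p' o\<^sub>L G = G o\<^sub>L p'"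
    using p by (simp_all add: p'_def compose_simps)
  have q': "selfadj q'" "q' o\<^sub>L q' = q'" "q' o\<^sub>L K = K o\<^sub>L q'"
    using q by (simp_all add: q'_def compose_simps)
  have pos: "positive_op (G o\<^sub>L p)" "positive_op (K o\<^sub>L q)"
    "positive_op (G o\<^sub>L p')" "positive_op (K o\<^sub>L q')"
    using positive_compose[OF G(2) positive_projection[OF p(2,3)]] p(4)
      positive_compose[OF K(2) positive_projection[OF q(2,3)]] q(4)
      positive_compose[OF G(2) positive_projection[OF p'(1,2)]] p'(3)
      positive_compose[OF K(2) positive_projection[OF q'(1,2)]] q'(3)
    by simp_all
  have A': "id_blinfun - A = (G o\<^sub>L p') + (K o\<^sub>L q')"
  proof -
    have "(G o\<^sub>L p') + (K o\<^sub>L q') = (G + K) - A"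
      by (simp add: A_def p'_def q'_def compose_simps)
    then show ?thesis using GK by simp
  qed
  show "(G o\<^sub>L p) + (K o\<^sub>L q) \<in> M" using G K p q by (simp add: closure_rules)
  show "0 \<preceq> (G o\<^sub>L p) + (K o\<^sub>L q)" using pos by simp
  show "(G o\<^sub>L p) + (K o\<^sub>L q) \<preceq> id_blinfun"
    unfolding op_le_def A_def[symmetric] A' using pos by auto
  fix t s assume ts: "t \<in> M" "s \<in> M" "projection t \<and> projection s \<and>
      t \<preceq> (G o\<^sub>L p) + (K o\<^sub>L q) \<and> (G o\<^sub>L p) + (K o\<^sub>L q) \<preceq> s"
  then have t: "selfadj t" "t o\<^sub>L t = t" "positive_op (A - t)"
    and s: "selfadj s" "s o\<^sub>L s = s" "positive_op (s - A)"
    by (auto simp: projection_iff op_le_def A_def)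
  show "t = 0"
  proof (rule one)
    have *: "p (t h) = t h \<and> q (t h) = t h" for h
    proof -
      define g where "g = t h"
      have tg: "t g = g" using t(2) unfolding g_def by (metis blinfun_apply_blinfun_compose)
      have "0 \<le> inner ((A - t) g) g" using t positive_opD by blast
      then have "inner ((id_blinfun - A) g) g \<le> 0"
        by (simp add: blinfun.diff_left inner_diff_left tg)
      then have "G (p' g) = 0" "K (q' g) = 0"
        using positive_sum_inner_zero[OF pos(3,4)] unfolding A' by simp_all
      from G(3)[OF this(1)] K(3)[OF this(2)] have "p' g = 0" "q' g = 0" .
      then show ?thesis by (simp only: g_def p'_def q'_def complement_apply_eq_0)
    qed
    show "p o\<^sub>L t = t" "q o\<^sub>L t = t" using * by (auto intro: blinfun_eqI)
  qed (use t ts in auto)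
  have "id_blinfun - s = 0"
  proof (rule zero)
    have *: "p ((id_blinfun - s) h) = 0 \<and> q ((id_blinfun - s) h) = 0" for h
    proof -
      define g where "g = (id_blinfun - s) h"
      have "s o\<^sub>L (id_blinfun - s) = 0" using s by (simp add: compose_simps)
      then have sg: "s g = 0" unfolding g_def by (metis blinfun_apply_blinfun_compose zero_blinfun.rep_eq)
      have "0 \<le> inner ((s - A) g) g" using s positive_opD by blast
      then have "inner (A g) g \<le> 0" by (simp add: blinfun.diff_left inner_diff_left sg)
      then have "G (p g) = 0" "K (q g) = 0"
        using positive_sum_inner_zero[OF pos(1,2)] unfolding A_def by simp_all
      from G(3)[OF this(1)] K(3)[OF this(2)] show ?thesis unfolding g_def ..
    qed
    show "p o\<^sub>L (id_blinfun - s) = 0" "q o\<^sub>L (id_blinfun - s) = 0"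
      using * by (auto intro!: blinfun_eqI)
    show "id_blinfun - s \<in> M" using ts by (simp add: closure_rules)
    show "selfadj (id_blinfun - s)" using s by simp
  qed
  then show "s = id_blinfun" by simp
qed

end

section \<open>From strict projections to compatibility\<close>

lemma mat_mult_nth: "mat_mult A B $ i $ j = (A $ i $ 1 o\<^sub>L B $ 1 $ j) + (A $ i $ 2 o\<^sub>L B $ 2 $ j)"
  by (simp add: mat_mult_def sum_2)

lemma vector_22_nth [simp]:
  "(vector [vector [a, b], vector [c, d]] :: 'a::zero ^ 2 ^ 2) $ 1 $ 1 = a"
  "(vector [vector [a, b], vector [c, d]] :: 'a::zero ^ 2 ^ 2) $ 1 $ 2 = b"
  "(vector [vector [a, b], vector [c, d]] :: 'a::zero ^ 2 ^ 2) $ 2 $ 1 = c"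
  "(vector [vector [a, b], vector [c, d]] :: 'a::zero ^ 2 ^ 2) $ 2 $ 2 = d"
  by (simp_all add: vector_2)

lemma matrix_22_eq_iff:
  fixes A B :: "'a ^ 2 ^ 2"
  shows "A = B \<longleftrightarrow> A $ 1 $ 1 = B $ 1 $ 1 \<and> A $ 1 $ 2 = B $ 1 $ 2 \<and> A $ 2 $ 1 = B $ 2 $ 1 \<and> A $ 2 $ 2 = B $ 2 $ 2"
  by (simp add: vec_eq_iff forall_2)

lemma M2_iff: "A \<in> M2 M \<longleftrightarrow> A $ 1 $ 1 \<in> M \<and> A $ 1 $ 2 \<in> M \<and> A $ 2 $ 1 \<in> M \<and> A $ 2 $ 2 \<in> M"
  by (auto simp: M2_def forall_2)

lemma M2_strict_central_zero:
  fixes \<Phi> :: "'h::complex_hilbert_space endo \<Rightarrow> 'k::complex_hilbert_space endo ^ 2 ^ 2"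
  assumes M: "von_neumann_algebra M id_blinfun" and M0: "von_neumann_algebra M\<^sub>0 e"
    and iso: "star_isomorphism_M2 \<Phi> M M\<^sub>0" and P: "M2_strict M\<^sub>0 e (\<Phi> p)"
    and p: "p \<in> M" and t: "t \<in> centre M" "p o\<^sub>L t = t \<or> p o\<^sub>L t = 0"
  shows "t = 0"
proof -
  interpret M: unital_vna M using M by unfold_locales
  interpret Z: vna M\<^sub>0 e using M0 by unfold_locales
  have tM: "t \<in> M" and tc: "\<And>x. x \<in> M \<Longrightarrow> t o\<^sub>L x = x o\<^sub>L t"
    using t(1) unfolding centre_def by blast+
  have bij: "bij_betw \<Phi> M (M2 M\<^sub>0)"
    and add: "\<And>x y. x \<in> M \<Longrightarrow> y \<in> M \<Longrightarrow> \<Phi> (x + y) = \<Phi> x + \<Phi> y"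
    and mult: "\<And>x y. x \<in> M \<Longrightarrow> y \<in> M \<Longrightarrow> \<Phi> (x o\<^sub>L y) = mat_mult (\<Phi> x) (\<Phi> y)"
    using iso unfolding star_isomorphism_M2_def by blast+
  have zero: "\<Phi> 0 = 0" using add[of 0 0] M.zero_in by simp
  define T where "T = \<Phi> t"
  have "T \<in> M2 M\<^sub>0" using bij tM by (auto simp: T_def bij_betw_def)
  then have TM: "T $ 1 $ 1 \<in> M\<^sub>0" "T $ 1 $ 2 \<in> M\<^sub>0" "T $ 2 $ 1 \<in> M\<^sub>0" "T $ 2 $ 2 \<in> M\<^sub>0"
    by (simp_all add: M2_iff)
  have comm: "mat_mult T U = mat_mult U T" if U: "U \<in> M2 M\<^sub>0" for U
  proof -
    have "U \<in> \<Phi> ` M" using bij U by (simp add: bij_betw_def)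
    then obtain u where u: "u \<in> M" "U = \<Phi> u" by (rule imageE) simp
    then show ?thesis using mult[OF tM u(1)] mult[OF u(1) tM] tc[OF u(1)] by (simp add: T_def)
  qed
  \<comment> \<open>Commuting with the two off-diagonal matrix units, whose nonzero entry is the
    unit \<open>e\<close>, makes \<open>T\<close> a scalar matrix.\<close>
  have "mat_mult T (vector [vector [0, e], vector [0, 0]]) $ i $ j
      = mat_mult (vector [vector [0, e], vector [0, 0]]) T $ i $ j" for i j
    by (subst comm) (simp_all add: M2_iff Z.unit_in Z.zero_in)
  from this[of 1 1] this[of 1 2] this[of 2 2] have T1: "T $ 2 $ 1 = 0" "T $ 1 $ 1 = T $ 2 $ 2"
    by (simp_all add: mat_mult_nth Z.unit_left Z.unit_right TM)
  have "mat_mult T (vector [vector [0, 0], vector [e, 0]]) $ i $ j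
      = mat_mult (vector [vector [0, 0], vector [e, 0]]) T $ i $ j" for i j
    by (subst comm) (simp_all add: M2_iff Z.unit_in Z.zero_in)
  from this[of 1 1] have T2: "T $ 1 $ 2 = 0"
    by (simp_all add: mat_mult_nth Z.unit_left Z.unit_right TM)
  obtain p1 p2 where p12: "strict_in M\<^sub>0 e p1" "strict_in M\<^sub>0 e p2"
    "\<Phi> p = vector [vector [p1 o\<^sub>L p1, p1 o\<^sub>L p2], vector [p1 o\<^sub>L p2, p2 o\<^sub>L p2]]"
    using P unfolding M2_strict_def by blast
  have "mat_mult (\<Phi> p) T = T \<or> mat_mult (\<Phi> p) T = 0"
    using t(2) mult[OF p tM] zero by (auto simp: T_def)
  \<comment> \<open>Since \<open>T\<close> is diagonal, the off-diagonal entry vanishes under either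
    alternative, so both are settled at once.\<close>
  then have "mat_mult (\<Phi> p) T $ 1 $ 2 = 0" using T2 by auto
  then have pT: "p1 o\<^sub>L (p2 o\<^sub>L T $ 2 $ 2) = 0"
    by (simp add: mat_mult_nth p12(3) T2 compose_assoc)
  have p12M: "p1 \<in> M\<^sub>0" "p2 \<in> M\<^sub>0" using p12 by (auto simp: strict_in_def)
  have "T $ 2 $ 2 = 0"
  proof (rule blinfun_eqI)
    fix h
    have "p1 (p2 ((T $ 2 $ 2) h)) = 0"
      using arg_cong[OF pT, of "\<lambda>x. blinfun_apply x h"] by simp
    then have "p2 ((T $ 2 $ 2) h) = 0"
      by (rule Z.strict_in_injective[OF p12(1) Z.unit_apply(1)[OF p12M(2)]])
    then have "(T $ 2 $ 2) h = 0"
      by (rule Z.strict_in_injective[OF p12(2) Z.unit_apply(1)[OF TM(4)]])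
    then show "(T $ 2 $ 2) h = blinfun_apply 0 h" by simp
  qed
  then have "T = 0" using T1 T2 by (simp add: matrix_22_eq_iff)
  then have "\<Phi> t = \<Phi> 0" by (simp add: T_def zero)
  then show "t = 0" using bij tM M.zero_in unfolding bij_betw_def by (auto dest: inj_onD)
qed

context unital_vna
begin

lemma unital_vna_centre: "unital_vna (centre M)"
  using von_neumann_algebra_centre by unfold_locales

lemma centre_in: "z \<in> centre M \<Longrightarrow> z \<in> M"
  and centre_commute: "z \<in> centre M \<Longrightarrow> x \<in> M \<Longrightarrow> x o\<^sub>L z = z o\<^sub>L x"
  unfolding centre_def by simp_all

lemma centre_left_commute: "z \<in> centre M \<Longrightarrow> x \<in> M \<Longrightarrow> x o\<^sub>L (z o\<^sub>L w) = z o\<^sub>L (x o\<^sub>L w)"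
  by (simp only: compose_assoc[symmetric] centre_commute[of z x])

end

section \<open>The algebra generated by \<open>a\<close> and \<open>b\<close>\<close>

locale generated_by_pair =
  fixes a b x0 :: "'h::complex_hilbert_space endo" and M
  assumes selfadj_a: "selfadj a" and selfadj_b: "selfadj b"
    and M_def: "M = generated_vna {a, b}"
    and positive_x0: "positive_op x0" and x0_centre: "x0 \<in> centre M" and norm_x0: "norm x0 < 1"
begin

sublocale unital_vna M
  using von_neumann_algebra_generated[of "{a, b}"] selfadj_a selfadj_b
  by unfold_locales (simp add: M_def selfadj_def)

lemma a_in: "a \<in> M" and b_in: "b \<in> M"
  using subset_generated_vna[of "{a, b}"] by (auto simp: M_def)

lemma commute_imp_centre:
  assumes "t \<in> M" "t o\<^sub>L a = a o\<^sub>L t" "t o\<^sub>L b = b o\<^sub>L t"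
  shows "t \<in> centre M"
proof -
  have "t o\<^sub>L x = x o\<^sub>L t" if "x \<in> M" for x
    by (rule commute_generated_vna[of t "{a, b}"])
      (use assms that in_bounded_ops selfadj_a selfadj_b M_def in auto)
  then show ?thesis using assms(1) unfolding centre_def by blast
qed

definition "y = id_blinfun - x0"
definition "r = inv_op y"

lemma y_centre: "y \<in> centre M"
proof -
  interpret Z: unital_vna "centre M" by (rule unital_vna_centre)
  show ?thesis by (simp add: y_def Z.closure_rules x0_centre)
qed

lemma r_centre: "r \<in> centre M"
proof -
  interpret Z: unital_vna "centre M" by (rule unital_vna_centre)
  show ?thesis
    unfolding r_def y_def
    by (rule inv_op_in_closed_subalgebra[OF norm_x0 Z.closed_subalgebra_M x0_centre])
qed

lemma r_y: "r o\<^sub>L y = id_blinfun" and y_r: "y o\<^sub>L r = id_blinfun"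
  unfolding r_def y_def by (rule inv_op_left[OF norm_x0], rule inv_op_right[OF norm_x0])

lemma positive_y: "positive_op y"
  unfolding y_def using positive_x0 norm_x0 by (intro contraction_positive positive_opD) auto

lemma selfadj_r: "selfadj r"
proof -
  have rb: "r \<in> bounded_ops" using r_centre centre_in in_bounded_ops by blast
  have yb: "y \<in> bounded_ops" "adj y = y" using positive_y positive_opD unfolding selfadj_def by blast+
  have "adj r o\<^sub>L y = id_blinfun"
    using arg_cong[OF y_r, of adj] rb yb by simp
  then have "adj r o\<^sub>L (y o\<^sub>L r) = r" by (simp flip: compose_assoc)
  then show ?thesis using rb by (simp add: selfadj_def y_r)
qed

lemma positive_r: "positive_op r"
proof -
  have "r o\<^sub>L (y o\<^sub>L r) = r" by (simp add: y_r)
  then show ?thesis using positive_sandwich[OF selfadj_r positive_y] by simp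
qed

lemma r_injective: "r h = 0 \<Longrightarrow> h = 0"
  using arg_cong[OF y_r, of "\<lambda>x. blinfun_apply x h"] by simp

text \<open>Polar decomposition read backwards: \<open>w\<close> commutes with \<open>u\<close> and
  \<open>u^2 = I\<close>, so the square of the absolute value is \<open>w^2\<close>.\<close>

lemma abs_op_central_times_symmetry:
  assumes w: "w \<in> centre M" "positive_op w" and u: "u \<in> M" "selfadj u" "u o\<^sub>L u = id_blinfun"
  shows "abs_op (w o\<^sub>L u) = w"
proof (rule abs_op_eqI[OF w(2)])
  have wu: "u o\<^sub>L w = w o\<^sub>L u" by (rule centre_commute[OF w(1) u(1)])
  have "adj (w o\<^sub>L u) = u o\<^sub>L w"
    using u(2) positive_opD(1)[OF w(2)] by (simp add: selfadj_def)
  then have "adj (w o\<^sub>L u) o\<^sub>L (w o\<^sub>L u) = u o\<^sub>L (w o\<^sub>L (w o\<^sub>L u))" by (simp add: compose_assoc)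
  also have "\<dots> = w o\<^sub>L (w o\<^sub>L (u o\<^sub>L u))"
    by (simp only: centre_left_commute[OF w(1) u(1)])
  finally show "w o\<^sub>L w = adj (w o\<^sub>L u) o\<^sub>L (w o\<^sub>L u)" by (simp add: u(3))
qed

lemma compatible_and_strict_if_M2_strict:
  assumes pq: "M2_strict_projections TYPE('k::complex_hilbert_space) M p q"
    and w1: "w1 \<in> centre M" "positive_op w1" "strict_in M id_blinfun w1"
    and w2: "w2 \<in> centre M" "positive_op w2" "strict_in M id_blinfun w2"
    and sum: "w1 + w2 = y"
    and a: "a = (1/2) *\<^sub>R x0 + (w1 o\<^sub>L p) + (w2 o\<^sub>L q)"
    and b: "b = (1/2) *\<^sub>R x0 + (w1 o\<^sub>L p) + (w2 o\<^sub>L (id_blinfun - q))"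
  shows "compatible x0 a b" "strict_in M id_blinfun (r o\<^sub>L (a - (1/2) *\<^sub>R x0))"
    "strict_in M id_blinfun (r o\<^sub>L (b - (1/2) *\<^sub>R x0))"
proof -
  interpret Z: unital_vna "centre M" by (rule unital_vna_centre)
  obtain M0 :: "'k endo set" and e \<Phi> where M0: "von_neumann_algebra M0 e"
    and iso: "star_isomorphism_M2 \<Phi> M M0"
    and P: "M2_strict M0 e (\<Phi> p)" and Q: "M2_strict M0 e (\<Phi> q)"
    using pq unfolding M2_strict_projections_def by (elim conjE exE) (rule that)
  have proj: "selfadj s \<and> s o\<^sub>L s = s" if s: "s \<in> M" "M2_strict M0 e (\<Phi> s)" for s
  proof -
    have inj: "inj_on \<Phi> M" using iso unfolding star_isomorphism_M2_def bij_betw_def by (elim conjE)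
    have "\<Phi> (s o\<^sub>L s) = \<Phi> s" "\<Phi> (adj s) = \<Phi> s"
      using iso s unfolding star_isomorphism_M2_def M2_strict_def by simp_all
    then have "s o\<^sub>L s = s" "adj s = s"
      using inj_onD[OF inj] s(1) compose_in adj_in by simp_all
    then show ?thesis using in_bounded_ops[OF s(1)] by (simp add: selfadj_def)
  qed
  have p: "p \<in> M" "selfadj p" "p o\<^sub>L p = p" and q: "q \<in> M" "selfadj q" "q o\<^sub>L q = q"
    using pq proj P Q unfolding M2_strict_projections_def by simp_all
  define q' where "q' = id_blinfun - q"
  have q': "q' \<in> M" "selfadj q'" "q' o\<^sub>L q' = q'"
    using q by (simp_all add: q'_def compose_simps closure_rules)
  \<comment> \<open>Chosen so that \<open>a - b = w2 u\<close> and, with the next definition,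
    \<open>I - a - b = w1 v\<close>.\<close>
  define u where "u = 2 *\<^sub>R q - id_blinfun"
  define v where "v = id_blinfun - 2 *\<^sub>R p"
  have u: "u \<in> M" "selfadj u" "u o\<^sub>L u = id_blinfun"
    using q by (simp_all add: u_def compose_simps scaleR_2 closure_rules)
  have v: "v \<in> M" "selfadj v" "v o\<^sub>L v = id_blinfun"
    using p by (simp_all add: v_def compose_simps scaleR_2 closure_rules)
  have "a - b = w2 o\<^sub>L u"
    unfolding a b by (simp add: u_def compose_simps scaleR_2)
  then have abs_d: "abs_op (a - b) = w2" using abs_op_central_times_symmetry[OF w2(1,2) u] by simp
  have "id_blinfun - a - b = (y - w2) - 2 *\<^sub>R (w1 o\<^sub>L p)"
    unfolding a b y_def
    by (simp add: compose_simps scaleR_2)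
      (simp flip: scaleR_minus_left scaleR_left_diff_distrib)
  also have "\<dots> = w1 o\<^sub>L v"
    unfolding sum[symmetric] by (simp add: v_def compose_simps)
  finally have abs_s: "abs_op (id_blinfun - a - b) = w1"
    using abs_op_central_times_symmetry[OF w1(1,2) v] by simp
  show "compatible x0 a b"
    unfolding compatible_def abs_d abs_s using sum by (simp add: y_def add.commute)
  \<comment> \<open>The normalised weights: \<open>r (a - x0 / 2) = G p + K q\<close> and
    \<open>G + K = r y = I\<close>.\<close>
  define G where "G = r o\<^sub>L w1"
  define K where "K = r o\<^sub>L w2"
  have GKZ: "G \<in> centre M" "K \<in> centre M"
    unfolding G_def K_def using r_centre w1 w2 by (simp_all add: Z.closure_rules)
  have pos: "positive_op G" "positive_op K"
    unfolding G_def K_def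
    using positive_compose[OF positive_r w1(2) centre_commute[OF w1(1) centre_in[OF r_centre]]]
      positive_compose[OF positive_r w2(2) centre_commute[OF w2(1) centre_in[OF r_centre]]] .
  have G0: "h = 0" if "G h = 0" for h
  proof (rule strict_in_injective[OF w1(3)])
    show "w1 h = 0" using that by (intro r_injective[of "w1 h"]) (simp add: G_def)
  qed simp
  have K0: "h = 0" if "K h = 0" for h
  proof (rule strict_in_injective[OF w2(3)])
    show "w2 h = 0" using that by (intro r_injective[of "w2 h"]) (simp add: K_def)
  qed simp
  have GK: "G + K = id_blinfun" unfolding G_def K_def r_y[symmetric] sum[symmetric] by (simp only: compose_simps)
  \<comment> \<open>Taking adjoints, \<open>t\<close> commutes with \<open>p\<close> and
    \<open>q\<close>, hence with \<open>a\<close> and \<open>b\<close>; it is therefore central and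
    the matrix argument applies to it.\<close>
  have zero: "t = 0" if t: "t \<in> M" "selfadj t" and tp: "p o\<^sub>L t = t \<or> p o\<^sub>L t = 0"
    and tq: "q o\<^sub>L t = t \<or> q o\<^sub>L t = 0" for t
  proof (rule M2_strict_central_zero[OF vna M0 iso P p(1) _ tp])
    have swap: "t o\<^sub>L s = s o\<^sub>L t" if "selfadj s" "s o\<^sub>L t = t \<or> s o\<^sub>L t = 0" for s
    proof -
      have "adj (s o\<^sub>L t) = t o\<^sub>L s" using that(1) t(2) by (simp add: selfadj_def)
      moreover have "adj (s o\<^sub>L t) = s o\<^sub>L t" using that(2) t(2) by (auto simp: selfadj_def)
      ultimately show ?thesis by simp
    qed
    have x: "t o\<^sub>L x0 = x0 o\<^sub>L t" by (rule centre_commute[OF x0_centre t(1)])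
    have pw: "t o\<^sub>L (w1 o\<^sub>L p) = w1 o\<^sub>L (p o\<^sub>L t)" "t o\<^sub>L (w2 o\<^sub>L q) = w2 o\<^sub>L (q o\<^sub>L t)"
      "t o\<^sub>L w2 = w2 o\<^sub>L t"
      by (simp_all only: centre_left_commute[OF w1(1) t(1)] centre_left_commute[OF w2(1) t(1)]
          swap[OF p(2) tp] swap[OF q(2) tq] centre_commute[OF w2(1) t(1)])
    have "t o\<^sub>L a = a o\<^sub>L t" "t o\<^sub>L b = b o\<^sub>L t"
      unfolding a b by (simp_all only: compose_simps compose_id compose_assoc x pw)
    then show "t \<in> centre M" using commute_imp_centre t(1) by blast
  qed
  have "strict_in M id_blinfun ((G o\<^sub>L p) + (K o\<^sub>L q))"
    by (rule strict_combination[OF centre_in[OF GKZ(1)] pos(1) G0 centre_in[OF GKZ(2)] pos(2) K0 GK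
        p centre_commute[OF GKZ(1) p(1)] q centre_commute[OF GKZ(2) q(1)]]) (auto intro: zero)
  also have "(G o\<^sub>L p) + (K o\<^sub>L q) = r o\<^sub>L (a - (1/2) *\<^sub>R x0)"
    by (simp add: a G_def K_def compose_simps compose_assoc)
  finally show "strict_in M id_blinfun (r o\<^sub>L (a - (1/2) *\<^sub>R x0))" .
  \<comment> \<open>Passing to the complement of \<open>q\<close> only interchanges
    \<open>q t = 0\<close> and \<open>q t = t\<close>, so \<open>zero\<close> also covers the
    element built from \<open>b\<close>.\<close>
  have q't: "q o\<^sub>L t = 0" if "q' o\<^sub>L t = t" for t
    using that by (simp only: q'_def compose_simps compose_id diff_eq_eq) simp
  have q't0: "q o\<^sub>L t = t" if "q' o\<^sub>L t = 0" for t
    using that by (simp only: q'_def compose_simps compose_id right_minus_eq)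
  have "strict_in M id_blinfun ((G o\<^sub>L p) + (K o\<^sub>L q'))"
    by (rule strict_combination[OF centre_in[OF GKZ(1)] pos(1) G0 centre_in[OF GKZ(2)] pos(2) K0 GK
        p centre_commute[OF GKZ(1) p(1)] q' centre_commute[OF GKZ(2) q'(1)]]) (auto intro: zero q't q't0)
  also have "(G o\<^sub>L p) + (K o\<^sub>L q') = r o\<^sub>L (b - (1/2) *\<^sub>R x0)"
    by (simp add: b q'_def G_def K_def compose_simps compose_assoc)
  finally show "strict_in M id_blinfun (r o\<^sub>L (b - (1/2) *\<^sub>R x0))" .
qed

end

section \<open>Matrix units over the centre\<close>

lemma scaleC_op_add: "scaleC_op c (x + y) = scaleC_op c x + scaleC_op c y"
  by (rule blinfun_eqI) (simp add: blinfun.add_left scaleC_add_right)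

lemma norm_le_one_if_squares_sum:
  assumes "selfadj s" "selfadj t" "(s o\<^sub>L s) + (t o\<^sub>L t) = id_blinfun"
  shows "norm s \<le> 1"
proof (rule norm_blinfun_bound)
  fix h
  have "inner (s (s h)) h + inner (t (t h)) h = inner h h"
    using arg_cong[OF assms(3), of "\<lambda>x. inner (blinfun_apply x h) h"]
    by (simp add: blinfun.add_left inner_add_left)
  then have "(norm (s h))\<^sup>2 + (norm (t h))\<^sup>2 = (norm h)\<^sup>2"
    by (simp only: power2_norm_eq_inner selfadj_inner[OF assms(1)] selfadj_inner[OF assms(2)])
  then have "(norm (s h))\<^sup>2 \<le> (norm h)\<^sup>2" using zero_le_power2[of "norm (t h)"] by linarith
  then show "norm (s h) \<le> 1 * norm h" by (simp add: power2_le_iff_abs_le)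
qed simp

lemma square_apply_zero:
  assumes "selfadj s" "s (s h) = 0"
  shows "s h = 0"
  using selfadj_inner[OF assms(1), of "s h" h] assms(2) by simp

text \<open>A vector fixed by \<open>s\<close> is killed by the square of \<open>t\<close>.\<close>

lemma (in unital_vna) strict_if_squares_sum:
  assumes s: "s \<in> M" "positive_op s" "\<And>h. s h = 0 \<Longrightarrow> h = 0"
    and t: "selfadj t" "\<And>h. t h = 0 \<Longrightarrow> h = 0"
    and st: "(s o\<^sub>L s) + (t o\<^sub>L t) = id_blinfun"
  shows "strict_in M id_blinfun s"
proof (rule strict_inI[OF s(1,2)])
  have sa: "selfadj s" using s(2) positive_opD by blast
  show "positive_op (id_blinfun - s)"
    by (rule contraction_positive[OF sa norm_le_one_if_squares_sum[OF sa t(1) st]])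
  show "h = 0" if "s h = 0" for h using s(3) that .
  show "h = 0" if sh: "s h = h" for h
  proof -
    have "s (s h) + t (t h) = h"
      using arg_cong[OF st, of "\<lambda>x. blinfun_apply x h"] by (simp add: blinfun.add_left)
    then have "t (t h) = 0" by (simp add: sh)
    then show ?thesis by (rule t(2)[OF t(2)])
  qed
qed

text \<open>\<open>G E + E G = G\<close> says \<open>G E G = I - E\<close>, so \<open>E\<close>,
  \<open>E G\<close>, \<open>G E\<close>, \<open>G E G\<close> are 2 by 2 matrix units. The relation
  is oriented as a rewrite rule moving \<open>E\<close> to the left.\<close>

locale matrix_units = unital_vna M for M :: "'h::complex_hilbert_space endo set" +
  fixes E G :: "'h endo"
  assumes E_in: "E \<in> M" and G_in: "G \<in> M" and selfadj_E: "selfadj E" and selfadj_G: "selfadj G"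
    and E_E: "E o\<^sub>L E = E" and G_G: "G o\<^sub>L G = id_blinfun"
    and G_E: "G o\<^sub>L E = G - (E o\<^sub>L G)"
    and commute_imp_centre: "\<And>x. x \<in> M \<Longrightarrow> x o\<^sub>L E = E o\<^sub>L x \<Longrightarrow> x o\<^sub>L G = G o\<^sub>L x \<Longrightarrow> x \<in> centre M"
begin

lemma E_E_left: "E o\<^sub>L (E o\<^sub>L w) = E o\<^sub>L w"
  and G_G_left: "G o\<^sub>L (G o\<^sub>L w) = w"
  and G_E_left: "G o\<^sub>L (E o\<^sub>L w) = (G o\<^sub>L w) - (E o\<^sub>L (G o\<^sub>L w))"
  by (simp_all only: compose_assoc[symmetric] E_E G_G G_E compose_simps compose_id)

text \<open>These rules are a terminating and confluent rewrite system for words in \<open>E\<close> and \<open>G\<close>.\<close>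

lemmas unit_rules = E_E E_E_left G_G G_G_left G_E G_E_left compose_simps compose_assoc

text \<open>\<open>E x E\<close> is the upper left block of \<open>x\<close>; adding its conjugate
  by \<open>G\<close> repeats it in the other diagonal place, which is how a central element sits in
  \<open>M\<close>.\<close>

definition corner :: "'h endo \<Rightarrow> 'h endo"
  where "corner x = (E o\<^sub>L (x o\<^sub>L E)) + (G o\<^sub>L (E o\<^sub>L (x o\<^sub>L (E o\<^sub>L G))))"

text \<open>Multiplication by \<open>G\<close> exchanges rows or columns, so each entry is the upper
  left block of a shifted \<open>x\<close>.\<close>

definition to_matrix :: "'h endo \<Rightarrow> 'h endo ^ 2 ^ 2"
  where "to_matrix x = vector [vector [corner x, corner (x o\<^sub>L G)],
    vector [corner (G o\<^sub>L x), corner (G o\<^sub>L (x o\<^sub>L G))]]"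

definition of_matrix :: "'h endo ^ 2 ^ 2 \<Rightarrow> 'h endo"
  where "of_matrix A = (A $ 1 $ 1 o\<^sub>L E) + (A $ 1 $ 2 o\<^sub>L (E o\<^sub>L G)) + (A $ 2 $ 1 o\<^sub>L (G o\<^sub>L E))
    + (A $ 2 $ 2 o\<^sub>L (G o\<^sub>L (E o\<^sub>L G)))"

lemma corner_in_centre:
  assumes "x \<in> M"
  shows "corner x \<in> centre M"
proof (rule commute_imp_centre)
  show "corner x \<in> M" using assms by (simp add: corner_def closure_rules E_in G_in)
  show "corner x o\<^sub>L E = E o\<^sub>L corner x" by (simp add: corner_def unit_rules)
  show "corner x o\<^sub>L G = G o\<^sub>L corner x" by (simp add: corner_def unit_rules)
qed

lemma of_matrix_to_matrix: "of_matrix (to_matrix x) = x"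
  by (simp add: of_matrix_def to_matrix_def corner_def unit_rules)

lemma to_matrix_of_matrix:
  assumes "A \<in> M2 (centre M)"
  shows "to_matrix (of_matrix A) = A"
proof -
  have zs: "A $ 1 $ 1 \<in> centre M" "A $ 1 $ 2 \<in> centre M" "A $ 2 $ 1 \<in> centre M" "A $ 2 $ 2 \<in> centre M"
    using assms by (simp_all add: M2_iff)
  have rules: "E o\<^sub>L z = z o\<^sub>L E" "G o\<^sub>L z = z o\<^sub>L G" "E o\<^sub>L (z o\<^sub>L w) = z o\<^sub>L (E o\<^sub>L w)"
    "G o\<^sub>L (z o\<^sub>L w) = z o\<^sub>L (G o\<^sub>L w)" if "z \<in> centre M" for z w
    by (rule centre_commute[OF that E_in], rule centre_commute[OF that G_in],
        rule centre_left_commute[OF that E_in], rule centre_left_commute[OF that G_in])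
  show ?thesis
    by (simp add: matrix_22_eq_iff to_matrix_def of_matrix_def corner_def unit_rules
        rules[OF zs(1)] rules[OF zs(2)] rules[OF zs(3)] rules[OF zs(4)])
qed

lemma to_matrix_in: "x \<in> M \<Longrightarrow> to_matrix x \<in> M2 (centre M)"
  by (simp add: to_matrix_def M2_iff corner_in_centre closure_rules G_in)

lemma bij_betw_to_matrix: "bij_betw to_matrix M (M2 (centre M))"
proof (rule bij_betw_byWitness[where f' = of_matrix])
  show "\<forall>x\<in>M. of_matrix (to_matrix x) = x" by (simp add: of_matrix_to_matrix)
  show "\<forall>A\<in>M2 (centre M). to_matrix (of_matrix A) = A" by (simp add: to_matrix_of_matrix)
  show "to_matrix ` M \<subseteq> M2 (centre M)" using to_matrix_in by blast
  show "of_matrix ` M2 (centre M) \<subseteq> M"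
  proof
    fix x assume "x \<in> of_matrix ` M2 (centre M)"
    then obtain A where "A \<in> M2 (centre M)" "x = of_matrix A" by (rule imageE) simp
    then show "x \<in> M" by (simp add: of_matrix_def M2_iff centre_in closure_rules E_in G_in)
  qed
qed

text \<open>Inserting \<open>I = E + G E G\<close> between \<open>x\<close> and \<open>y\<close>
  gives the row-by-column rule for the upper left entry; shifting \<open>x\<close> and
  \<open>y\<close> by \<open>G\<close> gives the others.\<close>

lemma corner_compose: "(corner x o\<^sub>L corner y) + (corner (x o\<^sub>L G) o\<^sub>L corner (G o\<^sub>L y)) = corner (x o\<^sub>L y)"
  by (simp add: corner_def unit_rules)

lemma corner_add: "corner (x + y) = corner x + corner y"
  by (simp add: corner_def compose_simps)

lemma corner_scaleC:
  assumes "x \<in> M"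
  shows "corner (scaleC_op c x) = scaleC_op c (corner x)"
  using E_in G_in by (simp add: corner_def scaleC_op_compose compose_scaleC_op scaleC_op_add in_bounded_ops)

lemma corner_adj:
  assumes "x \<in> M"
  shows "corner (adj x) = adj (corner x)"
  using assms E_in G_in selfadj_E selfadj_G
  by (simp add: corner_def in_bounded_ops selfadj_def compose_assoc)

lemma star_isomorphism_to_matrix: "star_isomorphism_M2 to_matrix M (centre M)"
  unfolding star_isomorphism_M2_def
proof (intro conjI ballI allI bij_betw_to_matrix)
  fix x assume x: "x \<in> M"
  show "to_matrix (scaleC_op c x) = mat_scaleC c (to_matrix x)" for c
    using x G_in
    by (simp add: matrix_22_eq_iff mat_scaleC_def to_matrix_def corner_scaleC[symmetric]
        scaleC_op_compose compose_scaleC_op in_bounded_ops compose_in)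
  show "to_matrix (adj x) = mat_adj (to_matrix x)"
    using x G_in selfadj_G
    by (simp add: matrix_22_eq_iff mat_adj_def to_matrix_def corner_adj[symmetric]
        in_bounded_ops compose_in selfadj_def compose_assoc)
  fix y assume y: "y \<in> M"
  show "to_matrix (x + y) = to_matrix x + to_matrix y"
    by (simp add: matrix_22_eq_iff to_matrix_def corner_add compose_simps)
  have "to_matrix (x o\<^sub>L y) = mat_mult (to_matrix x) (to_matrix y)"
    using corner_compose[of x y] corner_compose[of x "y o\<^sub>L G"] corner_compose[of "G o\<^sub>L x" y]
      corner_compose[of "G o\<^sub>L x" "y o\<^sub>L G"]
    by (simp add: matrix_22_eq_iff mat_mult_nth to_matrix_def compose_assoc)
  then show "to_matrix (x o\<^sub>L y) = mat_mult (to_matrix x) (to_matrix y)" .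
qed

lemma M2_strict_to_matrix:
  assumes p: "p \<in> M" "selfadj p" "p o\<^sub>L p = p"
    and s: "strict_in (centre M) id_blinfun s" and t: "strict_in (centre M) id_blinfun t"
    and st: "(s o\<^sub>L s) + (t o\<^sub>L t) = id_blinfun"
    and p_eq: "to_matrix p = vector [vector [s o\<^sub>L s, s o\<^sub>L t], vector [s o\<^sub>L t, t o\<^sub>L t]]"
  shows "M2_strict (centre M) id_blinfun (to_matrix p)"
proof -
  have "mat_adj (to_matrix p) = to_matrix p" "mat_mult (to_matrix p) (to_matrix p) = to_matrix p"
    using star_isomorphism_to_matrix p unfolding star_isomorphism_M2_def selfadj_def by metis+
  then show ?thesis
    unfolding M2_strict_def using to_matrix_in[OF p(1)] s t st p_eq by blast
qed

text \<open>Half-angle formulas: \<open>p\<close> has diagonal \<open>(I + C) / 2\<close>,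
  \<open>(I - C) / 2\<close> and off-diagonal entries \<open>S / 2\<close>, which are
  \<open>s^2\<close>, \<open>t^2\<close> and \<open>s t\<close>; for \<open>q\<close> the roles of
  \<open>s\<close> and \<open>t\<close> are exchanged. The abelian algebra is the centre of
  \<open>M\<close> acting on the same space, whence the type argument.\<close>

lemma M2_strict_projections_generic:
  fixes C S :: "'h endo"
  defines "p \<equiv> (1/2) *\<^sub>R (id_blinfun + (C o\<^sub>L (2 *\<^sub>R E - id_blinfun)) + (S o\<^sub>L G))"
    and "q \<equiv> (1/2) *\<^sub>R (id_blinfun - (C o\<^sub>L (2 *\<^sub>R E - id_blinfun)) + (S o\<^sub>L G))"
  assumes C: "C \<in> centre M" "positive_op C" and S: "S \<in> centre M" "positive_op S"
    and S0: "\<And>h. S h = 0 \<Longrightarrow> h = 0" and CS: "(C o\<^sub>L C) + (S o\<^sub>L S) = id_blinfun"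
    and p: "p \<in> M" "selfadj p" "p o\<^sub>L p = p" and q: "q \<in> M" "selfadj q" "q o\<^sub>L q = q"
  shows "M2_strict_projections TYPE('h) M p q"
proof -
  interpret Z: unital_vna "centre M" by (rule unital_vna_centre)
  have saC: "selfadj C" and saS: "selfadj S" using C S positive_opD by auto
  have "positive_op (id_blinfun - C)" "positive_op (id_blinfun + C)"
    using contraction_positive[OF saC norm_le_one_if_squares_sum[OF saC saS CS]] .
  then have pos: "positive_op ((1/2) *\<^sub>R (id_blinfun + C))" "positive_op ((1/2) *\<^sub>R (id_blinfun - C))"
    by auto
  define s where "s = sqrt_op ((1/2) *\<^sub>R (id_blinfun + C))"
  define t where "t = sqrt_op ((1/2) *\<^sub>R (id_blinfun - C))"
  have ss: "s o\<^sub>L s = (1/2) *\<^sub>R (id_blinfun + C)" and tt: "t o\<^sub>L t = (1/2) *\<^sub>R (id_blinfun - C)"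
    and s: "positive_op s" and t: "positive_op t"
    using pos by (simp_all add: s_def t_def sqrt_op_square positive_sqrt_op)
  have sZ: "s \<in> centre M" and tZ: "t \<in> centre M"
    unfolding s_def t_def using C pos by (simp_all add: Z.sqrt_op_in Z.closure_rules)
  have sum: "(s o\<^sub>L s) + (t o\<^sub>L t) = id_blinfun" "(t o\<^sub>L t) + (s o\<^sub>L s) = id_blinfun"
    unfolding ss tt by (simp_all flip: scaleR_add_right scaleR_2)
  have comm: "s o\<^sub>L t = t o\<^sub>L s" by (rule centre_commute[OF tZ centre_in[OF sZ]])
  have CCSS: "C (C h) + S (S h) = h" for h
    using arg_cong[OF CS, of "\<lambda>x. blinfun_apply x h"] by (simp add: blinfun.add_left)
  \<comment> \<open>\<open>s h = 0\<close> means \<open>C h = - h\<close> and \<open>t h = 0\<close>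
    means \<open>C h = h\<close>; either way \<open>C^2 h = h\<close>, and then
    \<open>S^2 h = 0\<close>.\<close>
  have SS0: "h = 0" if "C (C h) = h" for h
  proof -
    have "S (S h) = 0" using CCSS[of h] that by simp
    then show ?thesis by (rule S0[OF S0])
  qed
  have s0: "h = 0" if "s h = 0" for h
  proof (rule SS0)
    have "s (s h) = 0" using that by simp
    then have "C h = - h"
      using arg_cong[OF ss, of "\<lambda>x. blinfun_apply x h"]
      by (simp add: blinfun.scaleR_left blinfun.add_left add_eq_0_iff)
    then show "C (C h) = h" by (simp add: blinfun.minus_right)
  qed
  have t0: "h = 0" if "t h = 0" for h
  proof (rule SS0)
    have "t (t h) = 0" using that by simp
    then have "(id_blinfun - C) h = 0"
      using arg_cong[OF tt, of "\<lambda>x. blinfun_apply x h"] by (simp add: blinfun.scaleR_left)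
    then have "C h = h" by (simp only: complement_apply_eq_0)
    then show "C (C h) = h" by simp
  qed
  have strict: "strict_in (centre M) id_blinfun s" "strict_in (centre M) id_blinfun t"
    using Z.strict_if_squares_sum[OF sZ s s0 positive_opD(1)[OF t] t0 sum(1)]
      Z.strict_if_squares_sum[OF tZ t t0 positive_opD(1)[OF s] s0 sum(2)] by simp_all
  \<comment> \<open>Both sides are positive square roots of \<open>(I - C^2) / 4\<close>; positivity
    of \<open>S\<close> fixes the sign.\<close>
  have "s o\<^sub>L t = (1/2) *\<^sub>R S"
  proof -
    have "(s o\<^sub>L t) o\<^sub>L (s o\<^sub>L t) = (s o\<^sub>L s) o\<^sub>L (t o\<^sub>L t)"
      by (metis comm compose_assoc)
    also have "\<dots> = (1/4) *\<^sub>R (id_blinfun - (C o\<^sub>L C))"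
      unfolding ss tt by (simp add: compose_simps scaleR_add_right scaleR_diff_right)
    also have "\<dots> = ((1/2) *\<^sub>R S) o\<^sub>L ((1/2) *\<^sub>R S)"
      unfolding CS[symmetric] by (simp add: compose_simps)
    finally have "sqrt_op (((1/2) *\<^sub>R S) o\<^sub>L ((1/2) *\<^sub>R S)) = s o\<^sub>L t"
      by (intro sqrt_op_eqI positive_compose s t comm)
    moreover have "sqrt_op (((1/2) *\<^sub>R S) o\<^sub>L ((1/2) *\<^sub>R S)) = (1/2) *\<^sub>R S"
      using S by (intro sqrt_op_eqI) auto
    ultimately show ?thesis by simp
  qed
  note st = this
  have rules: "E o\<^sub>L z = z o\<^sub>L E" "G o\<^sub>L z = z o\<^sub>L G" "E o\<^sub>L (z o\<^sub>L w) = z o\<^sub>L (E o\<^sub>L w)"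
    "G o\<^sub>L (z o\<^sub>L w) = z o\<^sub>L (G o\<^sub>L w)" if "z \<in> centre M" for z w
    by (rule centre_commute[OF that E_in], rule centre_commute[OF that G_in],
        rule centre_left_commute[OF that E_in], rule centre_left_commute[OF that G_in])
  have half: "x - (1/2) *\<^sub>R x = (1/2) *\<^sub>R x" for x :: "'h endo"
    using scaleR_left_diff_distrib[of 1 "1/2" x] by simp
  have "to_matrix p = vector [vector [s o\<^sub>L s, s o\<^sub>L t], vector [s o\<^sub>L t, t o\<^sub>L t]]"
    unfolding ss tt st
    by (simp add: p_def matrix_22_eq_iff to_matrix_def corner_def unit_rules rules[OF C(1)] rules[OF S(1)]
        scaleR_add_right scaleR_diff_right half)
  then have P: "M2_strict (centre M) id_blinfun (to_matrix p)"
    by (rule M2_strict_to_matrix[OF p strict sum(1)])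
  have "to_matrix q = vector [vector [t o\<^sub>L t, t o\<^sub>L s], vector [t o\<^sub>L s, s o\<^sub>L s]]"
    unfolding ss tt comm[symmetric] st
    by (simp add: q_def matrix_22_eq_iff to_matrix_def corner_def unit_rules rules[OF C(1)] rules[OF S(1)]
        scaleR_add_right scaleR_diff_right half)
  then have Q: "M2_strict (centre M) id_blinfun (to_matrix q)"
    by (rule M2_strict_to_matrix[OF q strict(2,1) sum(2)])
  show ?thesis
    unfolding M2_strict_projections_def
    using p(1) q(1) von_neumann_algebra_centre abelian_centre star_isomorphism_to_matrix P Q by blast
qed

end

section \<open>From compatibility to strict projections\<close>

context unital_vna
begin

text \<open>If \<open>A\<close> acts idempotently on \<open>ker x\<close> and the kernel projection \<open>N\<close> is central, then \<open>A N\<close> is a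
  projection below \<open>A\<close>; strictness gives \<open>A N = 0\<close>, whence \<open>A \<le> 1 - N\<close> and \<open>N = 0\<close>.\<close>

lemma injective_if_strict_idempotent_on_kernel:
  assumes A: "strict_in M id_blinfun A" and x: "x \<in> M" "selfadj x" "x o\<^sub>L x \<in> centre M"
    and idem: "\<And>h. x h = 0 \<Longrightarrow> A (A h) = A h"
    and h: "x h = 0"
  shows "h = 0"
proof -
  have AM: "A \<in> M" and pos: "positive_op A" "positive_op (id_blinfun - A)"
    and strict: "\<And>p q. p \<in> M \<Longrightarrow> q \<in> M \<Longrightarrow> projection p \<Longrightarrow> projection q \<Longrightarrow> p \<preceq> A \<Longrightarrow> A \<preceq> q
      \<Longrightarrow> p = 0 \<and> q = id_blinfun"
    using A by (auto simp: strict_in_def op_le_def)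
  have saA: "selfadj A" using pos positive_opD by blast
  \<comment> \<open>The square of \<open>x\<close> has the same kernel and, being central, gives a
    kernel projection that commutes with \<open>A\<close>.\<close>
  have xx: "x o\<^sub>L x \<in> M" "selfadj (x o\<^sub>L x)" using x by (simp_all add: centre_in)
  obtain N where N: "N \<in> M" "selfadj N" "N o\<^sub>L N = N" "(x o\<^sub>L x) o\<^sub>L N = 0"
    "\<And>h. id_blinfun h = h \<Longrightarrow> (x o\<^sub>L x) h = 0 \<Longrightarrow> N h = h"
    "\<And>R. R o\<^sub>L (x o\<^sub>L x) = (x o\<^sub>L x) o\<^sub>L R \<Longrightarrow> R o\<^sub>L id_blinfun = id_blinfun o\<^sub>L R \<Longrightarrow> R o\<^sub>L N = N o\<^sub>L R"
    by (rule ex_kernel_projection[OF xx]) (rule that)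
  have comm: "A o\<^sub>L N = N o\<^sub>L A"
    by (rule N(6)[OF centre_commute[OF x(3) AM]]) simp
  have idN: "A (A (N g)) = A (N g)" for g
  proof (rule idem, rule square_apply_zero[OF x(2)])
    show "x (x (N g)) = 0" using arg_cong[OF N(4), of "\<lambda>x. blinfun_apply x g"] by simp
  qed
  define N' where "N' = id_blinfun - N"
  have N': "N' \<in> M" "selfadj N'" "N' o\<^sub>L N' = N'"
    using N(1-3) by (simp_all add: N'_def closure_rules compose_simps)
  have comm': "A o\<^sub>L N' = N' o\<^sub>L A" by (simp add: N'_def compose_simps comm)
  have "(A o\<^sub>L N) o\<^sub>L (A o\<^sub>L N) = A o\<^sub>L (A o\<^sub>L (N o\<^sub>L N))"
    by (metis comm compose_assoc)
  also have "\<dots> = A o\<^sub>L N" by (rule blinfun_eqI) (simp add: N(3) idN)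
  finally have "projection (A o\<^sub>L N)"
    using selfadj_compose[OF saA N(2) comm] by (simp add: projection_iff)
  moreover have "A o\<^sub>L N \<preceq> A"
  proof -
    have "A - (A o\<^sub>L N) = A o\<^sub>L N'" by (simp add: N'_def compose_simps)
    then show ?thesis
      using positive_compose[OF pos(1) positive_projection[OF N'(2,3)] comm'] by (simp add: op_le_def)
  qed
  ultimately have AN: "A o\<^sub>L N = 0"
    using strict[of "A o\<^sub>L N" id_blinfun] pos AM N(1)
    by (simp add: compose_in unit_in projection_iff op_le_def)
  have "N' - A = (id_blinfun - A) o\<^sub>L N'"
    using AN by (simp add: N'_def compose_simps)
  moreover have "positive_op ((id_blinfun - A) o\<^sub>L N')"
    using comm' by (intro positive_compose pos positive_projection[OF N'(2,3)]) (simp add: compose_simps)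
  ultimately have "N' = id_blinfun"
    using strict[of 0 N'] N' pos by (simp add: zero_in projection_iff op_le_def)
  then have "N = 0" by (simp add: N'_def)
  moreover have "N h = h" using N(5)[of h] h by simp
  ultimately show ?thesis by simp
qed

end

context generated_by_pair
begin

text \<open>\<open>(I + r D) / 2\<close> is idempotent exactly where \<open>(r D)^2 = I\<close>,
  that is, where \<open>D^2 = y^2\<close>. As the square of \<open>x\<close> is central,
  \<open>M\<close> leaves the kernel of \<open>x\<close> invariant, and \<open>eq\<close> may use
  this.\<close>

lemma injective_if_square_eq_on_kernel:
  assumes D: "D \<in> M" and strict: "strict_in M id_blinfun ((1/2) *\<^sub>R (id_blinfun + (r o\<^sub>L D)))"
    and x: "x \<in> M" "selfadj x" "x o\<^sub>L x \<in> centre M"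
    and eq: "\<And>h. x h = 0 \<Longrightarrow> (\<And>m. m \<in> M \<Longrightarrow> x (m h) = 0) \<Longrightarrow> D (D h) = y (y h)"
    and h: "x h = 0"
  shows "h = 0"
proof (rule injective_if_strict_idempotent_on_kernel[OF strict x _ h])
  fix g assume g: "x g = 0"
  have "x (m g) = 0" if m: "m \<in> M" for m
  proof (rule square_apply_zero[OF x(2)])
    have "(x o\<^sub>L x) (m g) = m ((x o\<^sub>L x) g)"
      by (simp only: blinfun_apply_blinfun_compose[symmetric] centre_commute[OF x(3) m])
    then show "x (x (m g)) = 0" using g by simp
  qed
  then have DD: "D (D g) = y (y g)" using eq[OF g] by blast
  have rD: "D (r k) = r (D k)" for k
    using arg_cong[OF centre_commute[OF r_centre D], of "\<lambda>x. blinfun_apply x k"] by simp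
  have ry: "r (y k) = k" for k
    using arg_cong[OF r_y, of "\<lambda>x. blinfun_apply x k"] by simp
  have yr: "r (r (y (y g))) = g" by (simp add: ry)
  define A where "A = (1/2) *\<^sub>R (id_blinfun + (r o\<^sub>L D))"
  have A: "A k = (1/2) *\<^sub>R (k + r (D k))" for k
    by (simp add: A_def blinfun.scaleR_left blinfun.add_left)
  have "A (A g) = (1/4) *\<^sub>R ((g + r (D g)) + (r (D g) + g))"
    by (simp add: A blinfun.scaleR_right blinfun.add_right rD DD yr scaleR_add_right)
  also have "\<dots> = (1/4) *\<^sub>R (2 *\<^sub>R (g + r (D g)))" by (simp add: scaleR_2 add_ac)
  also have "\<dots> = A g" by (simp add: A)
  finally show "((1/2) *\<^sub>R (id_blinfun + (r o\<^sub>L D))) (((1/2) *\<^sub>R (id_blinfun + (r o\<^sub>L D))) g)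
      = ((1/2) *\<^sub>R (id_blinfun + (r o\<^sub>L D))) g" by (simp only: A_def)
qed

text \<open>On the kernel of \<open>D\<close> the operator \<open>w\<close> vanishes, so
  \<open>y\<close> acts as \<open>v\<close>, and \<open>y^2 = v^2 = T^2 = (D + T)^2\<close>
  there.\<close>

lemma strict_square_injective:
  assumes D: "D \<in> M" "selfadj D" and T: "T \<in> M" "selfadj T"
    and strict: "strict_in M id_blinfun ((1/2) *\<^sub>R (id_blinfun + (r o\<^sub>L (D + T))))"
    and w: "w \<in> centre M" "selfadj w" "w o\<^sub>L w = D o\<^sub>L D"
    and v: "v \<in> centre M" "selfadj v" "v o\<^sub>L v = T o\<^sub>L T"
    and sum: "w + v = y"
    and h: "w h = 0"
  shows "h = 0"
proof -
  have wD: "w (w k) = D (D k)" and vT: "v (v k) = T (T k)" for k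
    using w(3) v(3) by (metis blinfun_apply_blinfun_compose)+
  have "D h = 0" by (rule square_apply_zero[OF D(2)]) (use h wD[of h] in simp)
  show ?thesis
  proof (rule injective_if_square_eq_on_kernel[OF _ strict D _ _ \<open>D h = 0\<close>])
    show "D + T \<in> M" using D T by (simp add: add_in)
    have "w o\<^sub>L w \<in> centre M"
      using unital_vna.axioms unital_vna_centre vna.compose_in[of "centre M"] w(1) by blast
    then show "D o\<^sub>L D \<in> centre M" by (simp add: w(3))
    fix g assume g: "D g = 0" "\<And>m. m \<in> M \<Longrightarrow> D (m g) = 0"
    have w0: "w k = 0" if "D k = 0" for k
      by (rule square_apply_zero[OF w(2)]) (use that wD[of k] in simp)
    have y: "y k = w k + v k" for k by (simp add: blinfun.add_left flip: sum)
    have "y (y g) = v (v g)"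
      using w0[OF g(1)] w0[OF g(2)[OF centre_in[OF v(1)]]] by (simp add: y blinfun.add_right)
    moreover have "(D + T) ((D + T) g) = T (T g)"
      using g(1) g(2)[OF T(1)] by (simp add: blinfun.add_left blinfun.add_right)
    ultimately show "(D + T) ((D + T) g) = y (y g)" by (simp add: vT)
  qed
qed

lemma abs_op_uminus: "x \<in> bounded_ops \<Longrightarrow> abs_op (- x) = abs_op x"
  by (simp add: abs_op_def compose_simps)

lemma symmetry_imp_idempotent:
  assumes "u o\<^sub>L u = id_blinfun"
  shows "(1/2) *\<^sub>R (id_blinfun + u) o\<^sub>L (1/2) *\<^sub>R (id_blinfun + u) = (1/2) *\<^sub>R (id_blinfun + u)"
proof -
  have "(1/2) *\<^sub>R (id_blinfun + u) o\<^sub>L (1/2) *\<^sub>R (id_blinfun + u)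
      = (1/4) *\<^sub>R (2 *\<^sub>R (id_blinfun + u))"
    by (simp add: compose_simps assms scaleR_2 scaleR_add_right add_ac)
  then show ?thesis by simp
qed

lemma M2_strict_if_compatible_and_strict:
  assumes compatible: "compatible x0 a b"
    and strict_a: "strict_in M id_blinfun (r o\<^sub>L (a - (1/2) *\<^sub>R x0))"
    and strict_b: "strict_in M id_blinfun (r o\<^sub>L (b - (1/2) *\<^sub>R x0))"
  shows "\<exists>p q w1 w2. M2_strict_projections TYPE('h) M p q \<and> w1 \<in> centre M \<and> w2 \<in> centre M \<and>
    positive_op w1 \<and> positive_op w2 \<and> strict_in M id_blinfun w1 \<and> strict_in M id_blinfun w2 \<and>
    w1 + w2 = y \<and> a = (1/2) *\<^sub>R x0 + (w1 o\<^sub>L p) + (w2 o\<^sub>L q) \<and>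
    b = (1/2) *\<^sub>R x0 + (w1 o\<^sub>L p) + (w2 o\<^sub>L (id_blinfun - q))"
proof -
  interpret Z: unital_vna "centre M" by (rule unital_vna_centre)
  define d where "d = a - b"
  define s where "s = a + b - id_blinfun"
  have dM: "d \<in> M" "selfadj d" and sM: "s \<in> M" "selfadj s"
    using a_in b_in selfadj_a selfadj_b by (simp_all add: d_def s_def closure_rules)
  have half: "(1/2) *\<^sub>R x + (1/2) *\<^sub>R x = x" for x :: "'h endo"
    by (simp flip: scaleR_left_distrib)
  have ads: "a = (1/2) *\<^sub>R (id_blinfun + d + s)" and bds: "b = (1/2) *\<^sub>R (id_blinfun - d + s)"
    by (simp_all add: d_def s_def half flip: scaleR_2)
  have central: "t \<in> centre M" if t: "t \<in> M" "t o\<^sub>L d = d o\<^sub>L t" "t o\<^sub>L s = s o\<^sub>L t" for t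
    using t by (intro commute_imp_centre) (simp_all add: ads bds compose_simps)
  \<comment> \<open>Since \<open>a - x0 / 2 = (y + d + s) / 2\<close> and \<open>r y = I\<close>,
    the strict elements become \<open>(I + r (d + s)) / 2\<close> and
    \<open>(I + r (s - d)) / 2\<close>.\<close>
  have "r o\<^sub>L (a - (1/2) *\<^sub>R x0) = (1/2) *\<^sub>R (r o\<^sub>L (y + (d + s)))"
    by (simp add: ads y_def compose_simps scaleR_add_right scaleR_diff_right)
  then have strict_ds: "strict_in M id_blinfun ((1/2) *\<^sub>R (id_blinfun + (r o\<^sub>L (d + s))))"
    using strict_a by (simp only: compose_simps r_y)
  have "r o\<^sub>L (b - (1/2) *\<^sub>R x0) = (1/2) *\<^sub>R (r o\<^sub>L (y + (s - d)))"
    by (simp add: bds y_def compose_simps scaleR_add_right scaleR_diff_right)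
  then have strict_sd: "strict_in M id_blinfun ((1/2) *\<^sub>R (id_blinfun + (r o\<^sub>L (s - d))))"
    using strict_b by (simp only: compose_simps r_y)
  have strict_ds': "strict_in M id_blinfun ((1/2) *\<^sub>R (id_blinfun + (r o\<^sub>L (s + d))))"
    using strict_ds by (simp only: add.commute[of s d])

  define w1 where "w1 = abs_op s"
  define w2 where "w2 = abs_op d"
  obtain u where u: "u \<in> M" "selfadj u" "u o\<^sub>L u = id_blinfun"
    and w2: "abs_op d \<in> M" "positive_op (abs_op d)" "abs_op d o\<^sub>L abs_op d = d o\<^sub>L d"
    and du: "d = abs_op d o\<^sub>L u" "u o\<^sub>L abs_op d = abs_op d o\<^sub>L u"
    "\<And>R. R o\<^sub>L d = d o\<^sub>L R \<Longrightarrow> R o\<^sub>L abs_op d = abs_op d o\<^sub>L R"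
    "\<And>R. R o\<^sub>L d = d o\<^sub>L R \<Longrightarrow> R o\<^sub>L u = u o\<^sub>L R"
    by (rule polar_decomposition[OF dM]) (rule that)
  obtain v where v: "v \<in> M" "selfadj v" "v o\<^sub>L v = id_blinfun"
    and w1: "abs_op s \<in> M" "positive_op (abs_op s)" "abs_op s o\<^sub>L abs_op s = s o\<^sub>L s"
    and sv: "s = abs_op s o\<^sub>L v" "v o\<^sub>L abs_op s = abs_op s o\<^sub>L v"
    "\<And>R. R o\<^sub>L s = s o\<^sub>L R \<Longrightarrow> R o\<^sub>L abs_op s = abs_op s o\<^sub>L R"
    "\<And>R. R o\<^sub>L s = s o\<^sub>L R \<Longrightarrow> R o\<^sub>L v = v o\<^sub>L R"
    by (rule polar_decomposition[OF sM]) (rule that)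
  note w1 = w1[folded w1_def] and w2 = w2[folded w2_def]
  note du = du[folded w2_def] and sv = sv[folded w1_def]
  have "id_blinfun - a - b = - s" by (simp add: s_def)
  then have "abs_op (id_blinfun - a - b) = w1"
    using abs_op_uminus[OF in_bounded_ops[OF sM(1)]] by (simp only: w1_def)
  then have sum: "w1 + w2 = y"
    using compatible unfolding compatible_def d_def[symmetric] w2_def[symmetric] y_def
    by (simp only: add.commute)
  have ys: "s o\<^sub>L y = y o\<^sub>L s" and yd: "d o\<^sub>L y = y o\<^sub>L d"
    using centre_commute[OF y_centre] sM dM by simp_all
  have w1s: "s o\<^sub>L w1 = w1 o\<^sub>L s" by (rule sv(3)) simp
  have w2d: "d o\<^sub>L w2 = w2 o\<^sub>L d" by (rule du(3)) simp
  have w1_eq: "w1 = y - w2" and w2_eq: "w2 = y - w1" by (simp_all flip: sum)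
  have w1d: "d o\<^sub>L w1 = w1 o\<^sub>L d" unfolding w1_eq by (simp only: compose_simps yd w2d)
  have w2s: "s o\<^sub>L w2 = w2 o\<^sub>L s" unfolding w2_eq by (simp only: compose_simps ys w1s)
  have w1Z: "w1 \<in> centre M" by (rule central[OF w1(1) w1d[symmetric] w1s[symmetric]])
  have w2Z: "w2 \<in> centre M" by (rule central[OF w2(1) w2d[symmetric] w2s[symmetric]])
  have sa1: "selfadj w1" and sa2: "selfadj w2" using w1 w2 positive_opD by auto
  have sum': "w2 + w1 = y" using sum by (simp only: add.commute)
  have w1_inj: "h = 0" if "w1 h = 0" for h
    by (rule strict_square_injective[OF sM dM strict_ds' w1Z sa1 w1(3) w2Z sa2 w2(3) sum that])
  have w2_inj: "h = 0" if "w2 h = 0" for h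
    by (rule strict_square_injective[OF dM sM strict_ds w2Z sa2 w2(3) w1Z sa1 w1(3) sum' that])
  have w_strict: "strict_in M id_blinfun w"
    if w: "w \<in> M" "positive_op w" "\<And>h. w h = 0 \<Longrightarrow> h = 0"
      and w': "positive_op w'" "\<And>h. w' h = 0 \<Longrightarrow> h = 0" and ww': "w + w' = y" for w w'
  proof (rule strict_inI[OF w(1,2)])
    \<comment> \<open>A vector fixed by \<open>w\<close> is killed by \<open>x0 + w'\<close>, hence
      by each of these positive summands.\<close>
    have eq: "id_blinfun - w = x0 + w'" using ww' by (simp add: y_def algebra_simps)
    show "positive_op (id_blinfun - w)" unfolding eq using positive_x0 w' by auto
    show "h = 0" if "w h = 0" for h by (rule w(3)[OF that])
    show "h = 0" if "w h = h" for h
    proof (rule w'(2), rule positive_sum_inner_zero(2)[OF positive_x0 w'(1)])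
      have "(x0 + w') h = 0" unfolding eq[symmetric] complement_apply_eq_0 by (rule that)
      then show "inner ((x0 + w') h) h \<le> 0" by simp
    qed
  qed
  have strict_w1: "strict_in M id_blinfun w1"
    by (rule w_strict[OF w1(1,2) w1_inj w2(2) w2_inj sum])
  have strict_w2: "strict_in M id_blinfun w2"
    by (rule w_strict[OF w2(1,2) w2_inj w1(2) w1_inj sum'])

  have central_uv: "t \<in> centre M" if t: "t \<in> M" "t o\<^sub>L u = u o\<^sub>L t" "t o\<^sub>L v = v o\<^sub>L t" for t
  proof (rule central[OF t(1)])
    have "t o\<^sub>L (w2 o\<^sub>L u) = (w2 o\<^sub>L u) o\<^sub>L t"
      by (simp only: centre_left_commute[OF w2Z t(1)] t(2) compose_assoc)
    then show "t o\<^sub>L d = d o\<^sub>L t" by (simp only: du(1)[symmetric])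
    have "t o\<^sub>L (w1 o\<^sub>L v) = (w1 o\<^sub>L v) o\<^sub>L t"
      by (simp only: centre_left_commute[OF w1Z t(1)] t(3) compose_assoc)
    then show "t o\<^sub>L s = s o\<^sub>L t" by (simp only: sv(1)[symmetric])
  qed
  have uu: "u o\<^sub>L (u o\<^sub>L x) = x" and vv: "v o\<^sub>L (v o\<^sub>L x) = x" for x
    by (simp_all add: u(3) v(3) flip: compose_assoc)
  have uuh: "u (u h) = h" and vvh: "v (v h) = h" for h
    using arg_cong[OF u(3), of "\<lambda>x. blinfun_apply x h"] arg_cong[OF v(3), of "\<lambda>x. blinfun_apply x h"]
    by simp_all
  define f where "f = (1/2) *\<^sub>R (v - u)"
  define g where "g = (1/2) *\<^sub>R (v + u)"
  have fM: "f \<in> M" "selfadj f" and gM: "g \<in> M" "selfadj g"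
    using u v by (simp_all add: f_def g_def closure_rules)
  note uv_simps = compose_simps compose_assoc u(3) v(3) uu vv
  \<comment> \<open>\<open>f^2 = (2 I - (u v + v u)) / 4\<close> and
    \<open>g^2 = (2 I + (u v + v u)) / 4\<close>, and \<open>u v + v u\<close> commutes with both
    symmetries \<open>u\<close> and \<open>v\<close>.\<close>
  have ffZ: "f o\<^sub>L f \<in> centre M"
    by (rule central_uv) (simp_all add: fM compose_in, simp_all add: f_def uv_simps scaleR_add_right scaleR_diff_right)
  have ggZ: "g o\<^sub>L g \<in> centre M"
    by (rule central_uv) (simp_all add: gM compose_in, simp_all add: g_def uv_simps scaleR_add_right scaleR_diff_right)
  have fg: "f o\<^sub>L g = - (g o\<^sub>L f)"
    by (simp add: f_def g_def uv_simps scaleR_add_right scaleR_diff_right)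
  have ffgg: "(f o\<^sub>L f) + (g o\<^sub>L g) = id_blinfun"
  proof -
    have "(f o\<^sub>L f) + (g o\<^sub>L g) = (1/4) *\<^sub>R ((id_blinfun + id_blinfun) + (id_blinfun + id_blinfun))"
      by (simp add: f_def g_def uv_simps scaleR_add_right scaleR_diff_right)
    then show ?thesis by (simp flip: scaleR_2)
  qed
  have dk: "d k = w2 (u k)" and sk: "s k = w1 (v k)" for k
    using arg_cong[OF du(1), of "\<lambda>x. blinfun_apply x k"] arg_cong[OF sv(1), of "\<lambda>x. blinfun_apply x k"]
    by simp_all
  have yk: "y k = w1 k + w2 k" for k by (simp add: blinfun.add_left flip: sum)
  have my: "m (y k) = y (m k)" if "m \<in> M" for m k
    using arg_cong[OF centre_commute[OF y_centre that], of "\<lambda>x. blinfun_apply x k"] by simp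
  \<comment> \<open>On the kernel of \<open>f\<close> the signs agree, so
    \<open>d + s = w2 u + w1 v\<close> acts there as \<open>y u\<close>. The kernel is invariant
    under \<open>u\<close>, so the square acts as \<open>y^2\<close>.\<close>
  have f_inj: "h = 0" if "f h = 0" for h
  proof (rule injective_if_square_eq_on_kernel[OF _ strict_ds fM ffZ _ that])
    show "d + s \<in> M" using dM sM by (simp add: add_in)
    fix k assume k: "f k = 0" "\<And>m. m \<in> M \<Longrightarrow> f (m k) = 0"
    have vu: "v k' = u k'" if "f k' = 0" for k'
      using that by (simp add: f_def blinfun.scaleR_left blinfun.diff_left)
    have ds: "(d + s) k' = y (u k')" if "f k' = 0" for k'
      by (simp add: blinfun.add_left dk sk vu[OF that] yk add.commute)
    show "(d + s) ((d + s) k) = y (y k)"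
      using ds[OF k(1)] ds[OF k(2)[OF u(1)]] my[OF add_in[OF dM(1) sM(1)], of "u k"]
      by (simp only: uuh)
  qed
  \<comment> \<open>On the kernel of \<open>g\<close> the signs are opposite, so it is
    \<open>s - d\<close> that acts as \<open>y v\<close>; this calls for the strict element built
    from \<open>b\<close>.\<close>
  have g_inj: "h = 0" if "g h = 0" for h
  proof (rule injective_if_square_eq_on_kernel[OF _ strict_sd gM ggZ _ that])
    show "s - d \<in> M" using dM sM by (simp add: diff_in)
    fix k assume k: "g k = 0" "\<And>m. m \<in> M \<Longrightarrow> g (m k) = 0"
    have uv: "u k' = - v k'" if "g k' = 0" for k'
      using that by (simp add: g_def blinfun.scaleR_left blinfun.add_left add_eq_0_iff)
    have sd: "(s - d) k' = y (v k')" if "g k' = 0" for k'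
      by (simp add: blinfun.diff_left dk sk uv[OF that] yk blinfun.minus_right)
    show "(s - d) ((s - d) k) = y (y k)"
      using sd[OF k(1)] sd[OF k(2)[OF v(1)]] my[OF diff_in[OF sM(1) dM(1)], of "v k"]
      by (simp only: vvh)
  qed

  define C where "C = abs_op f"
  define S where "S = abs_op g"
  obtain F where F: "F \<in> M" "selfadj F" "F o\<^sub>L F = id_blinfun"
    and C: "abs_op f \<in> M" "positive_op (abs_op f)" "abs_op f o\<^sub>L abs_op f = f o\<^sub>L f"
    and fF: "f = abs_op f o\<^sub>L F" "F o\<^sub>L abs_op f = abs_op f o\<^sub>L F"
    by (rule polar_decomposition[OF fM]) (rule that)
  obtain G where G: "G \<in> M" "selfadj G" "G o\<^sub>L G = id_blinfun"
    and S: "abs_op g \<in> M" "positive_op (abs_op g)" "abs_op g o\<^sub>L abs_op g = g o\<^sub>L g"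
    and gG: "g = abs_op g o\<^sub>L G" "G o\<^sub>L abs_op g = abs_op g o\<^sub>L G"
    by (rule polar_decomposition[OF gM]) (rule that)
  note C = C[folded C_def] and S = S[folded S_def]
  note fF = fF[folded C_def] and gG = gG[folded S_def]
  have "abs_op x = sqrt_op (x o\<^sub>L x)" if "selfadj x" for x :: "'h endo"
    using that by (simp add: abs_op_def selfadj_def)
  then have CZ: "C \<in> centre M" and SZ: "S \<in> centre M"
    unfolding C_def S_def
    using Z.sqrt_op_in[OF ffZ positive_square[OF fM(2)]] Z.sqrt_op_in[OF ggZ positive_square[OF gM(2)]]
      fM(2) gM(2) by simp_all
  have C_inj: "h = 0" if "C h = 0" for h
  proof (rule f_inj)
    have "f = F o\<^sub>L C" using fF by (simp only:)
    then have "f h = F (C h)" by simp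
    then show "f h = 0" by (simp add: that)
  qed
  have S_inj: "h = 0" if "S h = 0" for h
  proof (rule g_inj)
    have "g = G o\<^sub>L S" using gG by (simp only:)
    then have "g h = G (S h)" by simp
    then show "g h = 0" by (simp add: that)
  qed
  have CS: "(C o\<^sub>L C) + (S o\<^sub>L S) = id_blinfun" by (simp only: C(3) S(3) ffgg)
  have fg_CS: "f o\<^sub>L g = C o\<^sub>L (S o\<^sub>L (F o\<^sub>L G))"
  proof -
    have "(C o\<^sub>L F) o\<^sub>L (S o\<^sub>L G) = C o\<^sub>L (S o\<^sub>L (F o\<^sub>L G))"
      by (simp only: compose_assoc centre_left_commute[OF SZ F(1)])
    then show ?thesis by (simp only: fF(1)[symmetric] gG(1)[symmetric])
  qed
  have gf_CS: "g o\<^sub>L f = C o\<^sub>L (S o\<^sub>L (G o\<^sub>L F))"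
  proof -
    have "(S o\<^sub>L G) o\<^sub>L (C o\<^sub>L F) = C o\<^sub>L (S o\<^sub>L (G o\<^sub>L F))"
      by (simp only: compose_assoc centre_left_commute[OF CZ G(1)] centre_left_commute[OF CZ S(1)])
    then show ?thesis by (simp only: fF(1)[symmetric] gG(1)[symmetric])
  qed
  \<comment> \<open>Written out, \<open>f g + g f = 0\<close> carries the central factors
    \<open>C\<close> and \<open>S\<close> in front. They are injective and cancel, which passes the
    anticommutation on to \<open>F\<close> and \<open>G\<close>.\<close>
  have CSFG: "C o\<^sub>L (S o\<^sub>L ((F o\<^sub>L G) + (G o\<^sub>L F))) = 0"
    unfolding compose_simps fg_CS[symmetric] gf_CS[symmetric] fg by simp
  have "((F o\<^sub>L G) + (G o\<^sub>L F)) h = 0" for h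
  proof (rule S_inj, rule C_inj)
    show "C (S (((F o\<^sub>L G) + (G o\<^sub>L F)) h)) = 0"
      using arg_cong[OF CSFG, of "\<lambda>x. blinfun_apply x h"] by simp
  qed
  then have "(F o\<^sub>L G) + (G o\<^sub>L F) = 0" by (intro blinfun_eqI) simp
  then have GF: "G o\<^sub>L F = - (F o\<^sub>L G)" by (simp only: eq_neg_iff_add_eq_0 add.commute)
  define E where "E = (1/2) *\<^sub>R (id_blinfun + F)"
  have F_E: "2 *\<^sub>R E - id_blinfun = F" by (simp add: E_def)
  have "(G o\<^sub>L E) + (E o\<^sub>L G) = G"
    by (simp add: E_def compose_simps GF scaleR_add_right scaleR_diff_right half)
  then have GE: "G o\<^sub>L E = G - (E o\<^sub>L G)" by (simp only: eq_diff_eq)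
  have EE: "E o\<^sub>L E = E"
    unfolding E_def by (rule symmetry_imp_idempotent[OF F(3)])
  \<comment> \<open>Commuting with \<open>F\<close> and \<open>G\<close> implies commuting with
    \<open>f = C F\<close> and \<open>g = S G\<close>, hence with \<open>u\<close> and
    \<open>v\<close>, and therefore centrality.\<close>
  have uv_fg: "u = g - f" "v = f + g"
    by (simp_all add: f_def g_def half flip: scaleR_diff_right scaleR_add_right scaleR_2)
  interpret mu: matrix_units M E G
  proof (unfold_locales)
    show "E \<in> M" "selfadj E" using F by (simp_all add: E_def closure_rules)
    fix x assume x: "x \<in> M" "x o\<^sub>L E = E o\<^sub>L x" "x o\<^sub>L G = G o\<^sub>L x"
    have xF: "x o\<^sub>L F = F o\<^sub>L x" unfolding F_E[symmetric] by (simp add: compose_simps x(2))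
    have "x o\<^sub>L (C o\<^sub>L F) = (C o\<^sub>L F) o\<^sub>L x" "x o\<^sub>L (S o\<^sub>L G) = (S o\<^sub>L G) o\<^sub>L x"
      by (simp_all only: centre_left_commute[OF CZ x(1)] centre_left_commute[OF SZ x(1)] xF x(3) compose_assoc)
    then have "x o\<^sub>L f = f o\<^sub>L x" "x o\<^sub>L g = g o\<^sub>L x"
      by (simp_all only: fF(1)[symmetric] gG(1)[symmetric])
    then show "x \<in> centre M"
      by (intro central_uv x(1)) (simp_all only: uv_fg compose_simps)
  qed (fact G EE GE)+

  define p where "p = (1/2) *\<^sub>R (id_blinfun + v)"
  define q where "q = (1/2) *\<^sub>R (id_blinfun + u)"
  have p: "p \<in> M" "selfadj p" "p o\<^sub>L p = p" and q: "q \<in> M" "selfadj q" "q o\<^sub>L q = q"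
    using u v by (simp_all add: p_def q_def closure_rules symmetry_imp_idempotent)
  have p_form: "(1/2) *\<^sub>R (id_blinfun + (C o\<^sub>L (2 *\<^sub>R E - id_blinfun)) + (S o\<^sub>L G)) = p"
    and q_form: "(1/2) *\<^sub>R (id_blinfun - (C o\<^sub>L (2 *\<^sub>R E - id_blinfun)) + (S o\<^sub>L G)) = q"
    unfolding F_E fF(1)[symmetric] gG(1)[symmetric] p_def q_def uv_fg by (simp_all add: algebra_simps)
  have "M2_strict_projections TYPE('h) M p q"
    by (rule mu.M2_strict_projections_generic[OF CZ C(2) SZ S(2) _ CS, unfolded p_form q_form, OF _ p q])
      (rule S_inj)
  moreover have "a = (1/2) *\<^sub>R x0 + (w1 o\<^sub>L p) + (w2 o\<^sub>L q)"
  proof -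
    have "(1/2) *\<^sub>R x0 + (w1 o\<^sub>L p) + (w2 o\<^sub>L q) = (1/2) *\<^sub>R (x0 + (w1 + w2) + (d + s))"
      unfolding p_def q_def compose_simps compose_id du(1)[symmetric] sv(1)[symmetric]
      by (simp add: scaleR_add_right add_ac)
    then show ?thesis by (simp add: sum y_def ads add_ac)
  qed
  moreover have "b = (1/2) *\<^sub>R x0 + (w1 o\<^sub>L p) + (w2 o\<^sub>L (id_blinfun - q))"
  proof -
    have "id_blinfun - q = (1/2) *\<^sub>R (id_blinfun - u)"
      unfolding q_def using half[of id_blinfun] by (simp add: scaleR_add_right scaleR_diff_right algebra_simps)
    then have "(1/2) *\<^sub>R x0 + (w1 o\<^sub>L p) + (w2 o\<^sub>L (id_blinfun - q))
        = (1/2) *\<^sub>R x0 + (w1 o\<^sub>L p) + (w2 o\<^sub>L ((1/2) *\<^sub>R (id_blinfun - u)))" by simp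
    also have "\<dots> = (1/2) *\<^sub>R (x0 + (w1 + w2) + (s - d))"
      unfolding p_def compose_simps compose_id du(1)[symmetric] sv(1)[symmetric]
      by (simp add: scaleR_add_right scaleR_diff_right add_ac)
    finally show ?thesis by (simp add: sum y_def bds add_ac)
  qed
  ultimately show ?thesis
    using w1Z w2Z w1(2) w2(2) strict_w1 strict_w2 sum
    by (intro exI[of _ p] exI[of _ q] exI[of _ w1] exI[of _ w2] conjI)
qed

end

(* The first conjunct is the equivalence, with the abelian algebra in (ii) acting on a closed
   subspace of H; the second says that (ii) implies (i) also if that algebra acts on an arbitrary
   other Hilbert space 'k. *)
theorem theorem3p8:
  fixes a b x\<^sub>0 c :: "'h::complex_hilbert_space \<Rightarrow>\<^sub>L 'h"
    and M\<^sub>1 :: "('h \<Rightarrow>\<^sub>L 'h) set"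
  assumes "a \<in> effects" and "b \<in> effects"
    and "M\<^sub>1 = generated_vna {a, b}"
    and "positive_op x\<^sub>0" and "x\<^sub>0 \<in> centre M\<^sub>1" and "norm x\<^sub>0 < 1"
    and "c = (1 / 2) *\<^sub>R id_blinfun"
  shows "let cond_i =
        (compatible x\<^sub>0 a b \<and>
         strict_in M\<^sub>1 id_blinfun (inv_op (id_blinfun - x\<^sub>0) o\<^sub>L (a - (1 / 2) *\<^sub>R x\<^sub>0)) \<and>
         strict_in M\<^sub>1 id_blinfun (inv_op (id_blinfun - x\<^sub>0) o\<^sub>L (b - (1 / 2) *\<^sub>R x\<^sub>0)))
    in
      (cond_i \<longleftrightarrow>
        (\<exists>p q w\<^sub>1 w\<^sub>2.
          M2_strict_projections TYPE('h) M\<^sub>1 p q \<and>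
          w\<^sub>1 \<in> centre M\<^sub>1 \<and> w\<^sub>2 \<in> centre M\<^sub>1 \<and> positive_op w\<^sub>1 \<and> positive_op w\<^sub>2 \<and>
          strict_in M\<^sub>1 id_blinfun w\<^sub>1 \<and> strict_in M\<^sub>1 id_blinfun w\<^sub>2 \<and>
          w\<^sub>1 + w\<^sub>2 = id_blinfun - x\<^sub>0 \<and>
          a = (x\<^sub>0 o\<^sub>L c) + (w\<^sub>1 o\<^sub>L p) + (w\<^sub>2 o\<^sub>L q) \<and>
          b = (x\<^sub>0 o\<^sub>L c) + (w\<^sub>1 o\<^sub>L p) + (w\<^sub>2 o\<^sub>L (id_blinfun - q)))) \<and>
      ((\<exists>p q w\<^sub>1 w\<^sub>2.
          M2_strict_projections TYPE('k::complex_hilbert_space) M\<^sub>1 p q \<and>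
          w\<^sub>1 \<in> centre M\<^sub>1 \<and> w\<^sub>2 \<in> centre M\<^sub>1 \<and> positive_op w\<^sub>1 \<and> positive_op w\<^sub>2 \<and>
          strict_in M\<^sub>1 id_blinfun w\<^sub>1 \<and> strict_in M\<^sub>1 id_blinfun w\<^sub>2 \<and>
          w\<^sub>1 + w\<^sub>2 = id_blinfun - x\<^sub>0 \<and>
          a = (x\<^sub>0 o\<^sub>L c) + (w\<^sub>1 o\<^sub>L p) + (w\<^sub>2 o\<^sub>L q) \<and>
          b = (x\<^sub>0 o\<^sub>L c) + (w\<^sub>1 o\<^sub>L p) + (w\<^sub>2 o\<^sub>L (id_blinfun - q)))
        \<longrightarrow> cond_i)"
proof -
  interpret generated_by_pair a b x\<^sub>0 M\<^sub>1
    using assms by unfold_locales (simp_all add: effects_def selfadj_def)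
  have c: "x\<^sub>0 o\<^sub>L c = (1/2) *\<^sub>R x\<^sub>0" by (simp add: assms(7) compose_simps)
  note y = y_def[symmetric] and r = r_def[symmetric]
  show ?thesis
    unfolding Let_def c r y
  proof (intro conjI impI iffI)
    assume "compatible x\<^sub>0 a b \<and> strict_in M\<^sub>1 id_blinfun (r o\<^sub>L (a - (1/2) *\<^sub>R x\<^sub>0))
      \<and> strict_in M\<^sub>1 id_blinfun (r o\<^sub>L (b - (1/2) *\<^sub>R x\<^sub>0))"
    then show "\<exists>p q w\<^sub>1 w\<^sub>2. M2_strict_projections TYPE('h) M\<^sub>1 p q \<and> w\<^sub>1 \<in> centre M\<^sub>1 \<and> w\<^sub>2 \<in> centre M\<^sub>1 \<and>
      positive_op w\<^sub>1 \<and> positive_op w\<^sub>2 \<and> strict_in M\<^sub>1 id_blinfun w\<^sub>1 \<and> strict_in M\<^sub>1 id_blinfun w\<^sub>2 \<and>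
      w\<^sub>1 + w\<^sub>2 = y \<and> a = (1/2) *\<^sub>R x\<^sub>0 + (w\<^sub>1 o\<^sub>L p) + (w\<^sub>2 o\<^sub>L q) \<and>
      b = (1/2) *\<^sub>R x\<^sub>0 + (w\<^sub>1 o\<^sub>L p) + (w\<^sub>2 o\<^sub>L (id_blinfun - q))"
      by (elim conjE) (rule M2_strict_if_compatible_and_strict)
  \<comment> \<open>The remaining goals are the three clauses of (i), derived once with
    \<open>'h\<close> and once with \<open>'k\<close> carrying the abelian algebra.\<close>
  qed (elim exE conjE, rule compatible_and_strict_if_M2_strict, assumption+)+
qed

end
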